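(* Let $w$ and $v$ be the canonical unitaries in $\mathrm{C}^*(\mathbb Z_3*\mathbb Z_2)$ arising from the generators of the cyclic groups $\mathbb Z_3$ and $\mathbb Z_2$, respectively, and let $\mathrm{NCP}(3)=\mathrm{Span}\{1,w,w^2,v\}\subseteq \mathrm{C}^*(\mathbb Z_3*\mathbb Z_2)$. Then $$\mathrm P(3)^{\max}=W_{\mathrm{nc}}(w,v)\cong_{\mathrm{NCConv}} S_{\mathrm{nc}}(\mathrm{NCP}(3)).$$
   Context: $\mathrm C^*(G)$ is the full group C$^*$-algebra of the discrete group $G$; $*$ between groups denotes the free product; ucp means unital completely positive. All graded sets are indexed by the cardinals $n\in\mathbb N\cup\{\aleph_0\}$, and $\ell^2(n)$ is the Hilbert space of dimension $n$. The classical prism: $\mathrm P(3)=\mathrm{Conv}\,C_3\times[-1,1]\subset\mathbb C\times\mathbb R=\mathbb R^3$, where $C_3$ is the set of cube roots of unity in $\mathbb C$. For a tuple $\mathfrak x=(x_1,\dots,x_d)$ in an operator system with order unit $1$, let $\mathcal O_{\mathfrak x}=\mathrm{Span}\{1,x_1,x_1^*,\dots,x_d,x_d^*\}$. Then $W_n(\mathfrak x)=\{(\phi(x_1),\dots,\phi(x_d)) : \phi:\mathcal O_{\mathfrak x}\to\mathcal B(\ell^2(n)) \text{ ucp}\}$ and $W_{\mathrm{nc}}(\mathfrak x)=\bigsqcup_{n\le\aleph_0}W_n(\mathfrak x)$ (the noncommutative numerical range); $W_1(\mathfrak x)$ is the joint numerical range. $\mathrm P(3)^{\max}=\bigsqcup_{n\le\aleph_0}\mathrm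 P(3)^{\max}_n$, where $\mathrm P(3)^{\max}_n$ consists of all triples $(a,b,c)$ of selfadjoint operators in $\mathcal B(\ell^2(n))$ with $W_1(a,b,c)\subseteq \mathrm P(3)$. A pair $(x,c)$ with $c=c^*$ is identified with the selfadjoint triple $(\Re x,\Im x,c)$; with this identification $W_{\mathrm{nc}}(w,v)$ is regarded as a set of selfadjoint triples. For a finite-dimensional operator system $\mathcal R$, $S_{\mathrm{nc}}(\mathcal R)=\bigsqcup_{n\le\aleph_0}S_n(\mathcal R)$, where $S_n(\mathcal R)$ is the set of ucp maps $\mathcal R\to\mathcal B(\ell^2(n))$ (topologised by the bounded-weak topology). $\cong_{\mathrm{NCConv}}$ denotes isomorphism of noncommutative convex sets: a graded bijection, homeomorphic at each level, preserving direct sums and compressions by isometries. *)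

theory Defs
  imports
    "HOL-Analysis.Analysis"
    "HOL-Algebra.Elementary_Groups"
    "HOL-Library.Nonpos_Ints"
begin

section \<open>The Hilbert spaces \<open>\<ell>\<^sup>2\<close>\<close>

typedef 'i ell2 = "{x :: 'i \<Rightarrow> complex. (\<lambda>i. (cmod (x i))\<^sup>2) summable_on UNIV}"
  morphisms coord Abs_ell2
  by (rule exI[of _ "\<lambda>_. 0"]) simp

setup_lifting type_definition_ell2

lemma cmod_add_sq_le: "(cmod (a + b))\<^sup>2 \<le> 2 * ((cmod a)\<^sup>2 + (cmod b)\<^sup>2)"
proof -
  have "(cmod (a + b))\<^sup>2 \<le> (cmod a + cmod b)\<^sup>2"
    by (intro power_mono norm_triangle_ineq) auto
  also have "\<dots> \<le> 2 * ((cmod a)\<^sup>2 + (cmod b)\<^sup>2)"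
    using sum_squares_bound[of "cmod a" "cmod b"] by (simp add: power2_sum)
  finally show ?thesis .
qed

lemma ell2_sq_add:
  assumes "(\<lambda>i. (cmod (x i))\<^sup>2) summable_on A" "(\<lambda>i. (cmod (y i))\<^sup>2) summable_on A"
  shows "(\<lambda>i. (cmod (x i + y i))\<^sup>2) summable_on A"
  by (rule summable_on_comparison_test
      [OF summable_on_cmult_right[OF summable_on_add[OF assms], of 2]])
    (use cmod_add_sq_le in \<open>auto simp: algebra_simps\<close>)

lemma ell2_sq_cmult:
  assumes "(\<lambda>i. (cmod (x i))\<^sup>2) summable_on A"
  shows "(\<lambda>i. (cmod (c * x i))\<^sup>2) summable_on A"
  using summable_on_cmult_right[OF assms, of "(cmod c)\<^sup>2"]
  by (simp add: norm_mult power_mult_distrib)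

lemma ell2_abs_summable_prod:
  assumes "(\<lambda>i. (cmod (x i))\<^sup>2) summable_on A" "(\<lambda>i. (cmod (y i))\<^sup>2) summable_on A"
  shows "(\<lambda>i. cmod (x i * cnj (y i))) summable_on A"
proof (rule summable_on_comparison_test[OF summable_on_add[OF assms]])
  fix i
  show "cmod (x i * cnj (y i)) \<le> (cmod (x i))\<^sup>2 + (cmod (y i))\<^sup>2"
  proof -
    have "0 \<le> cmod (x i) * cmod (y i)" by simp
    then show ?thesis
      using sum_squares_bound[of "cmod (x i)" "cmod (y i)"]
      unfolding norm_mult complex_mod_cnj by linarith
  qed
qed auto

lemma coord_sq_summable: "(\<lambda>i. (cmod (coord x i))\<^sup>2) summable_on UNIV"
  using coord by blast

lemma coord_prod_summable: "(\<lambda>i. coord x i * cnj (coord y i)) summable_on UNIV"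
  by (rule abs_summable_summable)
    (rule ell2_abs_summable_prod[OF coord_sq_summable coord_sq_summable])

instantiation ell2 :: (type) ab_group_add
begin
lift_definition zero_ell2 :: "'a ell2" is "\<lambda>_. 0" by simp
lift_definition plus_ell2 :: "'a ell2 \<Rightarrow> 'a ell2 \<Rightarrow> 'a ell2" is "\<lambda>x y i. x i + y i"
  by (rule ell2_sq_add)
lift_definition uminus_ell2 :: "'a ell2 \<Rightarrow> 'a ell2" is "\<lambda>x i. - x i" by simp
lift_definition minus_ell2 :: "'a ell2 \<Rightarrow> 'a ell2 \<Rightarrow> 'a ell2" is "\<lambda>x y i. x i - y i"
  subgoal for x y using ell2_sq_add[of x UNIV "\<lambda>i. - y i"] by simp
  done
instance by standard (transfer; simp add: fun_eq_iff algebra_simps)+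
end

lift_definition cscale :: "complex \<Rightarrow> 'i ell2 \<Rightarrow> 'i ell2" is "\<lambda>c x i. c * x i"
  by (rule ell2_sq_cmult)

definition cinner :: "'i ell2 \<Rightarrow> 'i ell2 \<Rightarrow> complex" where
  "cinner x y = (\<Sum>\<^sub>\<infinity>i. coord x i * cnj (coord y i))"

lemma cinner_add_left: "cinner (x + y) z = cinner x z + cinner y z"
  unfolding cinner_def
  by (simp add: plus_ell2.rep_eq distrib_right infsum_add coord_prod_summable)

lemma cinner_cscale_left: "cinner (cscale c x) y = c * cinner x y"
  unfolding cinner_def by (simp add: cscale.rep_eq mult.assoc infsum_cmult_right')

lemma cinner_commute: "cinner x y = cnj (cinner y x)"
  unfolding cinner_def infsum_cnj[symmetric] by (simp add: mult.commute)

lemma cinner_self: "cinner x x = of_real (\<Sum>\<^sub>\<infinity>i. (cmod (coord x i))\<^sup>2)"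
proof -
  have "((\<lambda>i. complex_of_real ((cmod (coord x i))\<^sup>2)) has_sum
      of_real (\<Sum>\<^sub>\<infinity>i. (cmod (coord x i))\<^sup>2)) UNIV"
    using has_sum_of_real[OF has_sum_infsum[OF coord_sq_summable[of x]]] .
  then show ?thesis
    unfolding cinner_def complex_norm_square by (rule infsumI)
qed

instantiation ell2 :: (type) scaleR
begin
definition scaleR_ell2 :: "real \<Rightarrow> 'a ell2 \<Rightarrow> 'a ell2" where
  "scaleR_ell2 r = cscale (of_real r)"
instance ..
end

instantiation ell2 :: (type) real_inner
begin
definition inner_ell2 :: "'a ell2 \<Rightarrow> 'a ell2 \<Rightarrow> real" where
  "inner_ell2 x y = Re (cinner x y)"
definition norm_ell2 :: "'a ell2 \<Rightarrow> real" where
  "norm_ell2 x = sqrt (inner x x)"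
definition sgn_ell2 :: "'a ell2 \<Rightarrow> 'a ell2" where
  "sgn_ell2 x = scaleR (inverse (norm x)) x"
definition dist_ell2 :: "'a ell2 \<Rightarrow> 'a ell2 \<Rightarrow> real" where
  "dist_ell2 x y = norm (x - y)"
definition uniformity_ell2 :: "('a ell2 \<times> 'a ell2) filter" where
  "uniformity_ell2 = (INF e\<in>{0 <..}. principal {(x, y). dist x y < e})"
definition open_ell2 :: "'a ell2 set \<Rightarrow> bool" where
  "open_ell2 U \<longleftrightarrow> (\<forall>x\<in>U. eventually (\<lambda>(x', y). x' = x \<longrightarrow> y \<in> U) uniformity)"
instance
proof
  fix x y z :: "'a ell2" and r s :: real
  show "r *\<^sub>R (x + y) = r *\<^sub>R x + r *\<^sub>R y" "(r + s) *\<^sub>R x = r *\<^sub>R x + s *\<^sub>R x"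
    "r *\<^sub>R s *\<^sub>R x = (r * s) *\<^sub>R x" "1 *\<^sub>R x = x"
    unfolding scaleR_ell2_def by (transfer; simp add: fun_eq_iff algebra_simps)+
  show "inner x y = inner y x"
    unfolding inner_ell2_def by (subst cinner_commute) simp
  show "inner (x + y) z = inner x z + inner y z"
    unfolding inner_ell2_def by (simp add: cinner_add_left)
  show "inner (r *\<^sub>R x) y = r * inner x y"
    unfolding inner_ell2_def scaleR_ell2_def by (simp add: cinner_cscale_left)
  show "0 \<le> inner x x"
    unfolding inner_ell2_def cinner_self by (simp add: infsum_nonneg)
  show "inner x x = 0 \<longleftrightarrow> x = 0"
  proof
    assume "inner x x = 0"
    then have 0: "(\<Sum>\<^sub>\<infinity>i. (cmod (coord x i))\<^sup>2) \<le> 0"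
      by (simp add: inner_ell2_def cinner_self)
    have "(cmod (coord x i))\<^sup>2 = 0" for i
      by (rule nonneg_infsum_le_0D[OF 0 coord_sq_summable]) auto
    then show "x = 0"
      by (simp add: coord_inject[symmetric] zero_ell2.rep_eq fun_eq_iff)
  qed (simp add: inner_ell2_def cinner_self zero_ell2.rep_eq)
qed (simp_all add: norm_ell2_def sgn_ell2_def dist_ell2_def uniformity_ell2_def open_ell2_def)
end

lemma norm_ell2_sq: "(norm x)\<^sup>2 = (\<Sum>\<^sub>\<infinity>i. (cmod (coord x i))\<^sup>2)"
  by (simp add: norm_ell2_def inner_ell2_def cinner_self infsum_nonneg)

lemma norm_cscale: "norm (cscale c x) = cmod c * norm x"
proof (rule power2_eq_imp_eq)
  show "(norm (cscale c x))\<^sup>2 = (cmod c * norm x)\<^sup>2"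
    by (simp add: norm_ell2_sq power_mult_distrib cscale.rep_eq norm_mult infsum_cmult_right')
qed auto

section \<open>Bounded operators\<close>

text \<open>A bounded operator is a bounded real-linear map; complex linearity is the predicate
  \<open>clinear\<close> below, and is built into \<open>bounded_ops\<close>.\<close>

type_synonym ('i, 'j) op = "'i ell2 \<Rightarrow>\<^sub>L 'j ell2"

definition clinear :: "('i, 'j) op \<Rightarrow> bool" where
  "clinear T \<longleftrightarrow> (\<forall>c x. T (cscale c x) = cscale c (T x))"

lemma cscale_simps:
  "cscale c (x + y) = cscale c x + cscale c y" "cscale (c + d) x = cscale c x + cscale d x"
  "cscale c (cscale d x) = cscale (c * d) x" "cscale 1 x = x"
  by (transfer; simp add: fun_eq_iff algebra_simps)+

lemma bounded_linear_cscale: "bounded_linear (cscale c)"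
  by (rule bounded_linear_intro[of _ "cmod c"])
    (simp_all add: cscale_simps scaleR_ell2_def norm_cscale mult_ac)

definition scale_op :: "complex \<Rightarrow> ('i, 'j) op \<Rightarrow> ('i, 'j) op" where
  "scale_op c T = Blinfun (\<lambda>x. cscale c (T x))"

lemma scale_op_apply [simp]: "scale_op c T x = cscale c (T x)"
  unfolding scale_op_def
  by (simp add: bounded_linear_Blinfun_apply
      bounded_linear_compose[OF bounded_linear_cscale blinfun.bounded_linear_right])

lemma vector_space_scale_op:
  "vector_space (scale_op :: complex \<Rightarrow> ('i, 'j) op \<Rightarrow> ('i, 'j) op)"
proof (intro vector_space.intro allI)
qed (rule blinfun_eqI, simp add: plus_blinfun.rep_eq cscale_simps)+

global_interpretation cop: vector_space "scale_op :: complex \<Rightarrow> ('i, 'j) op \<Rightarrow> ('i, 'j) op"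
  defines cspan = cop.span
  by (rule vector_space_scale_op)

definition adj :: "('i, 'j) op \<Rightarrow> ('j, 'i) op" where
  "adj T = (THE S :: ('j, 'i) op. \<forall>x y. cinner (T x) y = cinner x (S y))"

lift_definition ket :: "'i \<Rightarrow> 'i ell2" is "\<lambda>i j. if j = i then 1 else 0"
proof -
  fix i :: 'i
  show "(\<lambda>j. (cmod (if j = i then 1 else 0))\<^sup>2) summable_on UNIV"
    by (rule finite_nonzero_values_imp_summable_on) (auto intro: finite_subset[of _ "{i}"])
qed

lemma coord_sum: "coord (\<Sum>i\<in>F. f i) j = (\<Sum>i\<in>F. coord (f i) j)"
  by (induct F rule: infinite_finite_induct) (auto simp: zero_ell2.rep_eq plus_ell2.rep_eq)

lemma coord_eqI: "(\<And>i. coord x i = coord y i) \<Longrightarrow> x = y"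
  by (simp add: coord_inject[symmetric] fun_eq_iff)

lemma inner_has_sum: "((\<lambda>i. Re (coord x i * cnj (coord y i))) has_sum inner x y) UNIV"
  unfolding inner_ell2_def cinner_def
  by (rule has_sum_Re) (rule has_sum_infsum[OF coord_prod_summable])

lemma has_sum_ket: "((\<lambda>i. cscale (coord x i) (ket i)) has_sum x) UNIV"
proof -
  let ?q = "\<lambda>i. (cmod (coord x i))\<^sup>2"
  have eq: "(norm ((\<Sum>i\<in>F. cscale (coord x i) (ket i)) - x))\<^sup>2 = (norm x)\<^sup>2 - sum ?q F" if "finite F" for F
  proof -
    have 1: "coord ((\<Sum>i\<in>F. cscale (coord x i) (ket i)) - x) j = (if j \<in> F then 0 else - coord x j)" for j
      using that by (simp add: minus_ell2.rep_eq coord_sum cscale.rep_eq ket.rep_eq if_distrib if_distribR cong: if_cong)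
    have "(norm ((\<Sum>i\<in>F. cscale (coord x i) (ket i)) - x))\<^sup>2 = infsum (\<lambda>j. if j \<in> F then 0 else ?q j) UNIV"
      unfolding norm_ell2_sq 1 by (rule infsum_cong) auto
    also have "\<dots> = infsum ?q (UNIV - F)"
      by (rule infsum_cong_neutral) auto
    also have "\<dots> = infsum ?q UNIV - infsum ?q F"
      by (rule infsum_Diff) (auto simp: coord_sq_summable that)
    finally show ?thesis using that by (simp add: norm_ell2_sq)
  qed
  have "(sum ?q \<longlongrightarrow> (norm x)\<^sup>2) (finite_subsets_at_top UNIV)"
    using has_sum_infsum[OF coord_sq_summable, of x] by (simp add: norm_ell2_sq has_sum_def)
  then have "((\<lambda>F. (norm x)\<^sup>2 - sum ?q F) \<longlongrightarrow> (norm x)\<^sup>2 - (norm x)\<^sup>2) (finite_subsets_at_top UNIV)"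
    by (intro tendsto_intros)
  then have "((\<lambda>F. sqrt ((norm x)\<^sup>2 - sum ?q F)) \<longlongrightarrow> 0) (finite_subsets_at_top UNIV)"
    using tendsto_real_sqrt by fastforce
  then have "((\<lambda>F. norm ((\<Sum>i\<in>F. cscale (coord x i) (ket i)) - x)) \<longlongrightarrow> 0) (finite_subsets_at_top UNIV)"
  proof (rule Lim_transform_eventually)
    show "\<forall>\<^sub>F F in finite_subsets_at_top UNIV. sqrt ((norm x)\<^sup>2 - sum ?q F) = norm ((\<Sum>i\<in>F. cscale (coord x i) (ket i)) - x)"
      by (rule eventually_finite_subsets_at_top_weakI) (simp add: eq[symmetric])
  qed
  then show ?thesis
    unfolding has_sum_def by (simp add: tendsto_norm_zero_iff LIM_zero_iff)
qed

lemma adj_exists: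
  assumes T: "clinear (T :: ('i,'j) op)"
  shows "\<exists>S. \<forall>x y. cinner (T x) y = cinner x (blinfun_apply S y)"
proof -
  define g where "g y i = cnj (cinner (T (ket i)) y)" for y i
  have fin: "sum (\<lambda>i. (cmod (g y i))\<^sup>2) F \<le> (norm T * norm y)\<^sup>2" if F: "finite F" for F y
  proof -
    let ?s = "sum (\<lambda>i. (cmod (g y i))\<^sup>2) F"
    let ?x = "\<Sum>i\<in>F. cscale (g y i) (ket i)"
    have "coord ?x j = (if j \<in> F then g y j else 0)" for j
      using F by (simp add: coord_sum cscale.rep_eq ket.rep_eq if_distrib if_distribR cong: if_cong)
    then have "(norm ?x)\<^sup>2 = infsum (\<lambda>j. if j \<in> F then (cmod (g y j))\<^sup>2 else 0) UNIV"
      unfolding norm_ell2_sq by (intro infsum_cong) auto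
    also have "\<dots> = infsum (\<lambda>j. (cmod (g y j))\<^sup>2) F"
      by (rule infsum_cong_neutral) auto
    finally have nx: "(norm ?x)\<^sup>2 = ?s" using F by simp
    have "inner (T ?x) y = (\<Sum>i\<in>F. inner (T (cscale (g y i) (ket i))) y)"
      by (simp add: blinfun.sum_right inner_sum_left)
    also have "\<dots> = ?s"
    proof (rule sum.cong[OF refl])
      fix i
      have "inner (T (cscale (g y i) (ket i))) y = Re (g y i * cnj (g y i))"
        using T by (simp add: clinear_def inner_ell2_def cinner_cscale_left g_def)
      then show "inner (T (cscale (g y i) (ket i))) y = (cmod (g y i))\<^sup>2"
        by (simp add: complex_norm_square[symmetric] del: of_real_power)
    qed
    finally have "?s \<le> norm (T ?x) * norm y"
      using norm_cauchy_schwarz[of "T ?x" y] by simp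
    also have "\<dots> \<le> (norm T * norm ?x) * norm y"
      by (intro mult_right_mono norm_blinfun) auto
    finally have le: "(norm ?x)\<^sup>2 \<le> norm ?x * (norm T * norm y)" by (simp add: nx mult_ac)
    have "norm ?x \<le> norm T * norm y"
    proof (cases "norm ?x = 0")
      case False
      then have "norm ?x > 0" by simp
      with le show ?thesis by (simp add: power2_eq_square)
    qed (simp add: zero_le_mult_iff)
    then have "(norm ?x)\<^sup>2 \<le> (norm T * norm y)\<^sup>2" by (intro power_mono) auto
    then show ?thesis unfolding nx .
  qed
  have sm: "(\<lambda>i. (cmod (g y i))\<^sup>2) summable_on UNIV" for y
    by (rule nonneg_bdd_above_summable_on) (auto intro!: bdd_aboveI fin)
  define S where "S y = Abs_ell2 (g y)" for y
  have cS: "coord (S y) = g y" for y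
    unfolding S_def by (rule Abs_ell2_inverse) (simp add: sm)
  have cadd: "cinner x (y + z) = cinner x y + cinner x z" for x y z :: "'k ell2"
    by (subst (1 2 3) cinner_commute) (simp add: cinner_add_left)
  have csc: "cinner x (cscale c y) = cnj c * cinner x y" for x y :: "'k ell2" and c
    by (subst (1 2) cinner_commute) (simp add: cinner_cscale_left)
  have bl: "bounded_linear S"
  proof (rule bounded_linear_intro[of _ "norm T"])
    show "S (x + y) = S x + S y" for x y
      by (rule coord_eqI) (simp add: cS plus_ell2.rep_eq g_def cadd)
    show "S (r *\<^sub>R x) = r *\<^sub>R S x" for r x
      by (rule coord_eqI) (simp add: cS scaleR_ell2_def cscale.rep_eq g_def csc)
    show "norm (S x) \<le> norm x * norm T" for x
    proof (rule power2_le_imp_le)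
      show "(norm (S x))\<^sup>2 \<le> (norm x * norm T)\<^sup>2"
        unfolding norm_ell2_sq cS
        by (rule infsum_le_finite_sums[OF sm]) (use fin[of _ x] in \<open>simp add: mult.commute\<close>)
    qed auto
  qed
  have re: "inner (T x) y = inner x (S y)" for x y
  proof -
    have "((\<lambda>i. inner (T (cscale (coord x i) (ket i))) y) has_sum inner (T x) y) UNIV"
      by (rule has_sum_bounded_linear[OF _ has_sum_ket, of "\<lambda>v. inner (T v) y"])
        (rule bounded_linear_compose[OF bounded_linear_inner_left blinfun.bounded_linear_right])
    moreover have "inner (T (cscale (coord x i) (ket i))) y = Re (coord x i * cnj (coord (S y) i))" for i
      using T by (simp add: clinear_def inner_ell2_def cinner_cscale_left cS g_def)
    ultimately show ?thesis
      using inner_has_sum[of x "S y"] has_sum_unique by fastforce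
  qed
  have "cinner (T x) y = cinner x (S y)" for x y
  proof (rule complex_eqI)
    show "Re (cinner (T x) y) = Re (cinner x (S y))"
      using re[of x y] by (simp add: inner_ell2_def)
    show "Im (cinner (T x) y) = Im (cinner x (S y))"
      using re[of "cscale (-\<i>) x" y] T by (simp add: inner_ell2_def clinear_def cinner_cscale_left)
  qed
  then show ?thesis using bounded_linear_Blinfun_apply[OF bl] by metis
qed

lemma adj_unique:
  assumes "\<forall>x y. cinner (blinfun_apply T x) y = cinner x (blinfun_apply S y)"
  shows "adj T = S"
  unfolding adj_def
proof (rule the_equality)
  fix S' assume S': "\<forall>x y. cinner (T x) y = cinner x (blinfun_apply S' y)"
  show "S' = S"
  proof (rule blinfun_eqI)
    fix y
    have "inner (S' y - S y) (S' y - S y) = 0"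
      using assms S' by (simp add: inner_diff_right) (simp add: inner_ell2_def)
    then show "S' y = S y" by simp
  qed
qed (fact assms)

lemma cinner_adj: "clinear T \<Longrightarrow> cinner (T x) y = cinner x (adj T y)"
  using adj_exists[of T] adj_unique[of T] by metis

text \<open>For \<open>I \<subseteq> 'i\<close> the space \<open>\<ell>\<^sup>2(I)\<close> is the subspace of \<open>\<ell>\<^sup>2('i)\<close> of vectors supported
  in \<open>I\<close>, with orthogonal projection \<open>proj I\<close>. An operator from \<open>\<ell>\<^sup>2(I)\<close> to \<open>\<ell>\<^sup>2(J)\<close> is extended
  by zero to the orthogonal complement of \<open>\<ell>\<^sup>2(I)\<close>, so the identity of \<open>\<ell>\<^sup>2(I)\<close> becomes
  \<open>proj I\<close>.\<close>

lift_definition restrict_ell2 :: "'i set \<Rightarrow> 'i ell2 \<Rightarrow> 'i ell2"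
  is "\<lambda>I x i. if i \<in> I then x i else 0"
proof -
  fix I :: "'i set" and x :: "'i \<Rightarrow> complex"
  assume "(\<lambda>i. (cmod (x i))\<^sup>2) summable_on UNIV"
  then show "(\<lambda>i. (cmod (if i \<in> I then x i else 0))\<^sup>2) summable_on UNIV"
    by (rule summable_on_comparison_test) auto
qed

lemma bounded_linear_restrict_ell2: "bounded_linear (restrict_ell2 I)"
proof (rule bounded_linear_intro[of _ 1])
  fix x y :: "'a ell2" and r :: real
  show "restrict_ell2 I (x + y) = restrict_ell2 I x + restrict_ell2 I y"
    by transfer (simp add: fun_eq_iff)
  show "restrict_ell2 I (r *\<^sub>R x) = r *\<^sub>R restrict_ell2 I x"
    unfolding scaleR_ell2_def by transfer (simp add: fun_eq_iff)
  have "(norm (restrict_ell2 I x))\<^sup>2 \<le> (norm x)\<^sup>2"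
    unfolding norm_ell2_sq
    by (intro infsum_mono coord_sq_summable) (simp add: restrict_ell2.rep_eq)
  then show "norm (restrict_ell2 I x) \<le> norm x * 1"
    by (auto dest: power2_le_imp_le)
qed

definition proj :: "'i set \<Rightarrow> ('i, 'i) op" where
  "proj I = Blinfun (restrict_ell2 I)"

lemma proj_apply [simp]: "proj I x = restrict_ell2 I x"
  by (simp add: proj_def bounded_linear_Blinfun_apply bounded_linear_restrict_ell2)

definition bounded_ops :: "'i set \<Rightarrow> 'j set \<Rightarrow> ('i, 'j) op set" where
  "bounded_ops I J = {T. clinear T \<and> proj J o\<^sub>L T o\<^sub>L proj I = T}"

text \<open>Index set of \<open>\<ell>\<^sup>2(n)\<close>, where \<open>\<infinity>\<close> stands for \<open>\<aleph>\<^sub>0\<close>.\<close>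

definition below :: "enat \<Rightarrow> nat set" where
  "below n = {k. enat k < n}"

abbreviation BL :: "enat \<Rightarrow> (nat, nat) op set" where
  "BL n \<equiv> bounded_ops (below n) (below n)"

text \<open>The \<open>\<sigma>\<close>-weak (weak*) topology.\<close>

definition ultraweak :: "('i, 'j) op topology" where
  "ultraweak = topology_generated_by
     {{T. (\<Sum>k::nat. cinner (blinfun_apply T (\<xi> k)) (\<eta> k)) \<in> U} | \<xi> \<eta> U.
        summable (\<lambda>k. (norm (\<xi> k))\<^sup>2) \<and> summable (\<lambda>k. (norm (\<eta> k))\<^sup>2) \<and> open U}"

section \<open>Operator systems and noncommutative numerical ranges\<close>

text \<open>Positivity of the matrix \<open>(T i j)\<close>, \<open>i, j < k\<close>, as an operator on the \<open>k\<close>-fold direct sum.\<close>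

definition pos_matrix :: "nat \<Rightarrow> (nat \<Rightarrow> nat \<Rightarrow> ('i, 'i) op) \<Rightarrow> bool" where
  "pos_matrix k T \<longleftrightarrow>
     (\<forall>\<xi>. (\<Sum>i<k. \<Sum>j<k. cinner (T i j (\<xi> j)) (\<xi> i)) \<in> \<real>\<^sub>\<ge>\<^sub>0)"

text \<open>The unital completely positive maps into \<open>B(\<ell>\<^sup>2(n))\<close> on an operator system
  \<open>S \<subseteq> B(\<ell>\<^sup>2(I))\<close>, whose order unit is \<open>proj I\<close>.\<close>

definition ucp :: "'i set \<Rightarrow> ('i, 'i) op set \<Rightarrow> enat \<Rightarrow> (('i, 'i) op \<Rightarrow> (nat, nat) op) set" where
  "ucp I S n = {\<phi> \<in> S \<rightarrow>\<^sub>E BL n.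
     (\<forall>x\<in>S. \<forall>y\<in>S. \<phi> (x + y) = \<phi> x + \<phi> y) \<and>
     (\<forall>c. \<forall>x\<in>S. \<phi> (scale_op c x) = scale_op c (\<phi> x)) \<and>
     \<phi> (proj I) = proj (below n) \<and>
     (\<forall>k T. (\<forall>i<k. \<forall>j<k. T i j \<in> S) \<longrightarrow> pos_matrix k T \<longrightarrow> pos_matrix k (\<lambda>i j. \<phi> (T i j)))}"

definition opsys :: "'i set \<Rightarrow> ('i, 'i) op list \<Rightarrow> ('i, 'i) op set" where
  "opsys I xs = cspan ({proj I} \<union> set xs \<union> adj ` set xs)"

definition W_nc :: "'i set \<Rightarrow> ('i, 'i) op list \<Rightarrow> enat \<Rightarrow> (nat, nat) op list set" where
  "W_nc I xs n = {map \<phi> xs | \<phi>. \<phi> \<in> ucp I (opsys I xs) n}"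

section \<open>Noncommutative convex sets\<close>

record 'x nc_set =
  level :: "enat \<Rightarrow> 'x set"
  level_top :: "enat \<Rightarrow> 'x topology"
  compress :: "(nat, nat) op \<Rightarrow> 'x \<Rightarrow> 'x"
  dsum :: "nat set \<Rightarrow> (nat \<Rightarrow> (nat, nat) op) \<Rightarrow> (nat \<Rightarrow> 'x) \<Rightarrow> 'x \<Rightarrow> bool"

definition isometries :: "enat \<Rightarrow> enat \<Rightarrow> (nat, nat) op set" where
  "isometries m n = {\<beta> \<in> bounded_ops (below m) (below n). adj \<beta> o\<^sub>L \<beta> = proj (below m)}"

text \<open>Isometries \<open>\<alpha> i : \<ell>\<^sup>2(m i) \<rightarrow> \<ell>\<^sup>2(n)\<close> which identify \<open>\<ell>\<^sup>2(n)\<close> with the direct sum of the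
  \<open>\<ell>\<^sup>2(m i)\<close>, \<open>i \<in> N\<close>.\<close>

definition decomposition ::
  "nat set \<Rightarrow> (nat \<Rightarrow> enat) \<Rightarrow> enat \<Rightarrow> (nat \<Rightarrow> (nat, nat) op) \<Rightarrow> bool" where
  "decomposition N m n \<alpha> \<longleftrightarrow> (\<forall>i\<in>N. \<alpha> i \<in> isometries (m i) n) \<and>
     (\<forall>\<xi>. ((\<lambda>i. \<alpha> i (adj (\<alpha> i) \<xi>)) has_sum proj (below n) \<xi>) N)"

definition nc_convex :: "'x nc_set \<Rightarrow> bool" where
  "nc_convex K \<longleftrightarrow>
     (\<forall>m n. \<forall>\<beta>\<in>isometries m n. \<forall>x\<in>level K n. compress K \<beta> x \<in> level K m) \<and>
     (\<forall>N m n \<alpha> x. decomposition N m n \<alpha> \<longrightarrow> (\<forall>i\<in>N. x i \<in> level K (m i)) \<longrightarrow>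
        (\<exists>y\<in>level K n. dsum K N \<alpha> x y))"

text \<open>The levels, being sets of operators on \<open>\<ell>\<^sup>2(nat)\<close>, may overlap, hence a graded map is a
  family of maps indexed by the level.\<close>

definition nc_iso :: "'x nc_set \<Rightarrow> 'y nc_set \<Rightarrow> (enat \<Rightarrow> 'x \<Rightarrow> 'y) \<Rightarrow> bool" where
  "nc_iso K L \<theta> \<longleftrightarrow>
     (\<forall>n. bij_betw (\<theta> n) (level K n) (level L n) \<and>
          homeomorphic_map (level_top K n) (level_top L n) (\<theta> n)) \<and>
     (\<forall>m n. \<forall>\<beta>\<in>isometries m n. \<forall>x\<in>level K n.
        \<theta> m (compress K \<beta> x) = compress L \<beta> (\<theta> n x)) \<and>
     (\<forall>N m n \<alpha> x. \<forall>y\<in>level K n.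
        decomposition N m n \<alpha> \<longrightarrow> (\<forall>i\<in>N. x i \<in> level K (m i)) \<longrightarrow> dsum K N \<alpha> x y \<longrightarrow>
        dsum L N \<alpha> (\<lambda>i. \<theta> (m i) (x i)) (\<theta> n y))"

definition nc_isomorphic :: "'x nc_set \<Rightarrow> 'y nc_set \<Rightarrow> bool" where
  "nc_isomorphic K L \<longleftrightarrow> nc_convex K \<and> nc_convex L \<and> (\<exists>\<theta>. nc_iso K L \<theta>)"

definition op_compress :: "(nat, nat) op \<Rightarrow> (nat, nat) op \<Rightarrow> (nat, nat) op" where
  "op_compress \<beta> T = adj \<beta> o\<^sub>L T o\<^sub>L \<beta>"

text \<open>\<open>y = \<Sum>i\<in>N. \<alpha> i x i (\<alpha> i)*\<close>, with strong convergence.\<close>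

definition op_dsum ::
  "nat set \<Rightarrow> (nat \<Rightarrow> (nat, nat) op) \<Rightarrow> (nat \<Rightarrow> (nat, nat) op) \<Rightarrow> (nat, nat) op \<Rightarrow> bool" where
  "op_dsum N \<alpha> x y \<longleftrightarrow>
     (\<forall>\<xi>. ((\<lambda>i. \<alpha> i (x i (adj (\<alpha> i) \<xi>))) has_sum y \<xi>) N)"

type_synonym op_triple = "(nat, nat) op \<times> (nat, nat) op \<times> (nat, nat) op"

definition triple_nc_set :: "(enat \<Rightarrow> op_triple set) \<Rightarrow> op_triple nc_set" where
  "triple_nc_set K = \<lparr>
     level = K,
     level_top = (\<lambda>n.
       subtopology (prod_topology ultraweak (prod_topology ultraweak ultraweak)) (K n)),
     compress = (\<lambda>\<beta> (a, b, c). (op_compress \<beta> a, op_compress \<beta> b, op_compress \<beta> c)),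
     dsum = (\<lambda>N \<alpha> x (a, b, c).
       op_dsum N \<alpha> (\<lambda>i. fst (x i)) a \<and>
       op_dsum N \<alpha> (\<lambda>i. fst (snd (x i))) b \<and>
       op_dsum N \<alpha> (\<lambda>i. snd (snd (x i))) c)\<rparr>"

text \<open>On the bounded set of ucp maps the bounded-weak topology is the topology of pointwise
  weak* convergence.\<close>

definition S_nc ::
  "'i set \<Rightarrow> ('i, 'i) op set \<Rightarrow> (('i, 'i) op \<Rightarrow> (nat, nat) op) nc_set" where
  "S_nc I R = \<lparr>
     level = ucp I R,
     level_top = (\<lambda>n. subtopology (product_topology (\<lambda>_. ultraweak) R) (ucp I R n)),
     compress = (\<lambda>\<beta> \<phi>. \<lambda>r\<in>R. op_compress \<beta> (\<phi> r)),
     dsum = (\<lambda>N \<alpha> \<phi> \<psi>. \<forall>r\<in>R. op_dsum N \<alpha> (\<lambda>i. \<phi> i r) (\<psi> r))\<rparr>"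

section \<open>The maximal noncommutative prism\<close>

definition P3 :: "(complex \<times> real) set" where
  "P3 = (convex hull {z. z ^ 3 = 1}) \<times> {-1..1}"

lift_definition basis0 :: "nat ell2" is "\<lambda>i. if i = 0 then 1 else 0"
  by (rule finite_nonzero_values_imp_summable_on) (auto intro: finite_subset[of _ "{0}"])

text \<open>The identification of \<open>B(\<ell>\<^sup>2(1))\<close> with the complex numbers.\<close>

definition scalar_of :: "(nat, nat) op \<Rightarrow> complex" where
  "scalar_of T = cinner (T basis0) basis0"

text \<open>For selfadjoint triples the scalars below are real, and \<open>(\<alpha>, \<beta>, \<gamma>) \<in> \<real>\<^sup>3\<close> corresponds to
  \<open>(\<alpha> + i \<beta>, \<gamma>) \<in> \<complex> \<times> \<real>\<close>.\<close>

definition P3_max :: "enat \<Rightarrow> op_triple set" where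
  "P3_max n = {(a, b, c).
     a \<in> BL n \<and> b \<in> BL n \<and> c \<in> BL n \<and> adj a = a \<and> adj b = b \<and> adj c = c \<and>
     (\<forall>\<alpha> \<beta> \<gamma>. [\<alpha>, \<beta>, \<gamma>] \<in> W_nc (below n) [a, b, c] 1 \<longrightarrow>
        (Complex (Re (scalar_of \<alpha>)) (Re (scalar_of \<beta>)), Re (scalar_of \<gamma>)) \<in> P3)}"

definition re_op :: "('i, 'i) op \<Rightarrow> ('i, 'i) op" where
  "re_op x = scale_op (1 / 2) (x + adj x)"

definition im_op :: "('i, 'i) op \<Rightarrow> ('i, 'i) op" where
  "im_op x = scale_op (1 / (2 * \<i>)) (x - adj x)"

definition as_triples :: "(enat \<Rightarrow> (nat, nat) op list set) \<Rightarrow> enat \<Rightarrow> op_triple set" where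
  "as_triples K n = {(re_op x, im_op x, c) | x c. [x, c] \<in> K n}"

section \<open>Free products of groups\<close>

abbreviation fp_words :: "('a, 'c) monoid_scheme \<Rightarrow> ('b, 'd) monoid_scheme \<Rightarrow> ('a + 'b) list set" where
  "fp_words G H \<equiv> lists (carrier G <+> carrier H)"

inductive_set fp_rel ::
  "('a, 'c) monoid_scheme \<Rightarrow> ('b, 'd) monoid_scheme \<Rightarrow> (('a + 'b) list \<times> ('a + 'b) list) set"
  for G H where
    fp_refl: "u \<in> fp_words G H \<Longrightarrow> (u, u) \<in> fp_rel G H"
  | fp_sym: "(u, v) \<in> fp_rel G H \<Longrightarrow> (v, u) \<in> fp_rel G H"
  | fp_trans: "(u, v) \<in> fp_rel G H \<Longrightarrow> (v, w) \<in> fp_rel G H \<Longrightarrow> (u, w) \<in> fp_rel G H"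
  | fp_oneL: "u \<in> fp_words G H \<Longrightarrow> v \<in> fp_words G H \<Longrightarrow>
      (u @ [Inl \<one>\<^bsub>G\<^esub>] @ v, u @ v) \<in> fp_rel G H"
  | fp_oneR: "u \<in> fp_words G H \<Longrightarrow> v \<in> fp_words G H \<Longrightarrow>
      (u @ [Inr \<one>\<^bsub>H\<^esub>] @ v, u @ v) \<in> fp_rel G H"
  | fp_multL: "u \<in> fp_words G H \<Longrightarrow> v \<in> fp_words G H \<Longrightarrow> g \<in> carrier G \<Longrightarrow> g' \<in> carrier G \<Longrightarrow>
      (u @ [Inl g, Inl g'] @ v, u @ [Inl (g \<otimes>\<^bsub>G\<^esub> g')] @ v) \<in> fp_rel G H"
  | fp_multR: "u \<in> fp_words G H \<Longrightarrow> v \<in> fp_words G H \<Longrightarrow> h \<in> carrier H \<Longrightarrow> h' \<in> carrier H \<Longrightarrow>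
      (u @ [Inr h, Inr h'] @ v, u @ [Inr (h \<otimes>\<^bsub>H\<^esub> h')] @ v) \<in> fp_rel G H"

definition free_product ::
  "('a, 'c) monoid_scheme \<Rightarrow> ('b, 'd) monoid_scheme \<Rightarrow> ('a + 'b) list set monoid" where
  "free_product G H = \<lparr>
     carrier = fp_words G H // fp_rel G H,
     monoid.mult = (\<lambda>A B. \<Union>a\<in>A. \<Union>b\<in>B. fp_rel G H `` {a @ b}),
     one = fp_rel G H `` {[]}\<rparr>"

definition fp_inl ::
  "('a, 'c) monoid_scheme \<Rightarrow> ('b, 'd) monoid_scheme \<Rightarrow> 'a \<Rightarrow> ('a + 'b) list set" where
  "fp_inl G H g = fp_rel G H `` {[Inl g]}"

definition fp_inr ::
  "('a, 'c) monoid_scheme \<Rightarrow> ('b, 'd) monoid_scheme \<Rightarrow> 'b \<Rightarrow> ('a + 'b) list set" where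
  "fp_inr G H h = fp_rel G H `` {[Inr h]}"

lemma fp_rel_words: "(u, v) \<in> fp_rel G H \<Longrightarrow> group G \<Longrightarrow> group H \<Longrightarrow> u \<in> fp_words G H \<and> v \<in> fp_words G H"
  by (induction rule: fp_rel.induct) (auto simp: group.is_monoid monoid.m_closed monoid.one_closed)

lemma fp_rel_context:
  assumes "(u, v) \<in> fp_rel G H" "a \<in> fp_words G H" "b \<in> fp_words G H"
  shows "(a @ u @ b, a @ v @ b) \<in> fp_rel G H"
  using assms(1)
proof (induction rule: fp_rel.induct)
  case (fp_refl u) then show ?case using assms by (intro fp_rel.fp_refl) auto
next
  case (fp_sym u v) show ?case by (rule fp_rel.fp_sym[OF fp_sym.IH])
next
  case (fp_trans u v w) show ?case by (rule fp_rel.fp_trans[OF fp_trans.IH])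
next
  case (fp_oneL u v)
  then show ?case using fp_rel.fp_oneL[of "a @ u" G H "v @ b"] assms by simp
next
  case (fp_oneR u v)
  then show ?case using fp_rel.fp_oneR[of "a @ u" G H "v @ b"] assms by simp
next
  case (fp_multL u v g h)
  then show ?case using fp_rel.fp_multL[of "a @ u" G H "v @ b" g h] assms by simp
next
  case (fp_multR u v g h)
  then show ?case using fp_rel.fp_multR[of "a @ u" G H "v @ b" g h] assms by simp
qed

context
  fixes G :: "('a, 'c) monoid_scheme" and H :: "('b, 'd) monoid_scheme"
  assumes G: "group G" and H: "group H"
begin

lemma equiv_fp_rel: "equiv (fp_words G H) (fp_rel G H)"
proof (rule equivI)
  show "fp_rel G H \<subseteq> fp_words G H \<times> fp_words G H" using fp_rel_words[OF _ G H] by auto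
  show "refl_on (fp_words G H) (fp_rel G H)" by (rule refl_onI) (rule fp_rel.fp_refl)
  show "Relation.sym (fp_rel G H)" by (rule symI) (rule fp_rel.fp_sym)
  show "Relation.trans (fp_rel G H)" by (rule transI) (rule fp_rel.fp_trans)
qed

lemma fp_rel_append:
  assumes "(u, u') \<in> fp_rel G H" "(v, v') \<in> fp_rel G H"
  shows "(u @ v, u' @ v') \<in> fp_rel G H"
proof -
  have w: "u \<in> fp_words G H" "u' \<in> fp_words G H" "v \<in> fp_words G H" "v' \<in> fp_words G H"
    using fp_rel_words[OF _ G H] assms by blast+
  have "(u @ v, u' @ v) \<in> fp_rel G H" using fp_rel_context[OF assms(1), of "[]" v] w by simp
  moreover have "(u' @ v, u' @ v') \<in> fp_rel G H" using fp_rel_context[OF assms(2), of u' "[]"] w by simp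
  ultimately show ?thesis by (rule fp_rel.fp_trans)
qed

lemma fp_mult:
  assumes "u \<in> fp_words G H" "v \<in> fp_words G H"
  shows "(fp_rel G H `` {u}) \<otimes>\<^bsub>free_product G H\<^esub> (fp_rel G H `` {v}) = fp_rel G H `` {u @ v}"
proof -
  have c: "fp_rel G H `` {a @ b} = fp_rel G H `` {u @ v}"
    if "a \<in> fp_rel G H `` {u}" "b \<in> fp_rel G H `` {v}" for a b
  proof (rule equiv_class_eq[OF equiv_fp_rel], rule fp_rel.fp_sym, rule fp_rel_append)
    show "(u, a) \<in> fp_rel G H" "(v, b) \<in> fp_rel G H" using that by (simp_all add: Image_singleton_iff)
  qed
  have uv: "u \<in> fp_rel G H `` {u}" "v \<in> fp_rel G H `` {v}"
    using fp_rel.fp_refl[OF assms(1)] fp_rel.fp_refl[OF assms(2)] by (simp_all add: Image_singleton_iff)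
  have "(\<Union>a\<in>fp_rel G H `` {u}. \<Union>b\<in>fp_rel G H `` {v}. fp_rel G H `` {a @ b})
      = fp_rel G H `` {u @ v}"
    (is "?L = ?R")
  proof (intro equalityI subsetI)
    fix w assume "w \<in> ?L"
    then obtain a b where ab: "a \<in> fp_rel G H `` {u}" "b \<in> fp_rel G H `` {v}" "w \<in> fp_rel G H `` {a @ b}"
      by (elim UN_E)
    then show "w \<in> ?R" by (simp only: c)
  next
    fix w assume "w \<in> ?R"
    with uv(2) have "w \<in> (\<Union>b\<in>fp_rel G H `` {v}. fp_rel G H `` {u @ b})" by (rule UN_I)
    with uv(1) show "w \<in> ?L" by (rule UN_I)
  qed
  then show ?thesis by (simp add: free_product_def)
qed

lemma fp_rel_inverse:
  "u \<in> fp_words G H \<Longrightarrow> \<exists>v\<in>fp_words G H. (v @ u, []) \<in> fp_rel G H"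
proof (induction u)
  case Nil then show ?case using fp_rel.fp_refl[of "[]" G H] by auto
next
  case (Cons x u)
  then obtain v where v: "v \<in> fp_words G H" "(v @ u, []) \<in> fp_rel G H" by auto
  have u: "u \<in> fp_words G H" using Cons by auto
  obtain y where y: "y \<in> carrier G <+> carrier H" "([y, x], []) \<in> fp_rel G H"
  proof (cases x)
    case (Inl g)
    then have g: "g \<in> carrier G" using Cons by auto
    have i: "inv\<^bsub>G\<^esub> g \<in> carrier G" using g G by (simp add: group.inv_closed)
    have "([Inl (inv\<^bsub>G\<^esub> g), Inl g], [Inl \<one>\<^bsub>G\<^esub>]) \<in> fp_rel G H"
      using fp_rel.fp_multL[of "[]" G H "[]" "inv\<^bsub>G\<^esub> g" g] g i G by (simp add: group.l_inv)
    moreover have "([Inl \<one>\<^bsub>G\<^esub>], []) \<in> fp_rel G H" using fp_rel.fp_oneL[of "[]" G H "[]"] by simp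
    ultimately have "([Inl (inv\<^bsub>G\<^esub> g), Inl g], []) \<in> fp_rel G H" by (rule fp_rel.fp_trans)
    then show ?thesis using that[of "Inl (inv\<^bsub>G\<^esub> g)"] i Inl by auto
  next
    case (Inr g)
    then have g: "g \<in> carrier H" using Cons by auto
    have i: "inv\<^bsub>H\<^esub> g \<in> carrier H" using g H by (simp add: group.inv_closed)
    have "([Inr (inv\<^bsub>H\<^esub> g), Inr g], [Inr \<one>\<^bsub>H\<^esub>]) \<in> fp_rel G H"
      using fp_rel.fp_multR[of "[]" G H "[]" "inv\<^bsub>H\<^esub> g" g] g i H by (simp add: group.l_inv)
    moreover have "([Inr \<one>\<^bsub>H\<^esub>], []) \<in> fp_rel G H" using fp_rel.fp_oneR[of "[]" G H "[]"] by simp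
    ultimately have "([Inr (inv\<^bsub>H\<^esub> g), Inr g], []) \<in> fp_rel G H" by (rule fp_rel.fp_trans)
    then show ?thesis using that[of "Inr (inv\<^bsub>H\<^esub> g)"] i Inr by auto
  qed
  have "((v @ [y]) @ x # u, v @ u) \<in> fp_rel G H"
    using fp_rel_context[OF y(2) v(1) u] by simp
  then have "((v @ [y]) @ x # u, []) \<in> fp_rel G H" using v(2) by (rule fp_rel.fp_trans)
  moreover have "v @ [y] \<in> fp_words G H" using v y by auto
  ultimately show ?case by blast
qed

lemma group_free_product: "group (free_product G H)"
proof (rule groupI)
  let ?P = "free_product G H"
  have car: "carrier ?P = (\<lambda>u. fp_rel G H `` {u}) ` fp_words G H"
    by (auto simp: free_product_def quotient_def)
  have one: "\<one>\<^bsub>?P\<^esub> = fp_rel G H `` {[]}" by (simp add: free_product_def)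
  show "\<one>\<^bsub>?P\<^esub> \<in> carrier ?P" unfolding one car by auto
  fix x assume "x \<in> carrier ?P"
  then obtain u where u: "u \<in> fp_words G H" "x = fp_rel G H `` {u}" unfolding car by auto
  show "\<one>\<^bsub>?P\<^esub> \<otimes>\<^bsub>?P\<^esub> x = x" unfolding one u(2) using fp_mult[of "[]" u] u(1) by simp
  obtain v where v: "v \<in> fp_words G H" "(v @ u, []) \<in> fp_rel G H" using fp_rel_inverse u by blast
  show "\<exists>y\<in>carrier ?P. y \<otimes>\<^bsub>?P\<^esub> x = \<one>\<^bsub>?P\<^esub>"
    unfolding car one using v u fp_mult equiv_class_eq[OF equiv_fp_rel v(2)] by auto
  fix y assume "y \<in> carrier ?P"
  then obtain u' where u': "u' \<in> fp_words G H" "y = fp_rel G H `` {u'}" unfolding car by auto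
  show "x \<otimes>\<^bsub>?P\<^esub> y \<in> carrier ?P" unfolding u u' using fp_mult u u' car by auto
  fix z assume "z \<in> carrier ?P"
  then obtain w where w: "w \<in> fp_words G H" "z = fp_rel G H `` {w}" unfolding car by auto
  have "u @ u' \<in> fp_words G H" "u' @ w \<in> fp_words G H" using u u' w by auto
  then show "x \<otimes>\<^bsub>?P\<^esub> y \<otimes>\<^bsub>?P\<^esub> z = x \<otimes>\<^bsub>?P\<^esub> (y \<otimes>\<^bsub>?P\<^esub> z)"
    unfolding u(2) u'(2) w(2) using fp_mult u(1) u'(1) w(1) by simp
qed

lemma fp_inl_hom: "fp_inl G H \<in> hom G (free_product G H)"
proof (rule homI)
  fix x y assume xy: "x \<in> carrier G" "y \<in> carrier G"
  show "fp_inl G H x \<in> carrier (free_product G H)"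
    using xy by (auto simp: fp_inl_def free_product_def quotient_def)
  have "(fp_rel G H `` {[Inl x]}) \<otimes>\<^bsub>free_product G H\<^esub> (fp_rel G H `` {[Inl y]})
      = fp_rel G H `` {[Inl x] @ [Inl y]}"
    by (rule fp_mult) (use xy in auto)
  moreover have "fp_rel G H `` {[Inl x] @ [Inl y]} = fp_rel G H `` {[Inl (x \<otimes>\<^bsub>G\<^esub> y)]}"
    using fp_rel.fp_multL[of "[]" G H "[]" x y] xy
    by (intro equiv_class_eq[OF equiv_fp_rel]) simp
  ultimately show "fp_inl G H (x \<otimes>\<^bsub>G\<^esub> y) = fp_inl G H x \<otimes>\<^bsub>free_product G H\<^esub> fp_inl G H y"
    by (simp add: fp_inl_def)
qed

lemma fp_inr_hom: "fp_inr G H \<in> hom H (free_product G H)"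
proof (rule homI)
  fix x y assume xy: "x \<in> carrier H" "y \<in> carrier H"
  show "fp_inr G H x \<in> carrier (free_product G H)"
    using xy by (auto simp: fp_inr_def free_product_def quotient_def)
  have "(fp_rel G H `` {[Inr x]}) \<otimes>\<^bsub>free_product G H\<^esub> (fp_rel G H `` {[Inr y]})
      = fp_rel G H `` {[Inr x] @ [Inr y]}"
    by (rule fp_mult) (use xy in auto)
  moreover have "fp_rel G H `` {[Inr x] @ [Inr y]} = fp_rel G H `` {[Inr (x \<otimes>\<^bsub>H\<^esub> y)]}"
    using fp_rel.fp_multR[of "[]" G H "[]" x y] xy
    by (intro equiv_class_eq[OF equiv_fp_rel]) simp
  ultimately show "fp_inr G H (x \<otimes>\<^bsub>H\<^esub> y) = fp_inr G H x \<otimes>\<^bsub>free_product G H\<^esub> fp_inr G H y"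
    by (simp add: fp_inr_def)
qed

end

section \<open>The full group C*-algebra of a countable discrete group\<close>

definition unitary_group :: "(nat, nat) op monoid" where
  "unitary_group = \<lparr>
     carrier = {U. clinear U \<and> adj U o\<^sub>L U = id_blinfun \<and> U o\<^sub>L adj U = id_blinfun},
     monoid.mult = (o\<^sub>L),
     one = id_blinfun\<rparr>"

text \<open>The unitary representations on \<open>\<ell>\<^sup>2(nat)\<close>. For countable groups they determine the maximal
  C*-norm: cyclic representations act on separable spaces, and every separable representation is
  a subrepresentation of one on \<open>\<ell>\<^sup>2(nat)\<close>. Their direct sum therefore generates the full group
  C*-algebra, as an algebra of operators on \<open>\<ell>\<^sup>2(univ_index G)\<close>.\<close>

definition unitary_reps :: "('g, 'c) monoid_scheme \<Rightarrow> ('g \<Rightarrow> (nat, nat) op) set" where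
  "unitary_reps G = hom G unitary_group \<inter> extensional (carrier G)"

type_synonym 'g univ = "('g \<Rightarrow> (nat, nat) op) \<times> nat"

definition univ_index :: "('g, 'c) monoid_scheme \<Rightarrow> 'g univ set" where
  "univ_index G = unitary_reps G \<times> UNIV"

lift_definition fibre :: "'a \<Rightarrow> ('a \<times> 'b) ell2 \<Rightarrow> 'b ell2" is "\<lambda>a x b. x (a, b)"
proof -
  fix a :: 'a and x :: "'a \<times> 'b \<Rightarrow> complex"
  assume "(\<lambda>i. (cmod (x i))\<^sup>2) summable_on UNIV"
  then have "(\<lambda>i. (cmod (x i))\<^sup>2) summable_on Pair a ` UNIV"
    by (rule summable_on_subset_banach) simp
  then show "(\<lambda>b. (cmod (x (a, b)))\<^sup>2) summable_on UNIV"
    by (subst (asm) summable_on_reindex) (auto simp: o_def inj_on_def)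
qed

definition univ_rep :: "('g, 'c) monoid_scheme \<Rightarrow> 'g \<Rightarrow> ('g univ, 'g univ) op" where
  "univ_rep G g = Blinfun (\<lambda>x. Abs_ell2 (\<lambda>(\<pi>, k).
     if \<pi> \<in> unitary_reps G then coord (\<pi> g (fibre \<pi> x)) k else 0))"

definition group_cstar :: "('g, 'c) monoid_scheme \<Rightarrow> ('g univ, 'g univ) op set" where
  "group_cstar G = closure (cspan (univ_rep G ` carrier G))"

lemma norm_unitary: assumes "U \<in> carrier unitary_group" shows "norm (U x) = norm x"
proof -
  have U: "clinear U" "adj U o\<^sub>L U = id_blinfun" using assms by (auto simp: unitary_group_def)
  have "adj U (U x) = x" using arg_cong[OF U(2), of "\<lambda>T. T x"] by simp
  then have "cinner (U x) (U x) = cinner x x" using cinner_adj[OF U(1), of x "U x"] by simp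
  then show ?thesis by (simp add: norm_ell2_def inner_ell2_def)
qed

lemma norm_fibre_sq: "(norm (fibre a x))\<^sup>2 = infsum (\<lambda>b. (cmod (coord x (a, b)))\<^sup>2) UNIV"
  by (simp add: norm_ell2_sq fibre.rep_eq)

lemma fibre_add: "fibre a (x + y) = fibre a x + fibre a y"
  by transfer (simp add: fun_eq_iff)

lemma fibre_cscale: "fibre a (cscale c x) = cscale c (fibre a x)"
  by transfer (simp add: fun_eq_iff)

lemma coord_sq_summable_fibres:
  "(\<lambda>a. (norm (fibre a x))\<^sup>2) summable_on UNIV" "(norm x)\<^sup>2 = infsum (\<lambda>a. (norm (fibre a x))\<^sup>2) UNIV"
proof -
  have s: "(\<lambda>(a, b). (cmod (coord x (a, b)))\<^sup>2) summable_on UNIV \<times> UNIV"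
    using coord_sq_summable[of x] by (simp add: case_prod_unfold)
  show "(\<lambda>a. (norm (fibre a x))\<^sup>2) summable_on UNIV"
    unfolding norm_fibre_sq using summable_on_Sigma_banach[OF s] by simp
  show "(norm x)\<^sup>2 = infsum (\<lambda>a. (norm (fibre a x))\<^sup>2) UNIV"
    unfolding norm_fibre_sq norm_ell2_sq[of x] using infsum_Sigma'_banach[OF s] by (simp add: case_prod_unfold)
qed

lemma
  assumes "g \<in> carrier G"
  shows coord_univ_rep: "coord (univ_rep G g x) (\<pi>, k) =
      (if \<pi> \<in> unitary_reps G then coord (\<pi> g (fibre \<pi> x)) k else 0)"
    and norm_univ_rep_le: "norm (univ_rep G g x) \<le> norm x"
proof -
  define f where "f x = (\<lambda>(\<pi>, k). if \<pi> \<in> unitary_reps G then coord (\<pi> g (fibre \<pi> x)) k else 0)"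
    for x :: "('a univ) ell2"
  have u: "\<pi> g \<in> carrier unitary_group" if "\<pi> \<in> unitary_reps G" for \<pi>
    using that assms by (auto simp: unitary_reps_def hom_def)
  have in1: "(\<lambda>k. (cmod (f x (\<pi>, k)))\<^sup>2) summable_on UNIV" for x \<pi>
    by (cases "\<pi> \<in> unitary_reps G") (simp_all add: f_def coord_sq_summable)
  have in2: "infsum (\<lambda>k. (cmod (f x (\<pi>, k)))\<^sup>2) UNIV \<le> (norm (fibre \<pi> x))\<^sup>2" for x \<pi>
    by (cases "\<pi> \<in> unitary_reps G")
      (simp_all add: f_def norm_ell2_sq[symmetric] norm_unitary[OF u])
  have out: "(\<lambda>\<pi>. infsum (\<lambda>k. (cmod (f x (\<pi>, k)))\<^sup>2) UNIV) summable_on UNIV" for x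
    by (rule summable_on_comparison_test[OF coord_sq_summable_fibres(1)[of x]])
      (auto simp: in2 infsum_nonneg)
  have sm: "(\<lambda>i. (cmod (f x i))\<^sup>2) summable_on UNIV" for x
  proof -
    have "(\<lambda>i. (cmod (f x i))\<^sup>2) summable_on (SIGMA \<pi>:UNIV. UNIV)"
      by (rule summable_on_SigmaI[OF has_sum_infsum[OF in1] out]) simp
    then show ?thesis by simp
  qed
  define F where "F x = Abs_ell2 (f x)" for x
  have cF: "coord (F x) = f x" for x unfolding F_def by (rule Abs_ell2_inverse) (simp add: sm)
  have nF: "norm (F x) \<le> norm x" for x
  proof (rule power2_le_imp_le)
    have "(norm (F x))\<^sup>2 = infsum (\<lambda>\<pi>. infsum (\<lambda>k. (cmod (f x (\<pi>, k)))\<^sup>2) UNIV) UNIV"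
      unfolding norm_ell2_sq cF
      using infsum_Sigma'_banach[of "\<lambda>\<pi> k. (cmod (f x (\<pi>, k)))\<^sup>2" UNIV "\<lambda>_. UNIV"] sm[of x]
      by (simp add: case_prod_unfold)
    also have "\<dots> \<le> (norm x)\<^sup>2"
      unfolding coord_sq_summable_fibres(2)[of x]
      by (rule infsum_mono[OF out coord_sq_summable_fibres(1) in2])
    finally show "(norm (F x))\<^sup>2 \<le> (norm x)\<^sup>2" .
  qed simp
  have cl: "\<pi> g (cscale c x) = cscale c (\<pi> g x)" if "\<pi> \<in> unitary_reps G" for \<pi> c x
    using u[OF that] by (simp add: unitary_group_def clinear_def)
  have bl: "bounded_linear F"
  proof (rule bounded_linear_intro[of _ 1])
    show "F (x + y) = F x + F y" for x y
      by (rule coord_eqI) (simp add: cF plus_ell2.rep_eq f_def fibre_add blinfun.add_right split: prod.split)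
    show "F (r *\<^sub>R x) = r *\<^sub>R F x" for r x
      by (rule coord_eqI) (simp add: cF scaleR_ell2_def cscale.rep_eq f_def fibre_cscale cl split: prod.split)
  qed (simp add: nF)
  have ap: "univ_rep G g x = F x"
    using bounded_linear_Blinfun_apply[OF bl] by (simp add: univ_rep_def F_def[abs_def] f_def)
  show "coord (univ_rep G g x) (\<pi>, k) =
      (if \<pi> \<in> unitary_reps G then coord (\<pi> g (fibre \<pi> x)) k else 0)"
    unfolding ap cF by (simp add: f_def)
  show "norm (univ_rep G g x) \<le> norm x" unfolding ap by (rule nF)
qed

lemma fibre_univ_rep:
  assumes "g \<in> carrier G"
  shows "fibre \<pi> (univ_rep G g x) = (if \<pi> \<in> unitary_reps G then \<pi> g (fibre \<pi> x) else 0)"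
  by (rule coord_eqI) (simp add: fibre.rep_eq coord_univ_rep[OF assms] zero_ell2.rep_eq)

lemma univ_rep_mult:
  fixes G :: "('a, 'c) monoid_scheme"
  assumes "group G" "g \<in> carrier G" "h \<in> carrier G"
  shows "univ_rep G (g \<otimes>\<^bsub>G\<^esub> h) = univ_rep G g o\<^sub>L univ_rep G h"
proof (rule blinfun_eqI, rule coord_eqI)
  fix x and i :: "'a univ"
  obtain \<pi> k where i: "i = (\<pi>, k)" by force
  have m: "g \<otimes>\<^bsub>G\<^esub> h \<in> carrier G" using assms by (simp add: group.is_monoid monoid.m_closed)
  have "\<pi> (g \<otimes>\<^bsub>G\<^esub> h) = \<pi> g o\<^sub>L \<pi> h" if "\<pi> \<in> unitary_reps G"
    using that assms by (auto simp: unitary_reps_def hom_def unitary_group_def)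
  then show "coord (univ_rep G (g \<otimes>\<^bsub>G\<^esub> h) x) i = coord ((univ_rep G g o\<^sub>L univ_rep G h) x) i"
    using assms m by (simp add: i coord_univ_rep fibre_univ_rep)
qed

lemma clinear_id [simp]: "clinear id_blinfun" by (simp add: clinear_def)

lemma adj_id [simp]: "adj id_blinfun = id_blinfun" by (rule adj_unique) simp

lemma univ_rep_one:
  fixes G :: "('a, 'c) monoid_scheme"
  assumes "group G"
  shows "univ_rep G \<one>\<^bsub>G\<^esub> = proj (univ_index G)"
proof (rule blinfun_eqI, rule coord_eqI)
  fix x and i :: "'a univ"
  obtain \<pi> k where i: "i = (\<pi>, k)" by force
  have o: "\<one>\<^bsub>G\<^esub> \<in> carrier G" by (rule monoid.one_closed[OF group.is_monoid[OF assms]])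
  have "\<pi> \<one>\<^bsub>G\<^esub> = id_blinfun" if "\<pi> \<in> unitary_reps G"
  proof -
    have c: "\<pi> \<one>\<^bsub>G\<^esub> \<in> carrier unitary_group" using that o by (auto simp: unitary_reps_def hom_def)
    have h: "\<pi> \<in> hom G unitary_group" using that by (simp add: unitary_reps_def)
    have "\<pi> (\<one>\<^bsub>G\<^esub> \<otimes>\<^bsub>G\<^esub> \<one>\<^bsub>G\<^esub>) = \<pi> \<one>\<^bsub>G\<^esub> o\<^sub>L \<pi> \<one>\<^bsub>G\<^esub>"
      using hom_mult[OF h o o] by (simp only: unitary_group_def monoid.simps)
    moreover have "\<one>\<^bsub>G\<^esub> \<otimes>\<^bsub>G\<^esub> \<one>\<^bsub>G\<^esub> = \<one>\<^bsub>G\<^esub>"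
      by (rule monoid.l_one[OF group.is_monoid[OF assms] o])
    ultimately have idem: "\<pi> \<one>\<^bsub>G\<^esub> = \<pi> \<one>\<^bsub>G\<^esub> o\<^sub>L \<pi> \<one>\<^bsub>G\<^esub>" by (simp only:)
    have "adj (\<pi> \<one>\<^bsub>G\<^esub>) o\<^sub>L \<pi> \<one>\<^bsub>G\<^esub> = adj (\<pi> \<one>\<^bsub>G\<^esub>) o\<^sub>L (\<pi> \<one>\<^bsub>G\<^esub> o\<^sub>L \<pi> \<one>\<^bsub>G\<^esub>)"
      by (rule arg_cong[OF idem])
    also have "\<dots> = (adj (\<pi> \<one>\<^bsub>G\<^esub>) o\<^sub>L \<pi> \<one>\<^bsub>G\<^esub>) o\<^sub>L \<pi> \<one>\<^bsub>G\<^esub>" by (rule blinfun_eqI) simp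
    finally have "id_blinfun = id_blinfun o\<^sub>L \<pi> \<one>\<^bsub>G\<^esub>" using c by (simp add: unitary_group_def)
    also have "\<dots> = \<pi> \<one>\<^bsub>G\<^esub>" by (rule blinfun_eqI) simp
    finally show ?thesis by (rule HOL.sym)
  qed
  then show "coord (univ_rep G \<one>\<^bsub>G\<^esub> x) i = coord (proj (univ_index G) x) i"
    using o by (simp add: i coord_univ_rep univ_index_def restrict_ell2.rep_eq fibre.rep_eq)
qed


section \<open>The operator system of the prism\<close>

type_synonym Z3Z2 = "(int + int) list set"

definition Z3_Z2 :: "Z3Z2 monoid" where
  "Z3_Z2 = free_product (integer_mod_group 3) (integer_mod_group 2)"

definition gen_w :: "(Z3Z2 univ, Z3Z2 univ) op" where
  "gen_w = univ_rep Z3_Z2 (fp_inl (integer_mod_group 3) (integer_mod_group 2) 1)"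

definition gen_v :: "(Z3Z2 univ, Z3Z2 univ) op" where
  "gen_v = univ_rep Z3_Z2 (fp_inr (integer_mod_group 3) (integer_mod_group 2) 1)"

definition NCP3 :: "(Z3Z2 univ, Z3Z2 univ) op set" where
  "NCP3 = cspan {proj (univ_index Z3_Z2), gen_w, gen_w o\<^sub>L gen_w, gen_v}"

lemma group_Z3_Z2: "group Z3_Z2"
  unfolding Z3_Z2_def
  by (rule group_free_product[OF group_integer_mod_group group_integer_mod_group])

lemma NCP3_subset_group_cstar: "NCP3 \<subseteq> group_cstar Z3_Z2"
proof -
  let ?w = "fp_inl (integer_mod_group 3) (integer_mod_group 2) 1"
  let ?v = "fp_inr (integer_mod_group 3) (integer_mod_group 2) 1"
  have w: "?w \<in> carrier Z3_Z2"
    unfolding Z3_Z2_def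
    by (rule hom_in_carrier[OF fp_inl_hom[OF group_integer_mod_group group_integer_mod_group]])
      (simp add: carrier_integer_mod_group)
  have v: "?v \<in> carrier Z3_Z2"
    unfolding Z3_Z2_def
    by (rule hom_in_carrier[OF fp_inr_hom[OF group_integer_mod_group group_integer_mod_group]])
      (simp add: carrier_integer_mod_group)
  note m = group.is_monoid[OF group_Z3_Z2]
  have "{univ_rep Z3_Z2 \<one>\<^bsub>Z3_Z2\<^esub>, univ_rep Z3_Z2 ?w, univ_rep Z3_Z2 (?w \<otimes>\<^bsub>Z3_Z2\<^esub> ?w),
      univ_rep Z3_Z2 ?v} \<subseteq> univ_rep Z3_Z2 ` carrier Z3_Z2"
    by (simp only: insert_subset imageI w v monoid.one_closed[OF m] monoid.m_closed[OF m] empty_subsetI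
        simp_thms)
  then have "NCP3 \<subseteq> cspan (univ_rep Z3_Z2 ` carrier Z3_Z2)"
    unfolding NCP3_def gen_w_def gen_v_def univ_rep_one[OF group_Z3_Z2, symmetric]
      univ_rep_mult[OF group_Z3_Z2 w w, symmetric]
    by (rule cop.span_mono)
  also have "\<dots> \<subseteq> group_cstar Z3_Z2"
    unfolding group_cstar_def by (rule closure_subset)
  finally show ?thesis .
qed

end

theory Submission
  imports Defs
begin

text \<open>
  Everything rests on one description of the triples \<open>(a, b, c)\<close>. The triangle with vertices the cube
  roots of unity is the set of all \<open>z\<close> with \<open>1 + 2 Re (\<zeta> z) \<ge> 0\<close> for \<open>\<zeta>\<^sup>3 = 1\<close>
  (\<open>triangle_iff\<close>), so the joint numerical range of a selfadjoint triple lies in the prism iff, for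
  \<open>x = a + i b\<close>, the operators \<open>1 + \<zeta> x + cnj \<zeta> x*\<close> and \<open>1 + c\<close>, \<open>1 - c\<close> are positive
  (\<open>P3_max_iff\<close>): vector states detect positivity, and states preserve it.

  If \<open>(x, c) = (\<phi> w, \<phi> v)\<close> for a ucp map \<open>\<phi>\<close>, these operators are the images of
  \<open>1 + \<zeta> w + cnj \<zeta> w*\<close> and \<open>1 + v\<close>, \<open>1 - v\<close>, which are positive multiples of spectral projections
  of \<open>w\<close> and \<open>v\<close>. Hence \<open>W_nc_subset_P3_max\<close>.

  Conversely, suppose that the inequalities hold. A third of the first three operators is a resolution
  of the identity into three positive operators, and a half of the other two is one into two. By
  Naimark each resolution dilates to a projection valued one, that is, \<open>x\<close> is a compression of a
  unitary \<open>W\<close> with \<open>W\<^sup>3 = 1\<close> and \<open>c\<close> is a compression of a unitary \<open>V\<close> with \<open>V\<^sup>2 = 1\<close>. As the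
  operator system is spanned by powers of \<open>w\<close> and powers of \<open>v\<close>, without mixed products, the only
  link between \<open>W\<close> and \<open>V\<close> is that both compressions are along the same isometry \<open>cuntz 0\<close>;
  \<open>resolution_unitary_dilation\<close> arranges this. The universal property of the free product turns \<open>W\<close>
  and \<open>V\<close> into a unitary representation on \<open>\<ell>\<^sup>2\<close>, hence a direct summand of the universal one, and
  compressing it gives a ucp map that takes \<open>w\<close> to \<open>x\<close> and \<open>v\<close> to \<open>c\<close> (\<open>P3_max_subset_W_nc\<close>). The
  dilation uses square roots of positive operators, which come from an iteration in the complete
  space of operators (\<open>positive_contraction_sqrt\<close>).

  For the isomorphism with the state space: a ucp map \<open>\<phi>\<close> preserves adjoints (\<open>ucp_adj\<close>), so its
  values on the span of \<open>1, w, w*, v\<close> are fixed linear combinations of \<open>1\<close> and the entries of its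
  triple \<open>(Re \<phi> w, Im \<phi> w, \<phi> v)\<close> (\<open>ucp_eq_triple_combination\<close>), and conversely the entries of the
  triple are fixed linear combinations of values of \<open>\<phi>\<close> (\<open>re_im_gen\<close>). Linear combinations are
  compatible with the ultraweak topology, compressions and direct sums. That direct sums exist at
  all follows from the bound \<open>norm (\<phi> r) \<le> norm r\<close> (\<open>ucp_norm_le\<close>), which makes the sums converge
  strongly.
\<close>

section \<open>The inner product and completeness of \<open>\<ell>\<^sup>2\<close>\<close>

lemma cinner_add_right: "cinner x (y + z) = cinner x y + cinner x z"
  by (subst (1 2 3) cinner_commute) (simp add: cinner_add_left)

lemma cinner_cscale_right: "cinner x (cscale c y) = cnj c * cinner x y"
  by (subst (1 2) cinner_commute) (simp add: cinner_cscale_left)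

lemma cscale_minus_one: "cscale (-1) x = - x"
  by transfer (simp add: fun_eq_iff)

lemma cscale_zero: "cscale 0 x = 0" "cscale c 0 = 0"
  by (transfer; simp add: fun_eq_iff)+

lemma cinner_minus_left: "cinner (- x) y = - cinner x y"
  by (simp flip: cscale_minus_one add: cinner_cscale_left)

lemma cinner_minus_right: "cinner x (- y) = - cinner x y"
  by (simp flip: cscale_minus_one add: cinner_cscale_right)

lemma cinner_diff_left: "cinner (x - y) z = cinner x z - cinner y z"
  using cinner_add_left[of x "- y" z] by (simp add: cinner_minus_left)

lemma cinner_diff_right: "cinner x (y - z) = cinner x y - cinner x z"
  using cinner_add_right[of x y "- z"] by (simp add: cinner_minus_right)

lemma cinner_zero [simp]: "cinner 0 x = 0" "cinner x 0 = 0"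
  using cinner_minus_left[of 0 x] cinner_minus_right[of x 0] by simp_all

lemma cinner_sum_left: "cinner (\<Sum>i\<in>F. f i) x = (\<Sum>i\<in>F. cinner (f i) x)"
  by (induct F rule: infinite_finite_induct) (auto simp: cinner_add_left)

lemma cinner_sum_right: "cinner x (\<Sum>i\<in>F. f i) = (\<Sum>i\<in>F. cinner x (f i))"
  by (induct F rule: infinite_finite_induct) (auto simp: cinner_add_right)

lemmas cinner_simps = cinner_add_left cinner_add_right cinner_diff_left cinner_diff_right
  cinner_minus_left cinner_minus_right cinner_cscale_left cinner_cscale_right

lemma cinner_eq_norm_sq: "cinner x x = of_real ((norm x)\<^sup>2)"
  by (simp add: cinner_self norm_ell2_sq)

lemma cinner_eq_inner: "cinner x y = Complex (inner x y) (inner (cscale (- \<i>) x) y)"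
  by (simp add: complex_eq_iff inner_ell2_def cinner_cscale_left)

lemma cmod_cinner_le: "cmod (cinner x y) \<le> 2 * (norm x * norm y)"
proof -
  have "cmod (cinner x y) \<le> \<bar>inner x y\<bar> + \<bar>inner (cscale (- \<i>) x) y\<bar>"
    using cmod_le[of "cinner x y"] by (simp add: cinner_eq_inner)
  also have "\<dots> \<le> norm x * norm y + norm (cscale (- \<i>) x) * norm y"
    by (intro add_mono Cauchy_Schwarz_ineq2)
  finally show ?thesis by (simp add: norm_cscale)
qed

lemma bounded_linear_cinner_left: "bounded_linear (\<lambda>x. cinner x y)"
proof (rule bounded_linear_intro[of _ "2 * norm y"])
  show "norm (cinner x y) \<le> norm x * (2 * norm y)" for x
    using cmod_cinner_le[of x y] by (simp only: mult_ac)
qed (simp_all add: cinner_add_left scaleR_ell2_def cinner_cscale_left scaleR_conv_of_real)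

lemma bounded_linear_cinner_right: "bounded_linear (cinner x)"
proof (rule bounded_linear_intro[of _ "2 * norm x"])
  show "norm (cinner x y) \<le> norm y * (2 * norm x)" for y
    using cmod_cinner_le[of x y] by (simp only: mult_ac)
qed (simp_all add: cinner_add_right scaleR_ell2_def cinner_cscale_right scaleR_conv_of_real)

lemma cinner_eqI:
  assumes "\<And>z. cinner x z = cinner y z" shows "x = y"
proof -
  have "cinner (x - y) (x - y) = 0" using assms[of "x - y"] by (simp add: cinner_diff_left)
  then show ?thesis by (simp add: cinner_eq_norm_sq)
qed

lemma sum_coord_le: "finite F \<Longrightarrow> (\<Sum>i\<in>F. (cmod (coord x i))\<^sup>2) \<le> (norm x)\<^sup>2"
  unfolding norm_ell2_sq by (rule finite_sum_le_infsum[OF coord_sq_summable]) auto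

lemma cmod_coord_le: "cmod (coord x i) \<le> norm x"
  by (rule power2_le_imp_le) (use sum_coord_le[of "{i}" x] in simp_all)

text \<open>The limit is taken coordinatewise; that it is square summable and the limit in norm is seen from
  the finite partial sums, where limits can be interchanged.\<close>

lemma Cauchy_ell2_convergent:
  fixes X :: "nat \<Rightarrow> 'i ell2"
  assumes "Cauchy X" shows "convergent X"
proof -
  have "Cauchy (\<lambda>n. coord (X n) i)" for i
  proof (rule metric_CauchyI)
    fix e :: real assume "e > 0"
    then obtain M where M: "\<And>m n. m \<ge> M \<Longrightarrow> n \<ge> M \<Longrightarrow> dist (X m) (X n) < e"
      using metric_CauchyD[OF assms] by blast
    show "\<exists>M. \<forall>m\<ge>M. \<forall>n\<ge>M. dist (coord (X m) i) (coord (X n) i) < e"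
    proof (intro exI[of _ M] allI impI)
      fix m n assume "m \<ge> M" "n \<ge> M"
      then have "norm (X m - X n) < e" using M by (simp add: dist_norm)
      moreover have "dist (coord (X m) i) (coord (X n) i) \<le> norm (X m - X n)"
        using cmod_coord_le[of "X m - X n" i] by (simp add: dist_norm minus_ell2.rep_eq)
      ultimately show "dist (coord (X m) i) (coord (X n) i) < e" by simp
    qed
  qed
  then have "\<exists>l. (\<lambda>n. coord (X n) i) \<longlonglongrightarrow> l" for i
    by (simp add: Cauchy_convergent_iff convergent_def)
  then obtain l where l: "\<And>i. (\<lambda>n. coord (X n) i) \<longlonglongrightarrow> l i" by metis
  have tail: "\<exists>N. \<forall>n\<ge>N. \<forall>F. finite F \<longrightarrow> (\<Sum>i\<in>F. (cmod (coord (X n) i - l i))\<^sup>2) \<le> e\<^sup>2"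
    if e: "e > 0" for e
  proof -
    obtain N where N: "\<And>m n. m \<ge> N \<Longrightarrow> n \<ge> N \<Longrightarrow> dist (X m) (X n) < e"
      using metric_CauchyD[OF assms e] by blast
    have "(\<Sum>i\<in>F. (cmod (coord (X n) i - l i))\<^sup>2) \<le> e\<^sup>2" if n: "n \<ge> N" and F: "finite F" for n F
    proof (rule tendsto_le[OF sequentially_bot tendsto_const])
      show "(\<lambda>m. \<Sum>i\<in>F. (cmod (coord (X n) i - coord (X m) i))\<^sup>2) \<longlonglongrightarrow>
          (\<Sum>i\<in>F. (cmod (coord (X n) i - l i))\<^sup>2)"
        by (intro tendsto_intros l)
      show "\<forall>\<^sub>F m in sequentially. (\<Sum>i\<in>F. (cmod (coord (X n) i - coord (X m) i))\<^sup>2) \<le> e\<^sup>2"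
        unfolding eventually_sequentially
      proof (intro exI[of _ N] allI impI)
        fix m assume "m \<ge> N"
        have "(\<Sum>i\<in>F. (cmod (coord (X n) i - coord (X m) i))\<^sup>2) \<le> (norm (X n - X m))\<^sup>2"
          using sum_coord_le[OF F, of "X n - X m"] by (simp add: minus_ell2.rep_eq)
        also have "\<dots> \<le> e\<^sup>2"
          using N[OF n \<open>m \<ge> N\<close>] by (intro power_mono) (auto simp: dist_norm)
        finally show "(\<Sum>i\<in>F. (cmod (coord (X n) i - coord (X m) i))\<^sup>2) \<le> e\<^sup>2" .
      qed
    qed
    then show ?thesis by blast
  qed
  have sm: "(\<lambda>i. (cmod (coord (X n) i - l i))\<^sup>2) summable_on UNIV"
    if "\<forall>F. finite F \<longrightarrow> (\<Sum>i\<in>F. (cmod (coord (X n) i - l i))\<^sup>2) \<le> c" for n c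
    using that by (intro nonneg_bdd_above_summable_on) (auto intro!: bdd_aboveI[of _ c])
  obtain N where N: "\<forall>F. finite F \<longrightarrow> (\<Sum>i\<in>F. (cmod (coord (X N) i - l i))\<^sup>2) \<le> 1\<^sup>2"
    using tail[of 1] by auto
  have "(\<lambda>i. (cmod (l i))\<^sup>2) summable_on UNIV"
    using ell2_sq_add[OF coord_sq_summable[of "X N"] ell2_sq_cmult[OF sm[OF N], of "-1"]] by simp
  then have cl: "coord (Abs_ell2 l) = l" by (simp add: Abs_ell2_inverse)
  have "X \<longlonglongrightarrow> Abs_ell2 l"
  proof (rule metric_LIMSEQ_I)
    fix r :: real assume "r > 0"
    then obtain N where N: "\<And>n F. n \<ge> N \<Longrightarrow> finite F \<Longrightarrow>
        (\<Sum>i\<in>F. (cmod (coord (X n) i - l i))\<^sup>2) \<le> (r / 2)\<^sup>2"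
      using tail[of "r / 2"] by auto
    show "\<exists>N. \<forall>n\<ge>N. dist (X n) (Abs_ell2 l) < r"
    proof (intro exI[of _ N] allI impI)
      fix n assume n: "n \<ge> N"
      have "(norm (X n - Abs_ell2 l))\<^sup>2 \<le> (r / 2)\<^sup>2"
        unfolding norm_ell2_sq minus_ell2.rep_eq cl
        by (rule infsum_le_finite_sums[OF sm]) (use N[OF n] in auto)
      then have "norm (X n - Abs_ell2 l) \<le> r / 2" by (rule power2_le_imp_le) (use \<open>r > 0\<close> in simp)
      then show "dist (X n) (Abs_ell2 l) < r" using \<open>r > 0\<close> by (simp add: dist_norm)
    qed
  qed
  then show ?thesis by (auto simp: convergent_def)
qed

instance ell2 :: (type) banach
  by standard (rule Cauchy_ell2_convergent)

lemma norm_sum_orthogonal: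
  fixes f :: "'a \<Rightarrow> 'i ell2"
  assumes orth: "\<And>i j. i \<in> A \<Longrightarrow> j \<in> A \<Longrightarrow> i \<noteq> j \<Longrightarrow> inner (f i) (f j) = 0"
    and "finite F" "F \<subseteq> A"
  shows "(norm (sum f F))\<^sup>2 = (\<Sum>i\<in>F. (norm (f i))\<^sup>2)"
  using assms(2,3)
proof (induction F)
  case (insert x F)
  have "inner (f x) (sum f F) = 0"
    unfolding inner_sum_right using insert orth by (intro sum.neutral) auto
  with insert show ?case
    by (simp add: power2_norm_eq_inner inner_add_left inner_add_right inner_commute)
qed simp

text \<open>By Pythagoras the Cauchy criterion for the sum is the one for the sum of the squared norms.\<close>

lemma summable_on_orthogonal:
  fixes f :: "'a \<Rightarrow> 'i ell2"
  assumes orth: "\<And>i j. i \<in> A \<Longrightarrow> j \<in> A \<Longrightarrow> i \<noteq> j \<Longrightarrow> inner (f i) (f j) = 0"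
    and sm: "(\<lambda>i. (norm (f i))\<^sup>2) summable_on A"
  shows "f summable_on A"
proof -
  note pyth = norm_sum_orthogonal[where A = A and f = f, OF orth]
  have "cauchy_filter (filtermap (sum f) (finite_subsets_at_top A))"
    unfolding cauchy_filter_metric_filtermap
  proof (intro allI impI)
    fix e :: real assume e: "e > 0"
    let ?s = "\<lambda>F. \<Sum>i\<in>F. (norm (f i))\<^sup>2"
    define l where "l = infsum (\<lambda>i. (norm (f i))\<^sup>2) A"
    have "(?s \<longlongrightarrow> l) (finite_subsets_at_top A)"
      using has_sum_infsum[OF sm] by (simp add: has_sum_def l_def)
    then have "\<forall>\<^sub>F F in finite_subsets_at_top A. dist (?s F) l < e\<^sup>2 / 8"
      by (rule tendstoD) (use e in auto)
    then have "\<exists>X. finite X \<and> X \<subseteq> A \<and> (\<forall>F. finite F \<and> X \<subseteq> F \<and> F \<subseteq> A \<longrightarrow> dist (?s F) l < e\<^sup>2 / 8)"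
      by (simp only: eventually_finite_subsets_at_top)
    then obtain F0 where F0: "finite F0" "F0 \<subseteq> A"
      and c': "\<forall>F. finite F \<and> F0 \<subseteq> F \<and> F \<subseteq> A \<longrightarrow> dist (?s F) l < e\<^sup>2 / 8"
      by (elim exE conjE) (rule that)
    have c: "dist (?s F) l < e\<^sup>2 / 8" if "finite F" "F0 \<subseteq> F" "F \<subseteq> A" for F
      using c' that by simp
    have e4: "(e / 2)\<^sup>2 = e\<^sup>2 / 4" by (simp add: power_divide)
    have near: "norm (sum f F - sum f F0) < e / 2" if F: "finite F" "F0 \<subseteq> F" "F \<subseteq> A" for F
    proof -
      have eq: "sum f F - sum f F0 = sum f (F - F0)" "?s (F - F0) = ?s F - ?s F0"
        using F F0 by (simp_all add: sum_diff)
      have "(norm (sum f F - sum f F0))\<^sup>2 = ?s F - ?s F0"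
        unfolding eq(1) eq(2)[symmetric] by (rule pyth) (use F in auto)
      also have "\<dots> < (e / 2)\<^sup>2"
        using c[OF F] c[OF F0(1) order_refl F0(2)] unfolding dist_real_def e4 by linarith
      finally show ?thesis by (rule power2_less_imp_less) (use e in auto)
    qed
    show "\<exists>P. eventually P (finite_subsets_at_top A) \<and>
        (\<forall>x y. P x \<and> P y \<longrightarrow> dist (sum f x) (sum f y) < e)"
    proof (intro exI[of _ "\<lambda>F. finite F \<and> F0 \<subseteq> F \<and> F \<subseteq> A"] conjI allI impI)
      show "\<forall>\<^sub>F F in finite_subsets_at_top A. finite F \<and> F0 \<subseteq> F \<and> F \<subseteq> A"
        unfolding eventually_finite_subsets_at_top using F0 by (intro exI[of _ F0]) simp
      fix x y assume a: "(finite x \<and> F0 \<subseteq> x \<and> x \<subseteq> A) \<and> (finite y \<and> F0 \<subseteq> y \<and> y \<subseteq> A)"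
      have "dist (sum f x) (sum f y) \<le> norm (sum f x - sum f F0) + norm (sum f y - sum f F0)"
        using dist_triangle2[of "sum f x" "sum f y" "sum f F0"] by (simp add: dist_norm)
      also have "\<dots> < e / 2 + e / 2"
        by (rule add_strict_mono; rule near) (use a in \<open>simp_all only: simp_thms\<close>)
      finally show "dist (sum f x) (sum f y) < e" by simp
    qed
  qed
  moreover have "filtermap (sum f) (finite_subsets_at_top A) \<noteq> bot"
    by (simp add: filtermap_bot_iff)
  ultimately obtain L where "filtermap (sum f) (finite_subsets_at_top A) \<le> nhds L"
    using cauchy_filter_complete_converges[OF _ complete_UNIV, of "filtermap (sum f) (finite_subsets_at_top A)"]
    by auto
  then show ?thesis by (auto simp: summable_on_def has_sum_def filterlim_def)
qed

lemma norm_infsum_orthogonal_le: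
  fixes f :: "'a \<Rightarrow> 'i ell2"
  assumes orth: "\<And>i j. i \<in> A \<Longrightarrow> j \<in> A \<Longrightarrow> i \<noteq> j \<Longrightarrow> inner (f i) (f j) = 0"
    and sm: "(\<lambda>i. (norm (f i))\<^sup>2) summable_on A"
  shows "(norm (infsum f A))\<^sup>2 \<le> infsum (\<lambda>i. (norm (f i))\<^sup>2) A"
proof (rule tendsto_upperbound[OF _ _ finite_subsets_at_top_neq_bot])
  have "(sum f \<longlongrightarrow> infsum f A) (finite_subsets_at_top A)"
    using has_sum_infsum[OF summable_on_orthogonal[OF orth sm]] by (simp add: has_sum_def)
  then show "((\<lambda>F. (norm (sum f F))\<^sup>2) \<longlongrightarrow> (norm (infsum f A))\<^sup>2) (finite_subsets_at_top A)"
    by (intro tendsto_intros)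
  show "\<forall>\<^sub>F F in finite_subsets_at_top A. (norm (sum f F))\<^sup>2 \<le> infsum (\<lambda>i. (norm (f i))\<^sup>2) A"
    by (rule eventually_finite_subsets_at_top_weakI)
      (simp add: norm_sum_orthogonal[where A = A, OF orth] finite_sum_le_infsum[OF sm])
qed

section \<open>Adjoints and selfadjoint operators\<close>

lemma clinearD: "clinear T \<Longrightarrow> blinfun_apply T (cscale c x) = cscale c (blinfun_apply T x)"
  by (simp add: clinear_def)

lemma cinner_adj': "clinear T \<Longrightarrow> cinner (adj T x) y = cinner x (blinfun_apply T y)"
  by (metis cinner_adj cinner_commute)

lemma clinear_adj [simp]: "clinear T \<Longrightarrow> clinear (adj T)"
  unfolding clinear_def[of "adj T"]
  by (intro allI cinner_eqI) (simp add: cinner_adj' cinner_cscale_left)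

lemma adj_adj [simp]: "clinear T \<Longrightarrow> adj (adj T) = T"
  by (rule adj_unique) (simp add: cinner_adj')

lemma cscale_diff: "cscale c (x - y) = cscale c x - cscale c y"
  by transfer (simp add: fun_eq_iff algebra_simps)

lemma restrict_cscale: "restrict_ell2 I (cscale c x) = cscale c (restrict_ell2 I x)"
  by transfer (simp add: fun_eq_iff)

lemma clinear_simps [simp]:
  "clinear S \<Longrightarrow> clinear T \<Longrightarrow> clinear (S + T)"
  "clinear S \<Longrightarrow> clinear T \<Longrightarrow> clinear (S - T)"
  "clinear T \<Longrightarrow> clinear (scale_op c T)"
  "clinear 0" "clinear (proj I)"
  by (simp_all add: clinear_def plus_blinfun.rep_eq minus_blinfun.rep_eq cscale_simps cscale_diff
      zero_blinfun.rep_eq cscale_zero mult.commute restrict_cscale)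

lemma clinear_compose [simp]: "clinear S \<Longrightarrow> clinear T \<Longrightarrow> clinear (S o\<^sub>L T)"
  by (simp add: clinear_def)

lemma clinear_sum: "(\<And>i. i \<in> F \<Longrightarrow> clinear (T i)) \<Longrightarrow> clinear (\<Sum>i\<in>F. T i)"
  by (induct F rule: infinite_finite_induct) auto

lemma adj_compose: "clinear S \<Longrightarrow> clinear T \<Longrightarrow> adj (S o\<^sub>L T) = adj T o\<^sub>L adj S"
  by (rule adj_unique) (simp add: cinner_adj)

lemma adj_add: "clinear S \<Longrightarrow> clinear T \<Longrightarrow> adj (S + T) = adj S + adj T"
  by (rule adj_unique) (simp add: cinner_adj plus_blinfun.rep_eq cinner_simps)

lemma adj_diff: "clinear S \<Longrightarrow> clinear T \<Longrightarrow> adj (S - T) = adj S - adj T"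
  by (rule adj_unique) (simp add: cinner_adj minus_blinfun.rep_eq cinner_simps)

lemma adj_scale_op: "clinear T \<Longrightarrow> adj (scale_op c T) = scale_op (cnj c) (adj T)"
  by (rule adj_unique) (simp add: cinner_adj cinner_simps)

lemma cinner_restrict: "cinner (restrict_ell2 I x) y = cinner x (restrict_ell2 I y)"
  unfolding cinner_def by (rule infsum_cong) (simp add: restrict_ell2.rep_eq)

lemma adj_proj [simp]: "adj (proj I) = proj I"
  by (rule adj_unique) (simp add: cinner_restrict)

lemma restrict_restrict [simp]: "restrict_ell2 I (restrict_ell2 I x) = restrict_ell2 I x"
  by transfer (simp add: fun_eq_iff)

definition selfadj :: "('i, 'i) op \<Rightarrow> bool" where
  "selfadj T \<longleftrightarrow> (\<forall>x y. cinner (T x) y = cinner x (T y))"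

lemma selfadjD: "selfadj T \<Longrightarrow> cinner (blinfun_apply T x) y = cinner x (blinfun_apply T y)"
  by (simp add: selfadj_def)

lemma selfadj_adj: "selfadj T \<Longrightarrow> adj T = T"
  by (rule adj_unique) (simp add: selfadj_def)

lemma selfadj_clinear: "selfadj T \<Longrightarrow> clinear T"
  unfolding clinear_def by (intro allI cinner_eqI) (simp add: selfadjD cinner_cscale_left)

lemma selfadjI: "clinear T \<Longrightarrow> adj T = T \<Longrightarrow> selfadj T"
  unfolding selfadj_def by (metis cinner_adj)

lemma selfadj_inner: "selfadj T \<Longrightarrow> inner (blinfun_apply T x) y = inner x (blinfun_apply T y)"
  by (simp add: selfadj_def inner_ell2_def)

lemma selfadj_id: "selfadj id_blinfun"
  by (simp add: selfadj_def)

lemma selfadj_zero: "selfadj 0"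
  by (simp add: selfadj_def zero_blinfun.rep_eq)

lemma selfadj_add: "selfadj S \<Longrightarrow> selfadj T \<Longrightarrow> selfadj (S + T)"
  by (simp add: selfadj_def plus_blinfun.rep_eq cinner_simps)

lemma selfadj_diff: "selfadj S \<Longrightarrow> selfadj T \<Longrightarrow> selfadj (S - T)"
  by (simp add: selfadj_def minus_blinfun.rep_eq cinner_simps)

lemma selfadj_scale_real: "selfadj T \<Longrightarrow> selfadj (scale_op (of_real r) T)"
  by (simp add: selfadj_def cinner_simps)

lemma scaleR_eq_scale_op: "r *\<^sub>R T = scale_op (of_real r) T"
  for T :: "('i, 'j) op"
  by (rule blinfun_eqI) (simp add: scaleR_blinfun.rep_eq scaleR_ell2_def)

lemma selfadj_square: "selfadj T \<Longrightarrow> selfadj (T o\<^sub>L T)"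
  by (simp add: selfadj_def)

text \<open>The form at \<open>x\<close> and at the multiple \<open>y\<close> of \<open>T x\<close> that has the norm of \<open>x\<close> is
  \<open>norm x * norm (T x)\<close>.\<close>

lemma norm_le_of_form_bound:
  fixes T :: "('i, 'j) op"
  assumes "C \<ge> 0" and form: "\<And>x y. 2 * inner (T x) y \<le> C * ((norm x)\<^sup>2 + (norm y)\<^sup>2)"
  shows "norm T \<le> C"
proof (rule norm_blinfun_bound[OF \<open>C \<ge> 0\<close>])
  fix x
  show "norm (T x) \<le> C * norm x"
  proof (cases "T x = 0")
    case False
    then have x: "norm x > 0" by auto
    define t where "t = norm x / norm (T x)"
    have t: "t * norm (T x) = norm x" using False by (simp add: t_def)
    have "2 * (norm x * norm (T x)) = 2 * inner (T x) (t *\<^sub>R T x)"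
      unfolding t[symmetric] by (simp add: power2_norm_eq_inner[symmetric] power2_eq_square)
    also have "\<dots> \<le> C * ((norm x)\<^sup>2 + (norm (t *\<^sub>R T x))\<^sup>2)" by (rule form)
    also have "norm (t *\<^sub>R T x) = norm x"
      using t by (simp add: t_def)
    finally have "norm x * norm (T x) \<le> norm x * (C * norm x)"
      by (simp add: power2_eq_square mult_ac)
    then show ?thesis using x by simp
  qed (use \<open>C \<ge> 0\<close> in simp)
qed

text \<open>Polarization: for selfadjoint \<open>T\<close> the real part of the sesquilinear form is a difference of two
  values of the quadratic form, to which the parallelogram law applies.\<close>

lemma selfadj_norm_le:
  assumes T: "selfadj T" and "C \<ge> 0" and form: "\<And>x. \<bar>inner (blinfun_apply T x) x\<bar> \<le> C * (norm x)\<^sup>2"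
  shows "norm T \<le> C"
proof (rule norm_le_of_form_bound[OF \<open>C \<ge> 0\<close>])
  fix x y
  have s: "inner (T y) x = inner (T x) y"
    using selfadj_inner[OF T, of y x] by (simp add: inner_commute)
  have "4 * inner (T x) y = inner (T (x + y)) (x + y) - inner (T (x - y)) (x - y)"
    by (simp add: blinfun.add_right blinfun.diff_right inner_add_left inner_add_right
        inner_diff_left inner_diff_right s)
  also have "\<dots> \<le> C * (norm (x + y))\<^sup>2 + C * (norm (x - y))\<^sup>2"
    using form[of "x + y"] form[of "x - y"] by linarith
  also have "\<dots> = C * (2 * ((norm x)\<^sup>2 + (norm y)\<^sup>2))"
    by (simp add: power2_norm_eq_inner inner_add_left inner_add_right inner_diff_left
        inner_diff_right inner_commute algebra_simps)
  finally show "2 * inner (T x) y \<le> C * ((norm x)\<^sup>2 + (norm y)\<^sup>2)"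
    by (simp add: algebra_simps)
qed

section \<open>Square roots of positive contractions\<close>

text \<open>If \<open>Y\<close> is a fixed point of \<open>Y \<mapsto> (T + Y\<^sup>2) / 2\<close> then \<open>(1 - Y)\<^sup>2 = 1 - T\<close>. The iteration
  towards it is dominated, step by step, by the same iteration for the scalar \<open>1\<close>.\<close>

primrec sqrt_iter :: "('i, 'i) op \<Rightarrow> nat \<Rightarrow> ('i, 'i) op" where
  "sqrt_iter T 0 = 0"
| "sqrt_iter T (Suc n) = (1 / 2) *\<^sub>R (T + (sqrt_iter T n o\<^sub>L sqrt_iter T n))"

primrec sqrt_iter_bound :: "nat \<Rightarrow> real" where
  "sqrt_iter_bound 0 = 0"
| "sqrt_iter_bound (Suc n) = (1 + sqrt_iter_bound n ^ 2) / 2"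

lemma sqrt_iter_bound_range: "0 \<le> sqrt_iter_bound n \<and> sqrt_iter_bound n \<le> 1"
proof (induction n)
  case (Suc n)
  then have "sqrt_iter_bound n ^ 2 \<le> 1" by (simp add: power_le_one)
  then show ?case by simp
qed simp

lemma sqrt_iter_bound_mono: "sqrt_iter_bound n \<le> sqrt_iter_bound (Suc n)"
proof -
  have "0 \<le> (1 - sqrt_iter_bound n)\<^sup>2" by simp
  then show ?thesis by (simp add: power2_diff)
qed

lemma norm_sqrt_iter:
  assumes T: "norm T \<le> 1"
  shows "norm (sqrt_iter T n) \<le> sqrt_iter_bound n"
proof (induction n)
  case (Suc n)
  have "norm (sqrt_iter T n o\<^sub>L sqrt_iter T n) \<le> norm (sqrt_iter T n) * norm (sqrt_iter T n)"
    by (rule norm_blinfun_compose)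
  also have "\<dots> \<le> sqrt_iter_bound n * sqrt_iter_bound n"
    using Suc sqrt_iter_bound_range[of n] by (intro mult_mono) auto
  finally have "norm (T + (sqrt_iter T n o\<^sub>L sqrt_iter T n)) \<le> 1 + sqrt_iter_bound n ^ 2"
    using T norm_triangle_ineq[of T "sqrt_iter T n o\<^sub>L sqrt_iter T n"]
    unfolding power2_eq_square by linarith
  then show ?case by simp
qed simp

text \<open>The identity \<open>A\<^sup>2 - B\<^sup>2 = A (A - B) + (A - B) B\<close> holds without commutativity, and its scalar analogue
  is exact; so each step for operators is bounded by the step for the scalar \<open>1\<close>.\<close>

lemma norm_sqrt_iter_step:
  assumes T: "norm T \<le> 1"
  shows "norm (sqrt_iter T (Suc n) - sqrt_iter T n) \<le> sqrt_iter_bound (Suc n) - sqrt_iter_bound n"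
proof (induction n)
  case 0
  then show ?case using T by simp
next
  case (Suc n)
  let ?A = "sqrt_iter T (Suc n)" and ?B = "sqrt_iter T n"
  let ?a = "sqrt_iter_bound (Suc n)" and ?b = "sqrt_iter_bound n"
  have ab: "0 \<le> ?a" "0 \<le> ?b" "norm ?A \<le> ?a" "norm ?B \<le> ?b"
    using sqrt_iter_bound_range norm_sqrt_iter[OF T] by blast+
  have sq: "(?A o\<^sub>L ?A) - (?B o\<^sub>L ?B) = (?A o\<^sub>L (?A - ?B)) + ((?A - ?B) o\<^sub>L ?B)"
    by (rule blinfun_eqI) (simp only: minus_blinfun.rep_eq plus_blinfun.rep_eq
        blinfun_apply_blinfun_compose blinfun.diff_right, simp)
  have "norm ((?A o\<^sub>L ?A) - (?B o\<^sub>L ?B)) \<le> norm (?A o\<^sub>L (?A - ?B)) + norm ((?A - ?B) o\<^sub>L ?B)"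
    unfolding sq by (rule norm_triangle_ineq)
  also have "\<dots> \<le> norm ?A * norm (?A - ?B) + norm (?A - ?B) * norm ?B"
    by (intro add_mono norm_blinfun_compose)
  also have "\<dots> \<le> ?a * (?a - ?b) + (?a - ?b) * ?b"
    by (intro add_mono mult_mono ab Suc.IH) (use ab sqrt_iter_bound_mono[of n] in auto)
  also have "\<dots> = ?a ^ 2 - ?b ^ 2" by algebra
  finally have *: "norm ((?A o\<^sub>L ?A) - (?B o\<^sub>L ?B)) \<le> ?a ^ 2 - ?b ^ 2" .
  have e1: "sqrt_iter T (Suc (Suc n)) - ?A = (1 / 2) *\<^sub>R ((?A o\<^sub>L ?A) - (?B o\<^sub>L ?B))"
    unfolding sqrt_iter.simps(2)[of T "Suc n"]
    by (subst (3) sqrt_iter.simps(2)) (simp only: scaleR_diff_right[symmetric] add_diff_cancel_left)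
  have e2: "sqrt_iter_bound (Suc (Suc n)) - ?a = (?a ^ 2 - ?b ^ 2) / 2"
    unfolding sqrt_iter_bound.simps(2)[of "Suc n"]
    by (subst (2) sqrt_iter_bound.simps(2)) (simp only: diff_divide_distrib[symmetric] add_diff_cancel_left)
  show ?case unfolding e1 e2 using * by simp
qed

lemma selfadj_sqrt_iter: "selfadj T \<Longrightarrow> selfadj (sqrt_iter T n)"
  by (induction n)
    (simp_all add: selfadj_zero scaleR_eq_scale_op selfadj_add selfadj_square
      selfadj_scale_real[of _ "1 / 2", simplified])

lemma selfadj_LIMSEQ:
  assumes "\<And>n. selfadj (Y n)" "Y \<longlonglongrightarrow> L" shows "selfadj L"
  unfolding selfadj_def
proof (intro allI)
  fix x y
  have "(\<lambda>n. cinner (Y n x) y) \<longlonglongrightarrow> cinner (L x) y"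
    by (intro bounded_linear.tendsto[OF bounded_linear_cinner_left] blinfun.tendsto assms tendsto_const)
  moreover have "(\<lambda>n. cinner (Y n x) y) \<longlonglongrightarrow> cinner x (L y)"
    unfolding selfadjD[OF assms(1)]
    by (intro bounded_linear.tendsto[OF bounded_linear_cinner_right] blinfun.tendsto assms tendsto_const)
  ultimately show "cinner (L x) y = cinner x (L y)" by (rule LIMSEQ_unique)
qed

lemma positive_contraction_sqrt:
  assumes Q: "selfadj Q" and pos: "\<And>x. 0 \<le> inner (blinfun_apply Q x) x"
    and le: "\<And>x. inner (blinfun_apply Q x) x \<le> (norm x)\<^sup>2"
  obtains S where "selfadj S" "S o\<^sub>L S = Q"
proof -
  define T where "T = id_blinfun - Q"
  have T: "selfadj T" unfolding T_def by (intro selfadj_diff selfadj_id Q)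
  have nT: "norm T \<le> 1"
  proof (rule selfadj_norm_le[OF T])
    show "\<bar>inner (T x) x\<bar> \<le> 1 * (norm x)\<^sup>2" for x
      using pos[of x] le[of x]
      by (simp add: T_def minus_blinfun.rep_eq inner_diff_left power2_norm_eq_inner)
  qed simp
  let ?Y = "sqrt_iter T"
  have "incseq sqrt_iter_bound" by (rule incseq_SucI) (rule sqrt_iter_bound_mono)
  then obtain l where "sqrt_iter_bound \<longlonglongrightarrow> l"
    using incseq_convergent[of sqrt_iter_bound 1] sqrt_iter_bound_range by blast
  then have sb: "summable (\<lambda>n. sqrt_iter_bound (Suc n) - sqrt_iter_bound n)"
    by (rule telescope_summable)
  have "summable (\<lambda>n. ?Y (Suc n) - ?Y n)"
    by (rule summable_comparison_test'[OF sb, of 0]) (rule norm_sqrt_iter_step[OF nT])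
  then have "(\<lambda>n. \<Sum>k<n. ?Y (Suc k) - ?Y k) \<longlonglongrightarrow> (\<Sum>n. ?Y (Suc n) - ?Y n)"
    by (rule summable_LIMSEQ)
  then obtain L where L: "?Y \<longlonglongrightarrow> L"
    unfolding sum_lessThan_telescope by auto
  have "(\<lambda>n. (1 / 2) *\<^sub>R (T + (?Y n o\<^sub>L ?Y n))) \<longlonglongrightarrow> (1 / 2) *\<^sub>R (T + (L o\<^sub>L L))"
    by (intro tendsto_intros bounded_bilinear.tendsto[OF bounded_bilinear_blinfun_compose] L)
  moreover have "(\<lambda>n. (1 / 2) *\<^sub>R (T + (?Y n o\<^sub>L ?Y n))) \<longlonglongrightarrow> L"
    using LIMSEQ_Suc[OF L] by simp
  ultimately have fix_pt: "(1 / 2) *\<^sub>R (T + (L o\<^sub>L L)) = L" by (rule LIMSEQ_unique)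
  have "T + (L o\<^sub>L L) = 2 *\<^sub>R L" by (subst fix_pt[symmetric]) simp
  then have LL: "L o\<^sub>L L = 2 *\<^sub>R L - T" by (simp add: eq_diff_eq add.commute)
  show ?thesis
  proof (rule that)
    show "selfadj (id_blinfun - L)"
      by (intro selfadj_diff selfadj_id selfadj_LIMSEQ[OF selfadj_sqrt_iter[OF T] L])
    show "(id_blinfun - L) o\<^sub>L (id_blinfun - L) = Q"
    proof (rule blinfun_eqI)
      fix x
      have "L (L x) = 2 *\<^sub>R L x - T x"
        using arg_cong[OF LL, of "\<lambda>A. A x"] by (simp add: minus_blinfun.rep_eq scaleR_blinfun.rep_eq)
      then show "((id_blinfun - L) o\<^sub>L (id_blinfun - L)) x = Q x"
        by (simp add: minus_blinfun.rep_eq blinfun.diff_right T_def scaleR_2)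
    qed
  qed
qed

section \<open>Isometries from injections of the index sets\<close>

lemma cinner_ket: "cinner x (ket i) = coord x i"
proof -
  have "cinner x (ket i) = infsum (\<lambda>j. coord x j * cnj (coord (ket i) j)) {i}"
    unfolding cinner_def by (rule infsum_cong_neutral) (auto simp: ket.rep_eq)
  then show ?thesis by (simp add: ket.rep_eq)
qed

text \<open>The function \<open>inv_into UNIV f\<close> is injective on the range of every \<open>f\<close>. So the extension by zero below
  is a contraction for all \<open>f\<close>, and is the isometry \<open>ket i \<mapsto> ket (f i)\<close> for injective \<open>f\<close>.\<close>

lemma sum_push_le:
  assumes "finite F"
  shows "(\<Sum>b\<in>F. (cmod (if b \<in> range f then coord x (inv_into UNIV f b) else 0))\<^sup>2) \<le> (norm x)\<^sup>2"
proof -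
  let ?G = "F \<inter> range f"
  have "(\<Sum>b\<in>F. (cmod (if b \<in> range f then coord x (inv_into UNIV f b) else 0))\<^sup>2)
      = (\<Sum>b\<in>?G. (cmod (coord x (inv_into UNIV f b)))\<^sup>2)"
    by (rule sum.mono_neutral_cong_right) (use assms in auto)
  also have "\<dots> = (\<Sum>a\<in>inv_into UNIV f ` ?G. (cmod (coord x a))\<^sup>2)"
    by (subst sum.reindex) (auto intro: inj_on_inv_into)
  also have "\<dots> \<le> (norm x)\<^sup>2" by (rule sum_coord_le) (use assms in simp)
  finally show ?thesis .
qed

lift_definition push_ell2 :: "('a \<Rightarrow> 'b) \<Rightarrow> 'a ell2 \<Rightarrow> 'b ell2"
  is "\<lambda>f x b. if b \<in> range f then x (inv_into UNIV f b) else 0"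
proof -
  fix f :: "'a \<Rightarrow> 'b" and x :: "'a \<Rightarrow> complex"
  assume "(\<lambda>i. (cmod (x i))\<^sup>2) summable_on UNIV"
  then have x: "coord (Abs_ell2 x) = x" by (simp add: Abs_ell2_inverse)
  show "(\<lambda>b. (cmod (if b \<in> range f then x (inv_into UNIV f b) else 0))\<^sup>2) summable_on UNIV"
    by (rule nonneg_bdd_above_summable_on)
      (use sum_push_le[of _ f "Abs_ell2 x", unfolded x] in
        \<open>auto intro!: bdd_aboveI[of _ "(norm (Abs_ell2 x))\<^sup>2"]\<close>)
qed

definition push :: "('a \<Rightarrow> 'b) \<Rightarrow> ('a, 'b) op" where
  "push f = Blinfun (push_ell2 f)"

lemma push_apply: "push f x = push_ell2 f x"
proof -
  have "bounded_linear (push_ell2 f)"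
  proof (rule bounded_linear_intro[of _ 1])
    show "push_ell2 f (x + y) = push_ell2 f x + push_ell2 f y" for x y
      by transfer (simp add: fun_eq_iff)
    show "push_ell2 f (r *\<^sub>R x) = r *\<^sub>R push_ell2 f x" for r x
      unfolding scaleR_ell2_def by transfer (simp add: fun_eq_iff)
    show "norm (push_ell2 f x) \<le> norm x * 1" for x
    proof (rule power2_le_imp_le)
      have "(norm (push_ell2 f x))\<^sup>2 \<le> (norm x)\<^sup>2"
        unfolding norm_ell2_sq[of "push_ell2 f x"]
        by (rule infsum_le_finite_sums[OF coord_sq_summable])
          (use sum_push_le[of _ f x] in \<open>simp add: push_ell2.rep_eq\<close>)
      then show "(norm (push_ell2 f x))\<^sup>2 \<le> (norm x * 1)\<^sup>2" by simp
    qed simp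
  qed
  then show ?thesis by (simp add: push_def bounded_linear_Blinfun_apply)
qed

lemma clinear_push [simp]: "clinear (push f)"
  unfolding clinear_def push_apply
  by transfer (simp add: fun_eq_iff)

lemma coord_push: "coord (push f x) b = (if b \<in> range f then coord x (inv_into UNIV f b) else 0)"
  by (simp add: push_apply push_ell2.rep_eq)

lemma push_ket:
  assumes "inj f" shows "push f (ket a) = ket (f a)"
  by (rule coord_eqI) (use assms in \<open>auto simp: coord_push ket.rep_eq\<close>)

lemma coord_adj_push:
  assumes "inj f" shows "coord (adj (push f) y) a = coord y (f a)"
  using cinner_adj'[of "push f" y "ket a"] by (simp add: cinner_ket push_ket[OF assms])

lemma adj_push_push:
  assumes "inj f" shows "adj (push f) (push f x) = x"
  by (rule coord_eqI) (use assms in \<open>simp add: coord_adj_push coord_push\<close>)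

lemma adj_push_push_disjoint:
  assumes "inj f" "range f \<inter> range g = {}" shows "adj (push f) (push g x) = 0"
  by (rule coord_eqI) (use assms in \<open>auto simp: coord_adj_push coord_push zero_ell2.rep_eq\<close>)

section \<open>Dilating a resolution of the identity to a unitary of finite order\<close>

lemma unitary_groupI:
  assumes "clinear U" "clinear V" "adj U = V" "\<And>x. V (U x) = x" "\<And>x. U (V x) = x"
  shows "U \<in> carrier unitary_group"
  using assms by (auto simp: unitary_group_def intro!: blinfun_eqI)

lemma unitary_groupD:
  assumes "U \<in> carrier unitary_group"
  shows "clinear U" "adj U (U x) = x" "U (adj U x) = x"
proof -
  have U: "clinear U" "adj U o\<^sub>L U = id_blinfun" "U o\<^sub>L adj U = id_blinfun"
    using assms by (auto simp: unitary_group_def)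
  show "clinear U" "adj U (U x) = x" "U (adj U x) = x"
    using U(1) arg_cong[OF U(2), of "\<lambda>A. A x"] arg_cong[OF U(3), of "\<lambda>A. A x"] by simp_all
qed

lemma group_unitary_group: "group unitary_group"
proof (rule groupI)
  fix U V assume U: "U \<in> carrier unitary_group" and V: "V \<in> carrier unitary_group"
  note u = unitary_groupD[OF U] and v = unitary_groupD[OF V]
  show "U \<otimes>\<^bsub>unitary_group\<^esub> V \<in> carrier unitary_group"
    using u v by (auto simp: unitary_group_def adj_compose intro!: blinfun_eqI)
  have "adj U \<in> carrier unitary_group" "adj U \<otimes>\<^bsub>unitary_group\<^esub> U = \<one>\<^bsub>unitary_group\<^esub>"
    using U by (auto simp: unitary_group_def)
  then show "\<exists>Y\<in>carrier unitary_group. Y \<otimes>\<^bsub>unitary_group\<^esub> U = \<one>\<^bsub>unitary_group\<^esub>" by blast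
next
qed (auto simp: unitary_group_def intro!: blinfun_eqI)

text \<open>For isometries \<open>J\<close> and \<open>V\<close> with orthogonal ranges this is the selfadjoint unitary that exchanges
  \<open>J x\<close> and \<open>V x\<close> and fixes the orthogonal complement of both ranges.\<close>

definition swap_op :: "('i, 'j) op \<Rightarrow> ('i, 'j) op \<Rightarrow> ('j, 'j) op" where
  "swap_op J V = (J o\<^sub>L adj V) + (V o\<^sub>L adj J) + (id_blinfun - (J o\<^sub>L adj J) - (V o\<^sub>L adj V))"

text \<open>For isometries \<open>\<iota> j\<close> with orthogonal ranges this is multiplication by \<open>\<zeta> j\<close> on the range of
  \<open>\<iota> j\<close>, for \<open>j < m\<close>, and the identity on the orthogonal complement of these ranges.\<close>

definition diag_op :: "nat \<Rightarrow> (nat \<Rightarrow> ('i, 'j) op) \<Rightarrow> (nat \<Rightarrow> complex) \<Rightarrow> ('j, 'j) op" where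
  "diag_op m \<iota> \<zeta> = id_blinfun + (\<Sum>j<m. scale_op (\<zeta> j - 1) (\<iota> j o\<^sub>L adj (\<iota> j)))"

context
  fixes J V :: "('i, 'j) op"
  assumes lin: "clinear J" "clinear V"
    and JJ: "\<And>x. adj J (J x) = x" and VV: "\<And>x. adj V (V x) = x" and JV: "\<And>x. adj J (V x) = 0"
begin

lemma adj_V_J: "adj V (J x) = 0"
  by (rule cinner_eqI) (simp add: cinner_adj'[OF lin(2)] cinner_adj[OF lin(1)] JV)

lemma swap_op_apply:
  "swap_op J V x = J (adj V x) + V (adj J x) + (x - J (adj J x) - V (adj V x))"
  by (simp add: swap_op_def plus_blinfun.rep_eq minus_blinfun.rep_eq)

lemma selfadj_swap_op: "selfadj (swap_op J V)"
  unfolding selfadj_def swap_op_apply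
  by (simp add: cinner_simps cinner_adj[OF lin(1)] cinner_adj[OF lin(2)]
      cinner_adj'[OF lin(1), symmetric] cinner_adj'[OF lin(2), symmetric])

lemma swap_op_J: "swap_op J V (J x) = V x"
  by (simp add: swap_op_apply JJ adj_V_J)

lemma adj_J_swap_op: "adj J (swap_op J V x) = adj V x"
  by (simp add: swap_op_apply blinfun.add_right blinfun.diff_right JJ JV)

lemma adj_V_swap_op: "adj V (swap_op J V x) = adj J x"
  by (simp add: swap_op_apply blinfun.add_right blinfun.diff_right VV adj_V_J)

lemma swap_op_swap_op: "swap_op J V (swap_op J V x) = x"
  unfolding swap_op_apply[of "swap_op J V x"] adj_J_swap_op adj_V_swap_op
  by (simp add: swap_op_apply)

end

context
  fixes m :: nat and \<iota> :: "nat \<Rightarrow> ('i, 'j) op"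
  assumes lin: "\<And>j. clinear (\<iota> j)"
    and orth: "\<And>i j x. adj (\<iota> i) (\<iota> j x) = (if i = j then x else 0)"
begin

lemma diag_op_apply: "diag_op m \<iota> f x = x + (\<Sum>j<m. cscale (f j - 1) (\<iota> j (adj (\<iota> j) x)))"
  by (simp add: diag_op_def plus_blinfun.rep_eq blinfun.sum_left)

lemma adj_diag_op_apply:
  assumes "i < m" shows "adj (\<iota> i) (diag_op m \<iota> f x) = cscale (f i) (adj (\<iota> i) x)"
proof -
  have "(\<Sum>j<m. cscale (f j - 1) (adj (\<iota> i) (\<iota> j (adj (\<iota> j) x)))) =
      (\<Sum>j<m. if j = i then cscale (f i - 1) (adj (\<iota> i) x) else 0)"
    by (rule sum.cong) (auto simp: orth cscale_zero)
  also have "\<dots> = cscale (f i - 1) (adj (\<iota> i) x)" using assms by simp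
  finally show ?thesis
    using cscale_simps(2)[of "f i - 1" 1 "adj (\<iota> i) x"]
    by (simp add: diag_op_apply blinfun.add_right blinfun.sum_right clinearD lin cscale_simps add.commute)
qed

lemma diag_op_mult: "diag_op m \<iota> f (diag_op m \<iota> g x) = diag_op m \<iota> (\<lambda>j. f j * g j) x"
proof -
  have "cscale (g j - 1) y + cscale (f j - 1) (cscale (g j) y) = cscale (f j * g j - 1) y" for j and y :: "'j ell2"
    unfolding cscale_simps(3) cscale_simps(2)[symmetric] by (simp add: algebra_simps)
  then have "(\<Sum>j<m. cscale (g j - 1) (\<iota> j (adj (\<iota> j) x))) +
      (\<Sum>j<m. cscale (f j - 1) (cscale (g j) (\<iota> j (adj (\<iota> j) x)))) =
      (\<Sum>j<m. cscale (f j * g j - 1) (\<iota> j (adj (\<iota> j) x)))"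
    by (simp add: sum.distrib[symmetric])
  moreover have "diag_op m \<iota> f (diag_op m \<iota> g x) = diag_op m \<iota> g x +
      (\<Sum>j<m. cscale (f j - 1) (cscale (g j) (\<iota> j (adj (\<iota> j) x))))"
    by (simp add: diag_op_apply[of f] adj_diag_op_apply clinearD lin)
  ultimately show ?thesis by (simp add: diag_op_apply[of g] diag_op_apply[of "\<lambda>j. f j * g j"] add.assoc)
qed

lemma diag_op_one: "(\<And>j. j < m \<Longrightarrow> f j = 1) \<Longrightarrow> diag_op m \<iota> f x = x"
  by (simp add: diag_op_apply cscale_zero)

lemma clinear_diag_op: "clinear (diag_op m \<iota> f)"
  unfolding diag_op_def by (intro clinear_simps clinear_sum clinear_id clinear_compose clinear_adj lin)

lemma adj_diag_op: "adj (diag_op m \<iota> f) = diag_op m \<iota> (\<lambda>j. cnj (f j))"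
  by (rule adj_unique)
    (simp add: diag_op_apply cinner_simps cinner_sum_left cinner_sum_right cinner_adj[OF lin]
      cinner_adj'[OF lin, symmetric])

end

text \<open>Isometries with pairwise orthogonal ranges, as among the generators of a Cuntz algebra. They provide
  infinitely many orthogonal copies of \<open>\<ell>\<^sup>2\<close> within \<open>\<ell>\<^sup>2\<close>, so that dilations stay on the same space.\<close>

definition cuntz :: "nat \<Rightarrow> (nat, nat) op" where
  "cuntz j = push (\<lambda>i. prod_encode (j, i))"

lemma clinear_cuntz [simp]: "clinear (cuntz j)"
  by (simp add: cuntz_def)

lemma cuntz_orthogonal: "adj (cuntz i) (cuntz j x) = (if i = j then x else 0)"
  unfolding cuntz_def
  by (auto intro!: adj_push_push adj_push_push_disjoint simp: inj_on_def prod_encode_eq)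

text \<open>The square roots \<open>S j\<close> of the \<open>Q j\<close> are the components of an isometry \<open>V\<close> into a sum of
  copies of \<open>\<ell>\<^sup>2\<close> (Naimark); the diagonal unitary on that sum compresses along \<open>V\<close> to
  \<open>\<Sum>j<m. \<zeta> j Q j\<close>. The swap of \<open>V\<close> with one further copy moves the compression to the
  copy \<open>cuntz 0\<close>, which is independent of the \<open>Q j\<close>. Hence several resolutions of the identity
  are dilated on the same space.\<close>

lemma resolution_unitary_dilation:
  fixes Q :: "nat \<Rightarrow> (nat, nat) op"
  assumes Q: "\<And>j. j < m \<Longrightarrow> selfadj (Q j)" "\<And>j x. j < m \<Longrightarrow> 0 \<le> inner (Q j x) x"
    and sum: "(\<Sum>j<m. Q j) = id_blinfun"
    and \<zeta>: "\<And>j. j < m \<Longrightarrow> \<zeta> j ^ p = 1" and p: "p > 0"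
  obtains W where "W \<in> carrier unitary_group" "W [^]\<^bsub>unitary_group\<^esub> p = id_blinfun"
    "adj (cuntz 0) o\<^sub>L W o\<^sub>L cuntz 0 = (\<Sum>j<m. scale_op (\<zeta> j) (Q j))"
proof -
  have sumx: "(\<Sum>j<m. Q j x) = x" for x
    using arg_cong[OF sum, of "\<lambda>A. A x"] by (simp add: blinfun.sum_left)
  have "\<exists>S. selfadj S \<and> S o\<^sub>L S = Q j" if j: "j < m" for j
  proof -
    have "inner (Q j x) x \<le> (norm x)\<^sup>2" for x
    proof -
      have "inner (Q j x) x \<le> (\<Sum>j<m. inner (Q j x) x)"
        by (rule member_le_sum) (use j Q in auto)
      then show ?thesis by (simp add: inner_sum_left[symmetric] sumx power2_norm_eq_inner)
    qed
    then show ?thesis using positive_contraction_sqrt[OF Q[OF j]] by blast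
  qed
  then obtain S where S: "\<And>j. j < m \<Longrightarrow> selfadj (S j)" and SS: "\<And>j. j < m \<Longrightarrow> S j o\<^sub>L S j = Q j"
    by metis
  have SSx: "S j (S j x) = Q j x" if "j < m" for j x
    using arg_cong[OF SS[OF that], of "\<lambda>A. A x"] by simp
  define J where "J = cuntz 0"
  define \<iota> where "\<iota> j = cuntz (Suc j)" for j
  have lin: "clinear J" "clinear (\<iota> j)" for j by (simp_all add: J_def \<iota>_def)
  have orth: "adj (\<iota> i) (\<iota> j x) = (if i = j then x else 0)" for i j x
    by (simp add: \<iota>_def cuntz_orthogonal)
  have Jo: "adj J (J x) = x" "adj J (\<iota> j x) = 0" for j x
    by (simp_all add: J_def \<iota>_def cuntz_orthogonal)
  define V where "V = (\<Sum>j<m. \<iota> j o\<^sub>L S j)"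
  have Vx: "V x = (\<Sum>j<m. \<iota> j (S j x))" for x by (simp add: V_def blinfun.sum_left)
  have linV: "clinear V"
    unfolding V_def by (intro clinear_sum clinear_compose lin selfadj_clinear S) simp
  have aV: "adj V x = (\<Sum>j<m. S j (adj (\<iota> j) x))" for x
  proof (rule cinner_eqI)
    fix z
    have "cinner (adj V x) z = (\<Sum>j<m. cinner x (\<iota> j (S j z)))"
      by (simp add: cinner_adj'[OF linV] Vx cinner_sum_right)
    also have "\<dots> = (\<Sum>j<m. cinner (S j (adj (\<iota> j) x)) z)"
      by (rule sum.cong) (simp_all add: selfadjD[OF S] cinner_adj'[OF lin(2)])
    finally show "cinner (adj V x) z = cinner (\<Sum>j<m. S j (adj (\<iota> j) x)) z"
      by (simp add: cinner_sum_left)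
  qed
  have iV: "adj (\<iota> i) (V x) = S i x" if "i < m" for i x
  proof -
    have "adj (\<iota> i) (V x) = (\<Sum>j<m. if j = i then S i x else 0)"
      unfolding Vx blinfun.sum_right by (rule sum.cong) (auto simp: orth)
    then show ?thesis using that by simp
  qed
  have VV: "adj V (V x) = x" for x
    by (simp add: aV iV SSx sumx)
  have JV: "adj J (V x) = 0" for x by (simp add: Vx blinfun.sum_right Jo)
  note swap = lin(1) linV Jo(1) VV JV
  define U where "U = swap_op J V"
  have U: "selfadj U" "\<And>x. U (U x) = x" "\<And>x. U (J x) = V x" "\<And>x. adj J (U x) = adj V x"
    unfolding U_def
    by (rule selfadj_swap_op[OF swap] swap_op_swap_op[OF swap] swap_op_J[OF swap]
        adj_J_swap_op[OF swap])+
  define D where "D f = diag_op m \<iota> f" for f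
  have D: "clinear (D f)" "adj (D f) = D (\<lambda>j. cnj (f j))" "D f (D g x) = D (\<lambda>j. f j * g j) x" for f g x
    unfolding D_def
    by (rule clinear_diag_op[OF lin(2) orth] adj_diag_op[OF lin(2) orth] diag_op_mult[OF lin(2) orth])+
  have D1: "D f x = x" if "\<And>j. j < m \<Longrightarrow> f j = 1" for f x
    unfolding D_def by (rule diag_op_one[OF lin(2) orth that])
  have iD: "adj (\<iota> i) (D f x) = cscale (f i) (adj (\<iota> i) x)" if "i < m" for i f x
    unfolding D_def by (rule adj_diag_op_apply[OF lin(2) orth that])
  define W where "W = U o\<^sub>L D \<zeta> o\<^sub>L U"
  have U': "clinear U" "adj U = U" using U by (simp_all add: selfadj_clinear selfadj_adj)
  have unit: "cnj (\<zeta> j) * \<zeta> j = 1" "\<zeta> j * cnj (\<zeta> j) = 1" if "j < m" for j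
  proof -
    have "norm (\<zeta> j) ^ p = 1" using arg_cong[OF \<zeta>[OF that], of norm] by (simp add: norm_power)
    then have "norm (\<zeta> j) = 1" using power_eq_imp_eq_base[of "norm (\<zeta> j)" p 1] p by simp
    then show "\<zeta> j * cnj (\<zeta> j) = 1" by (metis complex_norm_square of_real_1 power_one)
    then show "cnj (\<zeta> j) * \<zeta> j = 1" by (simp only: mult.commute)
  qed
  show ?thesis
  proof (rule that)
    show "W \<in> carrier unitary_group"
    proof (rule unitary_groupI)
      show "adj W = U o\<^sub>L D (\<lambda>j. cnj (\<zeta> j)) o\<^sub>L U"
        by (rule blinfun_eqI) (simp add: W_def adj_compose U' D)
      show "clinear W" "clinear (U o\<^sub>L D (\<lambda>j. cnj (\<zeta> j)) o\<^sub>L U)"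
        by (simp_all add: W_def U' D)
      show "(U o\<^sub>L D (\<lambda>j. cnj (\<zeta> j)) o\<^sub>L U) (W x) = x" "W ((U o\<^sub>L D (\<lambda>j. cnj (\<zeta> j)) o\<^sub>L U) x) = x" for x
        by (simp_all add: W_def U(2) D(3) D1 unit)
    qed
    have "(W [^]\<^bsub>unitary_group\<^esub> k) x = U (D (\<lambda>j. \<zeta> j ^ k) (U x))" for k x
    proof (induction k arbitrary: x)
      case 0
      then show ?case by (simp add: unitary_group_def D1 U(2))
    next
      case (Suc k)
      have "(W [^]\<^bsub>unitary_group\<^esub> Suc k) x = (W [^]\<^bsub>unitary_group\<^esub> k) (W x)"
        by (simp add: unitary_group_def)
      also have "\<dots> = U (D (\<lambda>j. \<zeta> j ^ k) (U (W x)))" by (rule Suc)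
      also have "\<dots> = U (D (\<lambda>j. \<zeta> j ^ Suc k) (U x))"
        by (simp add: W_def U(2) D(3) mult.commute)
      finally show ?case .
    qed
    then show "W [^]\<^bsub>unitary_group\<^esub> p = id_blinfun"
      by (intro blinfun_eqI) (simp add: D1 \<zeta> U(2))
    show "adj (cuntz 0) o\<^sub>L W o\<^sub>L cuntz 0 = (\<Sum>j<m. scale_op (\<zeta> j) (Q j))"
    proof (rule blinfun_eqI)
      fix x
      have "(adj J o\<^sub>L W o\<^sub>L J) x = adj V (D \<zeta> (V x))" by (simp add: W_def U)
      also have "\<dots> = (\<Sum>j<m. cscale (\<zeta> j) (Q j x))"
        by (simp add: aV iD iV clinearD selfadj_clinear S SSx)
      finally show "(adj (cuntz 0) o\<^sub>L W o\<^sub>L cuntz 0) x = (\<Sum>j<m. scale_op (\<zeta> j) (Q j)) x"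
        by (simp add: J_def blinfun.sum_left)
    qed
  qed
qed

section \<open>Homomorphisms from cyclic groups and free products\<close>

lemma int_pow_hom_integer_mod_group:
  fixes n :: nat
  assumes K: "group K" and x: "x \<in> carrier K" "x [^]\<^bsub>K\<^esub> n = \<one>\<^bsub>K\<^esub>"
  shows "(\<lambda>k::int. x [^]\<^bsub>K\<^esub> k) \<in> hom (integer_mod_group n) K"
proof (rule homI)
  interpret group K by fact
  fix k l :: int
  show "x [^]\<^bsub>K\<^esub> k \<in> carrier K" using x by simp
  have "x [^]\<^bsub>K\<^esub> (int n * q) = \<one>\<^bsub>K\<^esub>" for q :: int
    using int_pow_pow[OF x(1), of "int n" q] x(2) by (simp add: int_pow_int)
  moreover have "x [^]\<^bsub>K\<^esub> (k + l) = x [^]\<^bsub>K\<^esub> (int n * ((k + l) div int n) + (k + l) mod int n)"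
    by simp
  ultimately have "x [^]\<^bsub>K\<^esub> (k + l) = x [^]\<^bsub>K\<^esub> ((k + l) mod int n)"
    using x(1) by (simp only: int_pow_mult int_pow_closed l_one)
  then show "x [^]\<^bsub>K\<^esub> (k \<otimes>\<^bsub>integer_mod_group n\<^esub> l) = x [^]\<^bsub>K\<^esub> k \<otimes>\<^bsub>K\<^esub> x [^]\<^bsub>K\<^esub> l"
    using x(1) by (simp add: int_pow_mult)
qed

primrec fp_eval :: "('k, 'd) monoid_scheme \<Rightarrow> ('a \<Rightarrow> 'k) \<Rightarrow> ('b \<Rightarrow> 'k) \<Rightarrow> ('a + 'b) list \<Rightarrow> 'k" where
  "fp_eval K f g [] = \<one>\<^bsub>K\<^esub>"
| "fp_eval K f g (s # u) = case_sum f g s \<otimes>\<^bsub>K\<^esub> fp_eval K f g u"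

text \<open>The universal property of the free product. A word is evaluated letter by letter, and the
  evaluation is invariant under each of the relations that generate \<open>fp_rel\<close>.\<close>

lemma free_product_hom_exists:
  assumes G: "group G" and H: "group H" and K: "group K"
    and f: "f \<in> hom G K" and g: "g \<in> hom H K"
  obtains h where "h \<in> hom (free_product G H) K" "h \<in> extensional (carrier (free_product G H))"
    "\<And>x. x \<in> carrier G \<Longrightarrow> h (fp_inl G H x) = f x"
    "\<And>y. y \<in> carrier H \<Longrightarrow> h (fp_inr G H y) = g y"
proof -
  interpret K: group K by fact
  let ?e = "fp_eval K f g" and ?P = "free_product G H"
  have fc: "f x \<in> carrier K" if "x \<in> carrier G" for x using f that by (auto simp: hom_def)
  have gc: "g x \<in> carrier K" if "x \<in> carrier H" for x using g that by (auto simp: hom_def)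
  have e_closed: "?e u \<in> carrier K" if "u \<in> fp_words G H" for u
    using that by (induction u) (auto intro!: K.m_closed fc gc)
  note e_closed = e_closed e_closed[unfolded in_lists_conv_set]
  have e_append: "?e (u @ v) = ?e u \<otimes>\<^bsub>K\<^esub> ?e v" if "u \<in> fp_words G H" "v \<in> fp_words G H" for u v
    using that by (induction u) (auto simp: fc gc e_closed K.m_assoc)
  note e_append = e_append e_append[unfolded in_lists_conv_set]
  have letter: "Inl x \<in> carrier G <+> carrier H \<longleftrightarrow> x \<in> carrier G"
    "Inr y \<in> carrier G <+> carrier H \<longleftrightarrow> y \<in> carrier H" for x y by auto
  have f1: "f \<one>\<^bsub>G\<^esub> = \<one>\<^bsub>K\<^esub>" by (rule hom_one[OF f G K])
  have g1: "g \<one>\<^bsub>H\<^esub> = \<one>\<^bsub>K\<^esub>" by (rule hom_one[OF g H K])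
  have G1: "\<one>\<^bsub>G\<^esub> \<in> carrier G" and H1: "\<one>\<^bsub>H\<^esub> \<in> carrier H"
    using G H by (simp_all add: group.is_monoid monoid.one_closed)
  have Gm: "x \<otimes>\<^bsub>G\<^esub> y \<in> carrier G" if "x \<in> carrier G" "y \<in> carrier G" for x y
    using G that by (simp add: group.is_monoid monoid.m_closed)
  have Hm: "x \<otimes>\<^bsub>H\<^esub> y \<in> carrier H" if "x \<in> carrier H" "y \<in> carrier H" for x y
    using H that by (simp add: group.is_monoid monoid.m_closed)
  have e_rel: "(u, v) \<in> fp_rel G H \<Longrightarrow> ?e u = ?e v" for u v
  proof (induction rule: fp_rel.induct)
    case (fp_oneL u v)
    then show ?case using G1 by (simp add: e_append e_closed letter f1 K.m_assoc)
  next
    case (fp_oneR u v)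
    then show ?case using H1 by (simp add: e_append e_closed letter g1 K.m_assoc)
  next
    case (fp_multL u v x y)
    then show ?case using Gm[of x y] by (simp add: e_append e_closed letter fc hom_mult[OF f] K.m_assoc)
  next
    case (fp_multR u v x y)
    then show ?case using Hm[of x y] by (simp add: e_append e_closed letter gc hom_mult[OF g] K.m_assoc)
  qed simp_all
  define h where "h = restrict (\<lambda>A. ?e (SOME u. u \<in> A)) (carrier ?P)"
  have car: "carrier ?P = (\<lambda>u. fp_rel G H `` {u}) ` fp_words G H"
    by (auto simp: free_product_def quotient_def)
  have h: "h (fp_rel G H `` {u}) = ?e u" if u: "u \<in> fp_words G H" for u
  proof -
    have "u \<in> fp_rel G H `` {u}" using fp_rel.fp_refl[OF u] by (simp add: Image_singleton_iff)
    then have "(SOME u'. u' \<in> fp_rel G H `` {u}) \<in> fp_rel G H `` {u}" by (rule someI)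
    then have "(u, SOME u'. u' \<in> fp_rel G H `` {u}) \<in> fp_rel G H" by (simp add: Image_singleton_iff)
    from e_rel[OF this] show ?thesis using u by (simp add: h_def car)
  qed
  show ?thesis
  proof (rule that)
    show "h \<in> hom ?P K"
    proof (rule homI)
      fix A B assume "A \<in> carrier ?P" "B \<in> carrier ?P"
      then obtain u v where u: "u \<in> fp_words G H" "A = fp_rel G H `` {u}"
        and v: "v \<in> fp_words G H" "B = fp_rel G H `` {v}" unfolding car by blast
      have uv: "u @ v \<in> fp_words G H" using u v by auto
      show "h A \<in> carrier K" by (simp only: u(2) h[OF u(1)] e_closed(1)[OF u(1)])
      show "h (A \<otimes>\<^bsub>?P\<^esub> B) = h A \<otimes>\<^bsub>K\<^esub> h B"
        by (simp only: u(2) v(2) fp_mult[OF G H u(1) v(1)] h[OF uv] h[OF u(1)] h[OF v(1)]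
            e_append(1)[OF u(1) v(1)])
    qed
    show "h (fp_inl G H x) = f x" if "x \<in> carrier G" for x
      unfolding fp_inl_def using h[of "[Inl x]"] that fc[of x] by (simp add: letter)
    show "h (fp_inr G H y) = g y" if "y \<in> carrier H" for y
      unfolding fp_inr_def using h[of "[Inr y]"] that gc[of y] by (simp add: letter)
  qed (simp add: h_def)
qed

lemma Z3_Z2_representation:
  assumes W: "W \<in> carrier unitary_group" "W [^]\<^bsub>unitary_group\<^esub> (3::nat) = id_blinfun"
    and V: "V \<in> carrier unitary_group" "V [^]\<^bsub>unitary_group\<^esub> (2::nat) = id_blinfun"
  obtains \<pi> where "\<pi> \<in> unitary_reps Z3_Z2"
    "\<pi> (fp_inl (integer_mod_group 3) (integer_mod_group 2) 1) = W"
    "\<pi> (fp_inr (integer_mod_group 3) (integer_mod_group 2) 1) = V"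
proof -
  have one: "\<one>\<^bsub>unitary_group\<^esub> = id_blinfun" by (simp add: unitary_group_def)
  note hW = int_pow_hom_integer_mod_group[OF group_unitary_group W(1), of 3, unfolded one, OF W(2)]
  note hV = int_pow_hom_integer_mod_group[OF group_unitary_group V(1), of 2, unfolded one, OF V(2)]
  show ?thesis
  proof (rule free_product_hom_exists[OF group_integer_mod_group group_integer_mod_group
        group_unitary_group hW hV, folded Z3_Z2_def])
    fix h
    assume "h \<in> hom Z3_Z2 unitary_group" "h \<in> extensional (carrier Z3_Z2)"
      and l: "\<And>x. x \<in> carrier (integer_mod_group 3) \<Longrightarrow>
        h (fp_inl (integer_mod_group 3) (integer_mod_group 2) x) = W [^]\<^bsub>unitary_group\<^esub> x"
      and r: "\<And>x. x \<in> carrier (integer_mod_group 2) \<Longrightarrow>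
        h (fp_inr (integer_mod_group 3) (integer_mod_group 2) x) = V [^]\<^bsub>unitary_group\<^esub> x"
    then show thesis
      using l[of 1] r[of 1] W(1) V(1)
      by (intro that[of h]) (simp_all add: unitary_reps_def group.int_pow_1[OF group_unitary_group])
  qed
qed

section \<open>Unital completely positive maps\<close>

lemma bounded_opsD:
  assumes "T \<in> bounded_ops I J"
  shows "clinear T" "blinfun_apply T (restrict_ell2 I x) = T x"
    "restrict_ell2 J (blinfun_apply T x) = T x"
proof -
  have T: "proj J o\<^sub>L T o\<^sub>L proj I = T" using assms by (simp add: bounded_ops_def)
  have *: "restrict_ell2 J (T (restrict_ell2 I y)) = T y" for y
    using arg_cong[OF T, of "\<lambda>A. A y"] by simp
  show "clinear T" using assms by (simp add: bounded_ops_def)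
  show "T (restrict_ell2 I x) = T x" using *[of x] *[of "restrict_ell2 I x"] by simp
  show "restrict_ell2 J (T x) = T x" using *[of x] by (metis restrict_restrict)
qed

lemma bounded_opsI:
  assumes "clinear T" "\<And>x. blinfun_apply T (restrict_ell2 I x) = T x"
    "\<And>x. restrict_ell2 J (blinfun_apply T x) = T x"
  shows "T \<in> bounded_ops I J"
  using assms by (auto simp: bounded_ops_def intro: blinfun_eqI)

lemma adj_in_bounded_ops:
  assumes "T \<in> bounded_ops I J" shows "adj T \<in> bounded_ops J I"
proof (rule bounded_opsI)
  note T = bounded_opsD[OF assms]
  show "clinear (adj T)" by (simp add: T)
  show "adj T (restrict_ell2 J x) = adj T x" for x
    by (rule cinner_eqI) (simp add: cinner_adj'[OF T(1)] cinner_restrict T)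
  show "restrict_ell2 I (adj T x) = adj T x" for x
    by (rule cinner_eqI) (simp add: cinner_adj'[OF T(1)] cinner_restrict T)
qed

lemma compose_in_bounded_ops:
  assumes "S \<in> bounded_ops J K" "T \<in> bounded_ops I J" shows "S o\<^sub>L T \<in> bounded_ops I K"
  by (rule bounded_opsI) (use bounded_opsD[OF assms(1)] bounded_opsD[OF assms(2)] in simp_all)

lemma restrict_add: "restrict_ell2 I (x + y) = restrict_ell2 I x + restrict_ell2 I y"
  by transfer (simp add: fun_eq_iff)

lemma subspace_bounded_ops: "cop.subspace (bounded_ops I J)"
  by (rule cop.subspaceI)
    (auto intro!: bounded_opsI dest: bounded_opsD simp: plus_blinfun.rep_eq zero_blinfun.rep_eq
      restrict_add restrict_cscale bounded_opsD,
      simp add: bounded_linear.linear[OF bounded_linear_restrict_ell2] linear_0)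

lemma proj_in_bounded_ops: "proj I \<in> bounded_ops I I"
  by (rule bounded_opsI) simp_all

lemma inner_restrict_self: "inner (restrict_ell2 I x) x = (norm (restrict_ell2 I x))\<^sup>2"
  using cinner_restrict[of I "restrict_ell2 I x" x] by (simp add: power2_norm_eq_inner inner_ell2_def)

lemma inner_restrict_le: "inner (restrict_ell2 I x) x \<le> (norm x)\<^sup>2"
  unfolding inner_restrict_self norm_ell2_sq
  by (intro infsum_mono coord_sq_summable) (simp add: restrict_ell2.rep_eq)

lemma selfadj_cinner_self:
  assumes "selfadj T" shows "cinner (blinfun_apply T x) x = of_real (inner (T x) x)"
  using selfadjD[OF assms, of x x] cinner_commute[of "T x" x]
  by (simp add: complex_eq_iff inner_ell2_def)

lemma cinner_restrict_self: "cinner (restrict_ell2 I x) x = of_real (inner (restrict_ell2 I x) x)"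
proof -
  have "selfadj (proj I)" by (rule selfadjI) simp_all
  from selfadj_cinner_self[OF this, of x] show ?thesis by simp
qed

definition operator_system :: "'i set \<Rightarrow> ('i, 'i) op set \<Rightarrow> bool" where
  "operator_system I S \<longleftrightarrow> cop.subspace S \<and> proj I \<in> S \<and> S \<subseteq> bounded_ops I I \<and> (\<forall>x\<in>S. adj x \<in> S)"

lemma operator_system_opsys:
  assumes xs: "set xs \<subseteq> bounded_ops I I" shows "operator_system I (opsys I xs)"
  unfolding operator_system_def
proof (intro conjI ballI)
  let ?B = "{proj I} \<union> set xs \<union> adj ` set xs"
  have B: "?B \<subseteq> bounded_ops I I" using xs by (auto intro: adj_in_bounded_ops proj_in_bounded_ops)
  show "cop.subspace (opsys I xs)" by (simp add: opsys_def)
  show "proj I \<in> opsys I xs" unfolding opsys_def by (rule cop.span_base) simp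
  show sub: "opsys I xs \<subseteq> bounded_ops I I"
    unfolding opsys_def by (rule cop.span_minimal[OF B subspace_bounded_ops])
  have "y \<in> bounded_ops I I \<and> adj y \<in> opsys I xs" if "y \<in> opsys I xs" for y
    using that unfolding opsys_def
  proof (induction rule: cop.span_induct_alt)
    case base
    have "adj (0 :: ('a, 'a) op) = 0" by (rule adj_unique) (simp add: zero_blinfun.rep_eq)
    then show ?case using cop.subspace_0[OF subspace_bounded_ops] by (simp add: cop.span_zero)
  next
    case (step c y z)
    have y: "y \<in> bounded_ops I I" using step(1) B by blast
    have "adj y \<in> cspan ?B"
    proof (cases "y \<in> adj ` set xs")
      case True
      then obtain x where x: "x \<in> set xs" "y = adj x" by blast
      then have "adj y = x" using xs by (simp add: bounded_opsD(1)[of x I I] subset_iff)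
      then show ?thesis using x by (intro cop.span_base) simp
    qed (use step(1) in \<open>auto intro: cop.span_base\<close>)
    moreover have "adj (scale_op c y + z) = scale_op (cnj c) (adj y) + adj z"
      using bounded_opsD(1)[OF y] step(2) by (simp add: adj_add adj_scale_op bounded_opsD(1)[of z I I])
    ultimately show ?case
      using y step(2) subspace_bounded_ops[of I I]
      by (auto intro: cop.span_add cop.span_scale cop.subspace_add cop.subspace_scale)
  qed
  then show "adj x \<in> opsys I xs" if "x \<in> opsys I xs" for x using that by blast
qed

lemma ucpD:
  assumes "\<phi> \<in> ucp I S n"
  shows "x \<in> S \<Longrightarrow> \<phi> x \<in> BL n" "x \<in> S \<Longrightarrow> y \<in> S \<Longrightarrow> \<phi> (x + y) = \<phi> x + \<phi> y"
    "x \<in> S \<Longrightarrow> \<phi> (scale_op c x) = scale_op c (\<phi> x)" "\<phi> (proj I) = proj (below n)"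
    "\<phi> \<in> extensional S"
    "(\<And>i j. i < k \<Longrightarrow> j < k \<Longrightarrow> T i j \<in> S) \<Longrightarrow> pos_matrix k T \<Longrightarrow> pos_matrix k (\<lambda>i j. \<phi> (T i j))"
  using assms by (auto simp: ucp_def PiE_def Pi_def)

text \<open>Apart from direct sums, all ucp maps below arise in this way: moving \<open>adj J\<close> to the other side of the inner
  product turns the form of the compressed matrix at \<open>\<xi>\<close> into that of the original at \<open>J \<circ> \<xi>\<close>.
  Taking for \<open>\<Phi>\<close> the identity gives vector states and compressed representations, and taking a ucp
  map gives its compressions.\<close>

lemma compression_of_cp_map_ucp:
  assumes S: "operator_system I S"
    and bd: "\<And>x. x \<in> S \<Longrightarrow> \<Phi> x \<in> bounded_ops K K"
    and add: "\<And>x y. x \<in> S \<Longrightarrow> y \<in> S \<Longrightarrow> \<Phi> (x + y) = \<Phi> x + \<Phi> y"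
    and scale: "\<And>c x. x \<in> S \<Longrightarrow> \<Phi> (scale_op c x) = scale_op c (\<Phi> x)"
    and cp: "\<And>k T. (\<And>i j. i < k \<Longrightarrow> j < k \<Longrightarrow> T i j \<in> S) \<Longrightarrow> pos_matrix k T \<Longrightarrow>
      pos_matrix k (\<lambda>i j. \<Phi> (T i j))"
    and J: "J \<in> bounded_ops (below n) K"
    and unital: "adj J o\<^sub>L \<Phi> (proj I) o\<^sub>L J = proj (below n)"
  shows "(\<lambda>r\<in>S. adj J o\<^sub>L \<Phi> r o\<^sub>L J) \<in> ucp I S n"
proof -
  have sub: "cop.subspace S" "proj I \<in> S" using S by (auto simp: operator_system_def)
  note linJ = bounded_opsD(1)[OF J]
  let ?\<psi> = "\<lambda>r\<in>S. adj J o\<^sub>L \<Phi> r o\<^sub>L J"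
  have "?\<psi> \<in> S \<rightarrow>\<^sub>E BL n"
    using bd by (auto intro!: compose_in_bounded_ops[OF compose_in_bounded_ops[OF adj_in_bounded_ops[OF J]] J])
  moreover have "?\<psi> (x + y) = ?\<psi> x + ?\<psi> y" if "x \<in> S" "y \<in> S" for x y
    using that cop.subspace_add[OF sub(1) that] add[OF that]
    by (auto intro!: blinfun_eqI simp: plus_blinfun.rep_eq blinfun.add_right)
  moreover have "?\<psi> (scale_op c x) = scale_op c (?\<psi> x)" if "x \<in> S" for c x
    using that cop.subspace_scale[OF sub(1) that] scale[OF that] linJ
    by (auto intro!: blinfun_eqI simp: clinearD)
  moreover have "?\<psi> (proj I) = proj (below n)" using sub unital by simp
  moreover have "pos_matrix k (\<lambda>i j. ?\<psi> (T i j))"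
    if T: "\<forall>i<k. \<forall>j<k. T i j \<in> S" "pos_matrix k T" for k T
    unfolding pos_matrix_def
  proof
    fix \<xi>
    have "(\<Sum>i<k. \<Sum>j<k. cinner (?\<psi> (T i j) (\<xi> j)) (\<xi> i)) =
        (\<Sum>i<k. \<Sum>j<k. cinner (\<Phi> (T i j) (J (\<xi> j))) (J (\<xi> i)))"
      by (intro sum.cong) (use T in \<open>auto simp: cinner_adj'[OF linJ]\<close>)
    moreover have "pos_matrix k (\<lambda>i j. \<Phi> (T i j))" using T by (intro cp) auto
    ultimately show "(\<Sum>i<k. \<Sum>j<k. cinner (?\<psi> (T i j) (\<xi> j)) (\<xi> i)) \<in> \<real>\<^sub>\<ge>\<^sub>0"
      by (simp add: pos_matrix_def)
  qed
  ultimately show ?thesis by (simp add: ucp_def)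
qed

lemma compression_ucp:
  assumes S: "operator_system I S" and J: "J \<in> bounded_ops (below n) I"
    and iso: "adj J o\<^sub>L J = proj (below n)"
  shows "(\<lambda>r\<in>S. adj J o\<^sub>L r o\<^sub>L J) \<in> ucp I S n"
proof (rule compression_of_cp_map_ucp[OF S _ _ _ _ J, of "\<lambda>r. r"])
  show "x \<in> bounded_ops I I" if "x \<in> S" for x using S that by (auto simp: operator_system_def)
  show "adj J o\<^sub>L proj I o\<^sub>L J = proj (below n)"
    unfolding iso[symmetric] by (rule blinfun_eqI) (simp add: bounded_opsD[OF J])
qed simp_all

lemma ucp_compress:
  assumes S: "operator_system I S" and \<phi>: "\<phi> \<in> ucp I S n" and \<beta>: "\<beta> \<in> isometries m n"
  shows "(\<lambda>r\<in>S. op_compress \<beta> (\<phi> r)) \<in> ucp I S m"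
  unfolding op_compress_def
proof (rule compression_of_cp_map_ucp[OF S])
  show J: "\<beta> \<in> bounded_ops (below m) (below n)" using \<beta> by (simp add: isometries_def)
  have "adj \<beta> o\<^sub>L \<phi> (proj I) o\<^sub>L \<beta> = adj \<beta> o\<^sub>L \<beta>"
    by (rule blinfun_eqI) (simp add: ucpD(4)[OF \<phi>] bounded_opsD[OF J])
  then show "adj \<beta> o\<^sub>L \<phi> (proj I) o\<^sub>L \<beta> = proj (below m)" using \<beta> by (simp add: isometries_def)
qed (fact ucpD[OF \<phi>])+

lemma ucp_positive:
  assumes \<phi>: "\<phi> \<in> ucp I S n" and x: "x \<in> S" and pos: "\<And>\<xi>. cinner (blinfun_apply x \<xi>) \<xi> \<in> \<real>\<^sub>\<ge>\<^sub>0"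
  shows "cinner (\<phi> x \<xi>) \<xi> \<in> \<real>\<^sub>\<ge>\<^sub>0"
proof -
  have "pos_matrix 1 (\<lambda>i j. \<phi> x)"
    by (rule ucpD(6)[OF \<phi>, of 1 "\<lambda>i j. x"]) (use x pos in \<open>simp_all add: pos_matrix_def\<close>)
  then show ?thesis by (auto simp: pos_matrix_def)
qed

text \<open>The matrix with rows \<open>(C, r)\<close> and \<open>(r*, C)\<close> is positive as soon as \<open>norm r \<le> C\<close>, hence so is its
  image. The next two lemmas read off that the off-diagonal entries of the image are adjoint to each
  other and bounded by \<open>C\<close>.\<close>

lemma ucp_matrix2:
  assumes S: "operator_system I S" and \<phi>: "\<phi> \<in> ucp I S n" and r: "r \<in> S" and C: "norm r \<le> C"
  shows "of_real (C * (inner (restrict_ell2 (below n) x) x + inner (restrict_ell2 (below n) y) y))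
     + cinner (\<phi> r y) x + cinner (\<phi> (adj r) x) y \<in> \<real>\<^sub>\<ge>\<^sub>0"
proof -
  define T where "T i j = (if i = (0::nat) then if j = (0::nat) then scale_op (of_real C) (proj I) else r
     else if j = 0 then adj r else scale_op (of_real C) (proj I))" for i j
  have sub: "cop.subspace S" "proj I \<in> S" "S \<subseteq> bounded_ops I I" "adj r \<in> S"
    using S r by (auto simp: operator_system_def)
  have "r \<in> bounded_ops I I" using r sub by blast
  note rb = bounded_opsD[OF this]
  have C0: "0 \<le> C" using norm_ge_zero[of r] C by linarith
  have TS: "T i j \<in> S" for i j
    using sub r cop.subspace_scale[OF sub(1,2)] by (simp add: T_def)
  have "pos_matrix 2 T"
    unfolding pos_matrix_def
  proof
    fix \<xi> :: "nat \<Rightarrow> 'a ell2"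
    define a where "a = restrict_ell2 I (\<xi> 0)"
    define b where "b = restrict_ell2 I (\<xi> 1)"
    have na: "cinner (restrict_ell2 I (\<xi> 0)) (\<xi> 0) = of_real ((norm a)\<^sup>2)"
      using cinner_restrict[of I "a" "\<xi> 0"] by (simp add: a_def cinner_eq_norm_sq)
    have nb: "cinner (restrict_ell2 I (\<xi> 1)) (\<xi> 1) = of_real ((norm b)\<^sup>2)"
      using cinner_restrict[of I "b" "\<xi> 1"] by (simp add: b_def cinner_eq_norm_sq)
    have rab: "cinner (r (\<xi> 1)) (\<xi> 0) = cinner (r b) a"
      using cinner_restrict[of I "r b" "\<xi> 0"] by (simp add: a_def b_def rb)
    have rab': "cinner (adj r (\<xi> 0)) (\<xi> 1) = cnj (cinner (r b) a)"
      unfolding cinner_adj'[OF rb(1)] rab[symmetric] by (rule cinner_commute)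
    have eq: "(\<Sum>i<2. \<Sum>j<2. cinner (T i j (\<xi> j)) (\<xi> i)) =
        of_real C * of_real ((norm a)\<^sup>2) + cinner (r b) a + (cnj (cinner (r b) a) + of_real C * of_real ((norm b)\<^sup>2))"
      by (simp add: numeral_2_eq_2 T_def cinner_cscale_left na nb[unfolded One_nat_def]
          rab[unfolded One_nat_def] rab'[unfolded One_nat_def])
    have "\<bar>inner (r b) a\<bar> \<le> norm (r b) * norm a" by (rule Cauchy_Schwarz_ineq2)
    also have "\<dots> \<le> (C * norm b) * norm a"
      using norm_blinfun[of r b] C by (intro mult_right_mono order_trans[OF norm_blinfun] mult_right_mono) auto
    finally have 1: "\<bar>inner (r b) a\<bar> \<le> C * (norm b * norm a)" by (simp only: mult.assoc)
    have "C * (2 * (norm b * norm a)) \<le> C * ((norm a)\<^sup>2 + (norm b)\<^sup>2)"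
      using sum_squares_bound[of "norm a" "norm b"] C0 by (intro mult_left_mono) (simp_all add: mult_ac)
    then have 2: "0 \<le> C * (norm a)\<^sup>2 + C * (norm b)\<^sup>2 + 2 * inner (r b) a"
      using 1 by (simp add: algebra_simps abs_le_iff)
    show "(\<Sum>i<2. \<Sum>j<2. cinner (T i j (\<xi> j)) (\<xi> i)) \<in> \<real>\<^sub>\<ge>\<^sub>0"
      unfolding eq complex_nonneg_Reals_iff using 2 by (simp add: inner_ell2_def)
  qed
  then have "pos_matrix 2 (\<lambda>i j. \<phi> (T i j))" by (intro ucpD(6)[OF \<phi>] TS)
  from this[unfolded pos_matrix_def, rule_format, of "\<lambda>i. if i = 0 then x else y"]
  have "of_real C * cinner (restrict_ell2 (below n) x) x + cinner (\<phi> r y) x +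
      (cinner (\<phi> (adj r) x) y + of_real C * cinner (restrict_ell2 (below n) y) y) \<in> \<real>\<^sub>\<ge>\<^sub>0"
    by (simp add: numeral_2_eq_2 T_def ucpD(3,4)[OF \<phi>] sub cinner_cscale_left)
  then show ?thesis by (simp add: cinner_restrict_self algebra_simps)
qed

lemma ucp_adj:
  assumes S: "operator_system I S" and \<phi>: "\<phi> \<in> ucp I S n" and r: "r \<in> S"
  shows "\<phi> (adj r) = adj (\<phi> r)"
proof -
  have lin: "clinear (\<phi> r)" by (rule bounded_opsD(1)[OF ucpD(1)[OF \<phi> r]])
  have im: "Im (cinner (\<phi> r y) x) + Im (cinner (\<phi> (adj r) x) y) = 0" for x y
    using ucp_matrix2[OF S \<phi> r order_refl, of x y] by (simp add: complex_nonneg_Reals_iff)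
  \<comment> \<open>The imaginary parts agree at \<open>y\<close>; the real parts are imaginary parts at \<open>\<i> y\<close>.\<close>
  have "cinner (\<phi> r y) x = cinner y (\<phi> (adj r) x)" for x y
  proof (rule complex_eqI)
    show "Im (cinner (\<phi> r y) x) = Im (cinner y (\<phi> (adj r) x))"
      using im[of y x] cinner_commute[of y "\<phi> (adj r) x"] by simp
    show "Re (cinner (\<phi> r y) x) = Re (cinner y (\<phi> (adj r) x))"
      using im[of "cscale \<i> y" x] cinner_commute[of y "\<phi> (adj r) x"]
      by (simp add: clinearD[OF lin] cinner_simps)
  qed
  then show ?thesis by (intro adj_unique[symmetric]) simp
qed

lemma ucp_norm_le:
  assumes S: "operator_system I S" and \<phi>: "\<phi> \<in> ucp I S n" and r: "r \<in> S"
  shows "norm (\<phi> r) \<le> norm r"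
proof (rule norm_le_of_form_bound)
  fix y x
  let ?P = "restrict_ell2 (below n)"
  have lin: "clinear (\<phi> r)" by (rule bounded_opsD(1)[OF ucpD(1)[OF \<phi> r]])
  have "0 \<le> norm r * (inner (?P (- x)) (- x) + inner (?P y) y) + 2 * inner (\<phi> r y) (- x)"
    using ucp_matrix2[OF S \<phi> r order_refl, of "- x" y]
    by (simp add: complex_nonneg_Reals_iff ucp_adj[OF S \<phi> r] cinner_adj'[OF lin]
        inner_ell2_def cinner_commute[of "- x" "\<phi> r y"])
  moreover have "norm r * (inner (?P (- x)) (- x) + inner (?P y) y) \<le> norm r * ((norm x)\<^sup>2 + (norm y)\<^sup>2)"
    using inner_restrict_le[of _ "- x"] inner_restrict_le[of _ y] by (intro mult_left_mono add_mono) simp_all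
  ultimately show "2 * inner (\<phi> r y) x \<le> norm r * ((norm y)\<^sup>2 + (norm x)\<^sup>2)"
    by (simp add: add.commute)
qed simp

section \<open>Direct sums of completely positive maps\<close>

lemma has_sum_finite_sum:
  fixes f :: "'a \<Rightarrow> 'b \<Rightarrow> 'c::topological_comm_monoid_add"
  shows "finite F \<Longrightarrow> (\<And>k. k \<in> F \<Longrightarrow> (f k has_sum s k) A) \<Longrightarrow>
    ((\<lambda>x. \<Sum>k\<in>F. f k x) has_sum (\<Sum>k\<in>F. s k)) A"
  by (induction F rule: finite_induct) (auto intro: has_sum_add)

lemma isometriesD:
  assumes "\<beta> \<in> isometries m n"
  shows "\<beta> \<in> bounded_ops (below m) (below n)" "adj \<beta> (blinfun_apply \<beta> x) = restrict_ell2 (below m) x"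
proof -
  have "adj \<beta> o\<^sub>L \<beta> = proj (below m)" using assms by (simp add: isometries_def)
  from arg_cong[OF this, of "\<lambda>A. A x"] show "adj \<beta> (\<beta> x) = restrict_ell2 (below m) x" by simp
  show "\<beta> \<in> bounded_ops (below m) (below n)" using assms by (simp add: isometries_def)
qed

lemma inner_adj: "clinear T \<Longrightarrow> inner (blinfun_apply T x) y = inner x (adj T y)"
  by (simp add: inner_ell2_def cinner_adj)

lemma isometry_norm_sq:
  assumes "\<beta> \<in> isometries m n" shows "(norm (\<beta> x))\<^sup>2 = inner (restrict_ell2 (below m) x) x"
proof -
  note b = isometriesD[OF assms]
  have "inner (\<beta> x) (\<beta> x) = inner x (adj \<beta> (\<beta> x))"
    by (rule inner_adj[OF bounded_opsD(1)[OF b(1)]])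
  then show ?thesis by (simp add: power2_norm_eq_inner b(2) inner_commute)
qed

context
  fixes N :: "nat set" and m :: "nat \<Rightarrow> enat" and n :: enat and \<alpha> :: "nat \<Rightarrow> (nat, nat) op"
  assumes dec: "decomposition N m n \<alpha>"
begin

lemma decomposition_isometry: "i \<in> N \<Longrightarrow> \<alpha> i \<in> isometries (m i) n"
  using dec by (simp add: decomposition_def)

lemma decomposition_clinear: "i \<in> N \<Longrightarrow> clinear (\<alpha> i)"
  using bounded_opsD(1)[OF isometriesD(1)[OF decomposition_isometry]] .

lemma decomposition_has_sum_norm:
  "((\<lambda>i. (norm (adj (\<alpha> i) \<xi>))\<^sup>2) has_sum inner (restrict_ell2 (below n) \<xi>) \<xi>) N"
proof -
  have "((\<lambda>i. \<alpha> i (adj (\<alpha> i) \<xi>)) has_sum restrict_ell2 (below n) \<xi>) N"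
    using dec by (simp add: decomposition_def)
  from has_sum_bounded_linear[OF bounded_linear_inner_left this, of \<xi>]
  have "((\<lambda>i. inner (\<alpha> i (adj (\<alpha> i) \<xi>)) \<xi>) has_sum inner (restrict_ell2 (below n) \<xi>) \<xi>) N"
    by (simp add: o_def)
  then show ?thesis
    by (rule has_sum_cong[THEN iffD1, rotated])
      (simp add: inner_adj[OF decomposition_clinear] power2_norm_eq_inner)
qed

text \<open>The squared norms of the components of \<open>\<alpha> j x\<close> add up to that of \<open>\<alpha> j x\<close>, which the
  component in \<open>\<alpha> j\<close> attains alone.\<close>

lemma decomposition_orthogonal:
  assumes i: "i \<in> N" and j: "j \<in> N" and ne: "i \<noteq> j"
  shows "adj (\<alpha> i) (\<alpha> j x) = 0"
proof -
  note bj = bounded_opsD[OF isometriesD(1)[OF decomposition_isometry[OF j]]]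
  have jj: "adj (\<alpha> j) (\<alpha> j x) = restrict_ell2 (below (m j)) x"
    by (rule isometriesD(2)[OF decomposition_isometry[OF j]])
  have "(\<Sum>k\<in>{i, j}. (norm (adj (\<alpha> k) (\<alpha> j x)))\<^sup>2) \<le> inner (restrict_ell2 (below n) (\<alpha> j x)) (\<alpha> j x)"
    by (rule finite_sum_le_has_sum[OF decomposition_has_sum_norm]) (use i j in auto)
  also have "\<dots> = (norm (restrict_ell2 (below (m j)) x))\<^sup>2"
    by (simp add: bj power2_norm_eq_inner[symmetric] isometry_norm_sq[OF decomposition_isometry[OF j]]
        inner_restrict_self)
  finally show ?thesis using ne by (simp add: jj)
qed

text \<open>The summands \<open>\<alpha> i (T i (adj (\<alpha> i) \<xi>))\<close> are orthogonal, and their squared norms are dominated by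
  \<open>C\<^sup>2\<close> times those of the components of \<open>\<xi>\<close>, which are summable.\<close>

lemma strong_direct_sum_exists:
  assumes T: "\<And>i. i \<in> N \<Longrightarrow> T i \<in> BL (m i)" and C: "\<And>i. i \<in> N \<Longrightarrow> norm (T i) \<le> C" and "0 \<le> C"
  shows "\<exists>S\<in>BL n. op_dsum N \<alpha> T S"
proof -
  define f where "f \<xi> i = \<alpha> i (T i (adj (\<alpha> i) \<xi>))" for \<xi> i
  have nf: "(norm (f \<xi> i))\<^sup>2 \<le> C\<^sup>2 * (norm (adj (\<alpha> i) \<xi>))\<^sup>2" if i: "i \<in> N" for \<xi> i
  proof -
    have "(norm (f \<xi> i))\<^sup>2 \<le> (norm (T i (adj (\<alpha> i) \<xi>)))\<^sup>2"
      unfolding f_def isometry_norm_sq[OF decomposition_isometry[OF i]] by (rule inner_restrict_le)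
    also have "\<dots> \<le> (C * norm (adj (\<alpha> i) \<xi>))\<^sup>2"
      using C[OF i] by (intro power_mono order_trans[OF norm_blinfun] mult_right_mono) auto
    finally show ?thesis by (simp add: power_mult_distrib)
  qed
  have bound: "(\<lambda>i. C\<^sup>2 * (norm (adj (\<alpha> i) \<xi>))\<^sup>2) summable_on N" for \<xi>
    using has_sum_imp_summable[OF decomposition_has_sum_norm] by (rule summable_on_cmult_right)
  have sq: "(\<lambda>i. (norm (f \<xi> i))\<^sup>2) summable_on N" for \<xi>
    by (rule summable_on_comparison_test[OF bound nf]) auto
  have orth: "inner (f \<xi> i) (f \<xi> j) = 0" if "i \<in> N" "j \<in> N" "i \<noteq> j" for \<xi> i j
    using decomposition_orthogonal[OF that] that by (simp add: f_def inner_adj[OF decomposition_clinear])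
  define F where "F \<xi> = infsum (f \<xi>) N" for \<xi>
  have F: "(f \<xi> has_sum F \<xi>) N" for \<xi>
    unfolding F_def by (rule has_sum_infsum[OF summable_on_orthogonal[OF orth sq]])
  have Ti: "clinear (T i)" if "i \<in> N" for i using bounded_opsD(1)[OF T[OF that]] .
  have cF: "F (cscale c \<xi>) = cscale c (F \<xi>)" for c \<xi>
  proof (rule has_sum_unique[OF F])
    have "((\<lambda>i. cscale c (f \<xi> i)) has_sum cscale c (F \<xi>)) N"
      using has_sum_bounded_linear[OF bounded_linear_cscale F] by (simp add: o_def)
    then show "(f (cscale c \<xi>) has_sum cscale c (F \<xi>)) N"
      by (rule has_sum_cong[THEN iffD1, rotated])
        (simp add: f_def clinearD decomposition_clinear Ti)
  qed
  have bl: "bounded_linear F"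
  proof (rule bounded_linear_intro[of _ C])
    show "F (x + y) = F x + F y" for x y
    proof (rule has_sum_unique[OF F])
      show "(f (x + y) has_sum F x + F y) N"
        using has_sum_add[OF F[of x] F[of y]]
        by (rule has_sum_cong[THEN iffD1, rotated]) (simp add: f_def blinfun.add_right)
    qed
    show "F (r *\<^sub>R x) = r *\<^sub>R F x" for r x by (simp add: scaleR_ell2_def cF)
    show "norm (F x) \<le> norm x * C" for x
    proof (rule power2_le_imp_le)
      have "(norm (F x))\<^sup>2 \<le> infsum (\<lambda>i. (norm (f x i))\<^sup>2) N"
        unfolding F_def by (rule norm_infsum_orthogonal_le[OF orth sq])
      also have "\<dots> \<le> infsum (\<lambda>i. C\<^sup>2 * (norm (adj (\<alpha> i) x))\<^sup>2) N"
        by (rule infsum_mono[OF sq bound nf])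
      also have "\<dots> = C\<^sup>2 * inner (restrict_ell2 (below n) x) x"
        using infsumI[OF decomposition_has_sum_norm] by (simp add: infsum_cmult_right')
      also have "\<dots> \<le> C\<^sup>2 * (norm x)\<^sup>2" by (intro mult_left_mono inner_restrict_le) simp
      finally show "(norm (F x))\<^sup>2 \<le> (norm x * C)\<^sup>2" by (simp add: power_mult_distrib mult.commute)
    qed (use \<open>0 \<le> C\<close> in simp)
  qed
  have ap: "blinfun_apply (Blinfun F) = F" by (rule bounded_linear_Blinfun_apply[OF bl])
  show ?thesis
  proof (rule bexI)
    show "op_dsum N \<alpha> T (Blinfun F)" using F[unfolded f_def[abs_def]] by (simp add: op_dsum_def ap)
    show "Blinfun F \<in> BL n"
    proof (rule bounded_opsI)
      show "clinear (Blinfun F)" by (simp add: clinear_def ap cF)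
      show "Blinfun F (restrict_ell2 (below n) x) = Blinfun F x" for x
        unfolding ap F_def
        by (rule infsum_cong)
          (simp add: f_def bounded_opsD(2)[OF adj_in_bounded_ops[OF isometriesD(1)[OF decomposition_isometry]]])
      show "restrict_ell2 (below n) (Blinfun F x) = Blinfun F x" for x
        unfolding ap
      proof (rule has_sum_unique[OF _ F])
        have "((\<lambda>i. restrict_ell2 (below n) (f x i)) has_sum restrict_ell2 (below n) (F x)) N"
          using has_sum_bounded_linear[OF bounded_linear_restrict_ell2 F] by (simp add: o_def)
        then show "(f x has_sum restrict_ell2 (below n) (F x)) N"
          by (rule has_sum_cong[THEN iffD1, rotated])
            (simp add: f_def bounded_opsD(3)[OF isometriesD(1)[OF decomposition_isometry]])
      qed
    qed
  qed
qed

lemma op_dsum_unique: "op_dsum N \<alpha> x y \<Longrightarrow> op_dsum N \<alpha> x y' \<Longrightarrow> y = y'"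
  unfolding op_dsum_def by (intro blinfun_eqI) (blast intro: has_sum_unique)

lemma op_dsum_add:
  "op_dsum N \<alpha> x y \<Longrightarrow> op_dsum N \<alpha> x' y' \<Longrightarrow> op_dsum N \<alpha> (\<lambda>i. x i + x' i) (y + y')"
  unfolding op_dsum_def by (simp add: plus_blinfun.rep_eq blinfun.add_right has_sum_add)

lemma op_dsum_scale:
  assumes "op_dsum N \<alpha> x y" shows "op_dsum N \<alpha> (\<lambda>i. scale_op c (x i)) (scale_op c y)"
  unfolding op_dsum_def
proof
  fix \<xi>
  have "((\<lambda>i. cscale c (\<alpha> i (x i (adj (\<alpha> i) \<xi>)))) has_sum cscale c (y \<xi>)) N"
    using has_sum_bounded_linear[OF bounded_linear_cscale, of "\<lambda>i. \<alpha> i (x i (adj (\<alpha> i) \<xi>))"] assms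
    by (simp add: o_def op_dsum_def)
  then show "((\<lambda>i. \<alpha> i (scale_op c (x i) (adj (\<alpha> i) \<xi>))) has_sum scale_op c y \<xi>) N"
    unfolding scale_op_apply
    by (rule has_sum_cong[THEN iffD1, rotated]) (simp add: clinearD decomposition_clinear)
qed

lemma op_dsum_cong:
  "(\<And>i. i \<in> N \<Longrightarrow> x i = x' i) \<Longrightarrow> op_dsum N \<alpha> x y \<longleftrightarrow> op_dsum N \<alpha> x' y"
  unfolding op_dsum_def by (intro all_cong1 has_sum_cong) simp

lemma op_dsum_proj: "op_dsum N \<alpha> (\<lambda>i. proj (below (m i))) (proj (below n))"
  unfolding op_dsum_def
proof
  fix \<xi>
  have "((\<lambda>i. \<alpha> i (adj (\<alpha> i) \<xi>)) has_sum proj (below n) \<xi>) N"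
    using dec by (simp add: decomposition_def)
  then show "((\<lambda>i. \<alpha> i (proj (below (m i)) (adj (\<alpha> i) \<xi>))) has_sum proj (below n) \<xi>) N"
    by (rule has_sum_cong[THEN iffD1, rotated])
      (simp add: bounded_opsD(2)[OF isometriesD(1)[OF decomposition_isometry]])
qed

text \<open>Contractivity bounds the \<open>\<phi> i r\<close> uniformly in \<open>i\<close>. Linearity of \<open>\<psi>\<close> is uniqueness of strong limits,
  and each form in the definition of complete positivity is a sum of nonnegative forms of the \<open>\<phi> i\<close>.\<close>

lemma ucp_direct_sum_exists:
  assumes S: "operator_system I S" and \<phi>: "\<And>i. i \<in> N \<Longrightarrow> \<phi> i \<in> ucp I S (m i)"
  shows "\<exists>\<psi>\<in>ucp I S n. \<forall>r\<in>S. op_dsum N \<alpha> (\<lambda>i. \<phi> i r) (\<psi> r)"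
proof -
  have sub: "cop.subspace S" "proj I \<in> S" using S by (auto simp: operator_system_def)
  have "\<exists>T\<in>BL n. op_dsum N \<alpha> (\<lambda>i. \<phi> i r) T" if "r \<in> S" for r
    by (rule strong_direct_sum_exists[of _ "norm r"])
      (use that in \<open>auto intro: ucpD(1)[OF \<phi>] ucp_norm_le[OF S \<phi>]\<close>)
  then obtain \<psi>0 where \<psi>0: "\<And>r. r \<in> S \<Longrightarrow> \<psi>0 r \<in> BL n" "\<And>r. r \<in> S \<Longrightarrow> op_dsum N \<alpha> (\<lambda>i. \<phi> i r) (\<psi>0 r)"
    by metis
  define \<psi> where "\<psi> = restrict \<psi>0 S"
  have \<psi>: "\<psi> r \<in> BL n" "op_dsum N \<alpha> (\<lambda>i. \<phi> i r) (\<psi> r)" if "r \<in> S" for r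
    using \<psi>0[OF that] that by (simp_all add: \<psi>_def)
  have "\<psi> (x + y) = \<psi> x + \<psi> y" if xy: "x \<in> S" "y \<in> S" for x y
  proof (rule op_dsum_unique)
    show "op_dsum N \<alpha> (\<lambda>i. \<phi> i (x + y)) (\<psi> (x + y))"
      by (rule \<psi>(2)) (rule cop.subspace_add[OF sub(1) xy])
    show "op_dsum N \<alpha> (\<lambda>i. \<phi> i (x + y)) (\<psi> x + \<psi> y)"
      using op_dsum_add[OF \<psi>(2)[OF xy(1)] \<psi>(2)[OF xy(2)]]
      by (rule op_dsum_cong[THEN iffD1, rotated]) (simp add: ucpD(2)[OF \<phi> xy])
  qed
  moreover have "\<psi> (scale_op c x) = scale_op c (\<psi> x)" if x: "x \<in> S" for c x
  proof (rule op_dsum_unique)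
    show "op_dsum N \<alpha> (\<lambda>i. \<phi> i (scale_op c x)) (\<psi> (scale_op c x))"
      by (rule \<psi>(2)) (rule cop.subspace_scale[OF sub(1) x])
    show "op_dsum N \<alpha> (\<lambda>i. \<phi> i (scale_op c x)) (scale_op c (\<psi> x))"
      using op_dsum_scale[OF \<psi>(2)[OF x]]
      by (rule op_dsum_cong[THEN iffD1, rotated]) (simp add: ucpD(3)[OF \<phi> x])
  qed
  moreover have "\<psi> (proj I) = proj (below n)"
  proof (rule op_dsum_unique)
    show "op_dsum N \<alpha> (\<lambda>i. \<phi> i (proj I)) (\<psi> (proj I))" by (rule \<psi>(2)[OF sub(2)])
    show "op_dsum N \<alpha> (\<lambda>i. \<phi> i (proj I)) (proj (below n))"
      using op_dsum_proj by (rule op_dsum_cong[THEN iffD1, rotated]) (simp add: ucpD(4)[OF \<phi>])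
  qed
  moreover have "pos_matrix k (\<lambda>i j. \<psi> (T i j))"
    if T: "\<forall>i<k. \<forall>j<k. T i j \<in> S" "pos_matrix k T" for k T
    unfolding pos_matrix_def
  proof
    fix \<xi>
    let ?s = "\<Sum>i<k. \<Sum>j<k. cinner (\<psi> (T i j) (\<xi> j)) (\<xi> i)"
    let ?t = "\<lambda>l. \<Sum>i<k. \<Sum>j<k. cinner (\<alpha> l (\<phi> l (T i j) (adj (\<alpha> l) (\<xi> j)))) (\<xi> i)"
    have "((\<lambda>l. cinner (\<alpha> l (\<phi> l (T i j) (adj (\<alpha> l) (\<xi> j)))) (\<xi> i)) has_sum
        cinner (\<psi> (T i j) (\<xi> j)) (\<xi> i)) N" if "i < k" "j < k" for i j
      using has_sum_bounded_linear[OF bounded_linear_cinner_left] \<psi>(2)[of "T i j"] T that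
      by (fastforce simp: op_dsum_def o_def)
    then have sum: "(?t has_sum ?s) N" by (intro has_sum_finite_sum) auto
    have t: "?t l \<in> \<real>\<^sub>\<ge>\<^sub>0" if l: "l \<in> N" for l
    proof -
      have "pos_matrix k (\<lambda>i j. \<phi> l (T i j))" by (rule ucpD(6)[OF \<phi>[OF l]]) (use T in auto)
      from this[unfolded pos_matrix_def, rule_format, of "\<lambda>i. adj (\<alpha> l) (\<xi> i)"]
      show ?thesis by (simp add: cinner_adj[OF decomposition_clinear[OF l]])
    qed
    have "0 \<le> Re ?s"
      by (rule has_sum_nonneg[OF has_sum_Re[OF sum]]) (use t in \<open>auto simp: complex_nonneg_Reals_iff\<close>)
    moreover have "Im ?s = 0"
    proof (rule has_sum_unique[OF has_sum_Im[OF sum]])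
      show "((\<lambda>l. Im (?t l)) has_sum 0) N"
        by (rule has_sum_0) (use t in \<open>auto simp: complex_nonneg_Reals_iff\<close>)
    qed
    ultimately show "?s \<in> \<real>\<^sub>\<ge>\<^sub>0" by (simp add: complex_nonneg_Reals_iff)
  qed
  moreover have "\<psi> \<in> S \<rightarrow>\<^sub>E BL n" using \<psi>(1) by (auto simp: \<psi>_def)
  ultimately have "\<psi> \<in> ucp I S n" by (simp add: ucp_def)
  then show ?thesis using \<psi>(2) by blast
qed

end

lemma nc_convex_S_nc:
  assumes "operator_system I S" shows "nc_convex (S_nc I S)"
  unfolding nc_convex_def
proof (intro conjI allI ballI impI)
  fix m n \<beta> x assume "\<beta> \<in> isometries m n" "x \<in> level (S_nc I S) n"
  then show "compress (S_nc I S) \<beta> x \<in> level (S_nc I S) m"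
    using ucp_compress[OF assms] by (simp add: S_nc_def)
next
  fix N m n \<alpha> x
  assume "decomposition N m n \<alpha>" "\<forall>i\<in>N. x i \<in> level (S_nc I S) (m i)"
  then show "\<exists>y\<in>level (S_nc I S) n. dsum (S_nc I S) N \<alpha> x y"
    using ucp_direct_sum_exists[OF _ assms, of N m n \<alpha> x] by (simp add: S_nc_def)
qed

section \<open>The generators of the operator system of the prism\<close>

lemma cinner_fibres: "cinner x y = infsum (\<lambda>a. cinner (fibre a x) (fibre a y)) UNIV"
proof -
  have s: "(\<lambda>(a, b). coord x (a, b) * cnj (coord y (a, b))) summable_on UNIV \<times> UNIV"
    using coord_prod_summable[of x y] by (simp add: case_prod_unfold)
  show ?thesis
    unfolding cinner_def fibre.rep_eq using infsum_Sigma'_banach[OF s] by (simp add: case_prod_unfold)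
qed

lemma unitary_rep_one:
  assumes "group G" "\<pi> \<in> unitary_reps G" shows "\<pi> \<one>\<^bsub>G\<^esub> = id_blinfun"
  using hom_one[OF _ assms(1) group_unitary_group, of \<pi>] assms(2)
  by (simp add: unitary_reps_def unitary_group_def)

lemma unitary_rep_mult:
  assumes "\<pi> \<in> unitary_reps G" "g \<in> carrier G" "h \<in> carrier G"
  shows "\<pi> (g \<otimes>\<^bsub>G\<^esub> h) = \<pi> g o\<^sub>L \<pi> h"
  using hom_mult[of \<pi> G unitary_group g h] assms by (simp add: unitary_reps_def unitary_group_def)

lemma clinear_univ_rep:
  fixes G :: "('a, 'c) monoid_scheme"
  assumes g: "g \<in> carrier G" shows "clinear (univ_rep G g)"
  unfolding clinear_def
proof (intro allI coord_eqI)
  fix c x and i :: "'a univ"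
  obtain \<pi> k where i: "i = (\<pi>, k)" by force
  have "clinear (\<pi> g)" if "\<pi> \<in> unitary_reps G"
    using that g unitary_groupD(1)[of "\<pi> g"] by (auto simp: unitary_reps_def hom_def)
  then show "coord (univ_rep G g (cscale c x)) i = coord (cscale c (univ_rep G g x)) i"
    by (simp add: i coord_univ_rep[OF g] fibre_cscale clinearD cscale.rep_eq)
qed

text \<open>The inner product is the sum of those of the fibres. On the fibre over a representation \<open>\<pi>\<close>
  the operators \<open>\<pi> g\<close> and \<open>\<pi> h\<close> are mutually inverse unitaries; on the other fibres both sides vanish.\<close>

lemma adj_univ_rep:
  assumes G: "group G" and g: "g \<in> carrier G" and h: "h \<in> carrier G" and gh: "g \<otimes>\<^bsub>G\<^esub> h = \<one>\<^bsub>G\<^esub>"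
  shows "adj (univ_rep G g) = univ_rep G h"
proof (rule adj_unique, intro allI)
  fix x y
  have "cinner (\<pi> g a) b = cinner a (\<pi> h b)" if \<pi>: "\<pi> \<in> unitary_reps G" for \<pi> a b
  proof -
    have u: "\<pi> g \<in> carrier unitary_group" using \<pi> g by (auto simp: unitary_reps_def hom_def)
    have "\<pi> g o\<^sub>L \<pi> h = id_blinfun"
      using unitary_rep_mult[OF \<pi> g h] unitary_rep_one[OF G \<pi>] gh by simp
    from arg_cong[OF this, of "\<lambda>T. adj (\<pi> g) (T b)"] have "\<pi> h b = adj (\<pi> g) b"
      by (simp add: unitary_groupD[OF u])
    then show ?thesis by (simp add: cinner_adj unitary_groupD(1)[OF u])
  qed
  then show "cinner (univ_rep G g x) y = cinner x (univ_rep G h y)"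
    unfolding cinner_fibres by (intro infsum_cong) (simp add: fibre_univ_rep g h)
qed

lemma univ_rep_in_bounded_ops:
  fixes G :: "('a, 'c) monoid_scheme"
  assumes G: "group G" and g: "g \<in> carrier G"
  shows "univ_rep G g \<in> bounded_ops (univ_index G) (univ_index G)"
proof -
  have o: "\<one>\<^bsub>G\<^esub> \<in> carrier G" by (rule monoid.one_closed[OF group.is_monoid[OF G]])
  have "univ_rep G g = proj (univ_index G) o\<^sub>L univ_rep G g" "univ_rep G g = univ_rep G g o\<^sub>L proj (univ_index G)"
    using univ_rep_mult[OF G o g] univ_rep_mult[OF G g o] G
    by (simp_all add: group.is_monoid monoid.l_one monoid.r_one g univ_rep_one[OF G, symmetric])
  then have "univ_rep G g x = restrict_ell2 (univ_index G) (univ_rep G g x)"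
    "univ_rep G g x = univ_rep G g (restrict_ell2 (univ_index G) x)" for x
    by (metis blinfun_apply_blinfun_compose proj_apply)+
  then show ?thesis by (intro bounded_opsI clinear_univ_rep[OF g]) simp_all
qed

abbreviation prism_index :: "Z3Z2 univ set" where
  "prism_index \<equiv> univ_index Z3_Z2"

lemma
  shows gen_w_sq: "gen_w o\<^sub>L gen_w = adj gen_w"
    and gen_w_adj_gen_w: "gen_w o\<^sub>L adj gen_w = proj prism_index"
    and gen_v_sq: "gen_v o\<^sub>L gen_v = proj prism_index"
    and adj_gen_v: "adj gen_v = gen_v"
    and gen_w_in_bounded_ops: "gen_w \<in> bounded_ops prism_index prism_index"
    and gen_v_in_bounded_ops: "gen_v \<in> bounded_ops prism_index prism_index"
proof -
  let ?G = "integer_mod_group 3" and ?H = "integer_mod_group 2"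
  let ?l = "fp_inl ?G ?H" and ?r = "fp_inr ?G ?H"
  note G = group_integer_mod_group[of 3] and H = group_integer_mod_group[of 2]
  note hl = fp_inl_hom[OF G H, folded Z3_Z2_def] and hr = fp_inr_hom[OF G H, folded Z3_Z2_def]
  have c: "1 \<in> carrier ?G" "2 \<in> carrier ?G" "1 \<in> carrier ?H" by (simp_all add: carrier_integer_mod_group)
  have car: "?l 1 \<in> carrier Z3_Z2" "?l 2 \<in> carrier Z3_Z2" "?r 1 \<in> carrier Z3_Z2"
    using hom_in_carrier[OF hl] hom_in_carrier[OF hr] c by blast+
  have mult: "?l 1 \<otimes>\<^bsub>Z3_Z2\<^esub> ?l 1 = ?l 2" "?l 1 \<otimes>\<^bsub>Z3_Z2\<^esub> ?l 2 = \<one>\<^bsub>Z3_Z2\<^esub>"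
    "?r 1 \<otimes>\<^bsub>Z3_Z2\<^esub> ?r 1 = \<one>\<^bsub>Z3_Z2\<^esub>"
    using hom_mult[OF hl c(1) c(1)] hom_mult[OF hl c(1) c(2)] hom_mult[OF hr c(3) c(3)]
      hom_one[OF hl G group_Z3_Z2] hom_one[OF hr H group_Z3_Z2] by simp_all
  have sq: "gen_w o\<^sub>L gen_w = univ_rep Z3_Z2 (?l 2)"
    by (simp add: gen_w_def univ_rep_mult[OF group_Z3_Z2 car(1,1), symmetric] mult)
  moreover have "adj gen_w = univ_rep Z3_Z2 (?l 2)"
    unfolding gen_w_def by (rule adj_univ_rep[OF group_Z3_Z2 car(1,2) mult(2)])
  ultimately show "gen_w o\<^sub>L gen_w = adj gen_w" by simp
  show "gen_w o\<^sub>L adj gen_w = proj prism_index"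
    using univ_rep_mult[OF group_Z3_Z2 car(1,2)] univ_rep_one[OF group_Z3_Z2]
    by (simp add: \<open>adj gen_w = _\<close> mult) (simp add: gen_w_def)
  show "gen_v o\<^sub>L gen_v = proj prism_index"
    using univ_rep_mult[OF group_Z3_Z2 car(3,3)] univ_rep_one[OF group_Z3_Z2]
    by (simp add: gen_v_def mult)
  show "adj gen_v = gen_v"
    unfolding gen_v_def by (rule adj_univ_rep[OF group_Z3_Z2 car(3,3) mult(3)])
  show "gen_w \<in> bounded_ops prism_index prism_index" "gen_v \<in> bounded_ops prism_index prism_index"
    unfolding gen_w_def gen_v_def by (rule univ_rep_in_bounded_ops[OF group_Z3_Z2] car)+
qed

lemma NCP3_eq_opsys: "NCP3 = opsys prism_index [gen_w, gen_v]"
  unfolding NCP3_def opsys_def gen_w_sq by (rule arg_cong[of _ _ cspan]) (auto simp: adj_gen_v)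

lemma operator_system_NCP3: "operator_system prism_index NCP3"
  unfolding NCP3_eq_opsys
  by (rule operator_system_opsys) (simp add: gen_w_in_bounded_ops gen_v_in_bounded_ops)

lemma NCP3_gens: "proj prism_index \<in> NCP3" "gen_w \<in> NCP3" "adj gen_w \<in> NCP3" "gen_v \<in> NCP3"
  unfolding NCP3_def gen_w_sq by (rule cop.span_base, simp)+

lemma NCP3_add: "x \<in> NCP3 \<Longrightarrow> y \<in> NCP3 \<Longrightarrow> x + y \<in> NCP3"
  and NCP3_scale: "x \<in> NCP3 \<Longrightarrow> scale_op c x \<in> NCP3"
  unfolding NCP3_def by (rule cop.span_add cop.span_scale; assumption)+

definition combination ::
  "('i, 'j) op \<Rightarrow> ('i, 'j) op \<Rightarrow> ('i, 'j) op \<Rightarrow> ('i, 'j) op \<Rightarrow> complex \<times> complex \<times> complex \<times> complex \<Rightarrow> ('i, 'j) op"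
  where "combination p x y z = (\<lambda>(c0, c1, c2, c3).
    scale_op c0 p + (scale_op c1 x + (scale_op c2 y + scale_op c3 z)))"

lemma NCP3_combination:
  assumes "r \<in> NCP3"
  shows "\<exists>k. r = combination (proj prism_index) gen_w (adj gen_w) gen_v k"
proof -
  obtain c0 c1 c2 c3 where "r - scale_op c0 (proj prism_index) - scale_op c1 gen_w
      - scale_op c2 (adj gen_w) - scale_op c3 gen_v = 0"
    using assms unfolding NCP3_def gen_w_sq cop.span_insert cop.span_empty by blast
  then have "r = combination (proj prism_index) gen_w (adj gen_w) gen_v (c0, c1, c2, c3)"
    by (simp add: combination_def algebra_simps)
  then show ?thesis ..
qed

lemma ucp_combination:
  assumes \<phi>: "\<phi> \<in> ucp prism_index NCP3 n"
  shows "\<phi> (combination (proj prism_index) gen_w (adj gen_w) gen_v k)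
    = combination (proj (below n)) (\<phi> gen_w) (adj (\<phi> gen_w)) (\<phi> gen_v) k"
  by (cases k)
    (simp add: combination_def ucpD(2,3,4)[OF \<phi>] NCP3_gens NCP3_add NCP3_scale
      ucp_adj[OF operator_system_NCP3 \<phi>])

text \<open>The hypotheses make \<open>e\<close> a positive multiple of a projection: \<open>c e = e\<^sup>2 = e* e\<close>.\<close>

lemma scaled_projection_positive:
  assumes e: "clinear e" "adj e = e" and sq: "\<And>x. e (blinfun_apply e x) = cscale (of_real c) (e x)"
    and "c > 0"
  shows "cinner (blinfun_apply e x) x \<in> \<real>\<^sub>\<ge>\<^sub>0"
proof -
  have "of_real c * cinner (e x) x = cinner (e x) (e x)"
    using cinner_adj[OF e(1), of "e x" x] e(2) by (simp add: sq cinner_cscale_left)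
  then have "cinner (e x) x = of_real ((norm (e x))\<^sup>2 / c)"
    using \<open>c > 0\<close> by (simp add: cinner_eq_norm_sq field_simps)
  then show ?thesis using \<open>c > 0\<close> by simp
qed

lemma cube_root_identities:
  fixes \<zeta> :: complex
  assumes "\<zeta> ^ 3 = 1"
  shows "\<zeta> * cnj \<zeta> = 1" "\<zeta> * \<zeta> = cnj \<zeta>" "cnj \<zeta> * cnj \<zeta> = \<zeta>"
proof -
  have "norm \<zeta> ^ 3 = 1" using arg_cong[OF assms, of norm] by (simp add: norm_power)
  then have "norm \<zeta> = 1" using power_eq_imp_eq_base[of "norm \<zeta>" 3 1] by simp
  then show 1: "\<zeta> * cnj \<zeta> = 1" by (metis complex_norm_square of_real_1 power_one)
  have "\<zeta> * \<zeta> = (\<zeta> * \<zeta>) * (\<zeta> * cnj \<zeta>)" by (simp add: 1)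
  also have "\<dots> = \<zeta> ^ 3 * cnj \<zeta>" by (simp add: power3_eq_cube mult_ac)
  finally show 2: "\<zeta> * \<zeta> = cnj \<zeta>" by (simp add: assms)
  show "cnj \<zeta> * cnj \<zeta> = \<zeta>" using arg_cong[OF 2, of cnj] by simp
qed

text \<open>A third of this element is the spectral projection of \<open>gen_w\<close> for the eigenvalue \<open>cnj \<zeta>\<close>.\<close>

lemma gen_w_spectral_positive:
  assumes \<zeta>: "\<zeta> ^ 3 = 1"
  shows "cinner (combination (proj prism_index) gen_w (adj gen_w) gen_v (1, \<zeta>, cnj \<zeta>, 0) x) x \<in> \<real>\<^sub>\<ge>\<^sub>0"
proof (rule scaled_projection_positive[of _ 3])
  note w = bounded_opsD[OF gen_w_in_bounded_ops]
  note w' = bounded_opsD[OF adj_in_bounded_ops[OF gen_w_in_bounded_ops]]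
  note v = bounded_opsD[OF gen_v_in_bounded_ops]
  let ?e = "combination (proj prism_index) gen_w (adj gen_w) gen_v (1, \<zeta>, cnj \<zeta>, 0)"
  have lin: "clinear (proj prism_index)" "clinear gen_w" "clinear (adj gen_w)" "clinear gen_v"
    by (simp_all add: w(1) v(1))
  show "clinear ?e" by (simp add: combination_def lin)
  have ww: "gen_w (gen_w x) = adj gen_w x" "gen_w (adj gen_w x) = restrict_ell2 prism_index x" for x
    using arg_cong[OF gen_w_sq, of "\<lambda>T. T x"] arg_cong[OF gen_w_adj_gen_w, of "\<lambda>T. T x"] by simp_all
  have ww': "adj gen_w (gen_w x) = restrict_ell2 prism_index x" "adj gen_w (adj gen_w x) = gen_w x" for x
  proof -
    show "adj gen_w (gen_w x) = restrict_ell2 prism_index x" by (simp add: ww(1)[symmetric]) (simp add: ww)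
    show "adj gen_w (adj gen_w x) = gen_w x" by (simp add: ww(1)[symmetric]) (simp add: ww w)
  qed
  have ex: "?e x = restrict_ell2 prism_index x + (cscale \<zeta> (gen_w x) + cscale (cnj \<zeta>) (adj gen_w x))" for x
    by (simp add: combination_def plus_blinfun.rep_eq cscale_simps cscale_zero)
  show "adj ?e = ?e"
    by (rule adj_unique) (simp add: ex cinner_simps cinner_adj'[OF w(1)] cinner_adj[OF w(1)] cinner_restrict algebra_simps)
  note z = cube_root_identities[OF \<zeta>]
  have alg: "p + (\<zeta> * q + cnj \<zeta> * r) + (\<zeta> * (q + (\<zeta> * r + cnj \<zeta> * p)) + cnj \<zeta> * (r + (\<zeta> * p + cnj \<zeta> * q))) =
      3 * (p + (\<zeta> * q + cnj \<zeta> * r))" for p q r :: complex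
  proof -
    have "\<zeta> * (q + (\<zeta> * r + cnj \<zeta> * p)) = \<zeta> * q + ((\<zeta> * \<zeta>) * r + (\<zeta> * cnj \<zeta>) * p)"
      "cnj \<zeta> * (r + (\<zeta> * p + cnj \<zeta> * q)) = cnj \<zeta> * r + ((\<zeta> * cnj \<zeta>) * p + (cnj \<zeta> * cnj \<zeta>) * q)"
      by (simp_all only: distrib_left mult_ac)
    then show ?thesis by (simp add: z)
  qed
  show "?e (?e x) = cscale (of_real 3) (?e x)" for x
  proof (rule coord_eqI)
    fix i
    show "coord (?e (?e x)) i = coord (cscale (of_real 3) (?e x)) i"
      unfolding ex using alg[of "coord (restrict_ell2 prism_index x) i" "coord (gen_w x) i" "coord (adj gen_w x) i"]
      by (simp add: restrict_add restrict_cscale w w' ww ww' blinfun.add_right clinearD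
          plus_ell2.rep_eq cscale.rep_eq)
  qed
qed simp

lemma gen_v_spectral_positive:
  assumes s: "s = 1 \<or> s = - 1"
  shows "cinner (combination (proj prism_index) gen_w (adj gen_w) gen_v (1, 0, 0, of_real s) x) x \<in> \<real>\<^sub>\<ge>\<^sub>0"
proof (rule scaled_projection_positive[of _ 2])
  note w = bounded_opsD[OF gen_w_in_bounded_ops]
  note v = bounded_opsD[OF gen_v_in_bounded_ops]
  let ?e = "combination (proj prism_index) gen_w (adj gen_w) gen_v (1, 0, 0, of_real s)"
  have vs: "selfadj gen_v" by (rule selfadjI[OF v(1) adj_gen_v])
  show "clinear ?e" by (simp add: combination_def w(1) v(1))
  have vv: "gen_v (gen_v x) = restrict_ell2 prism_index x" for x
    using arg_cong[OF gen_v_sq, of "\<lambda>T. T x"] by simp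
  have ex: "?e x = restrict_ell2 prism_index x + cscale (of_real s) (gen_v x)" for x
    by (simp add: combination_def plus_blinfun.rep_eq cscale_simps cscale_zero)
  show "adj ?e = ?e"
    by (rule adj_unique) (simp add: ex cinner_simps selfadjD[OF vs] cinner_restrict)
  show "?e (?e x) = cscale (of_real 2) (?e x)" for x
    unfolding ex using s
    by (intro coord_eqI) (auto simp: restrict_add restrict_cscale v vv blinfun.add_right clinearD
          plus_ell2.rep_eq cscale.rep_eq algebra_simps)
qed simp

section \<open>The prism as an intersection of half-spaces\<close>

definition omega :: complex where
  "omega = Complex (- 1 / 2) (sqrt 3 / 2)"

lemma omega_sq: "omega ^ 2 = cnj omega"
  by (simp add: omega_def power2_eq_square complex_eq_iff field_simps)

lemma omega_power_cube: "(omega ^ j) ^ 3 = 1"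
proof -
  have "omega ^ 3 = omega ^ 2 * omega" by (simp add: power3_eq_cube power2_eq_square)
  also have "\<dots> = 1" unfolding omega_sq by (simp add: omega_def complex_eq_iff field_simps)
  finally show ?thesis by (simp add: power_mult[symmetric] mult.commute[of j]) (simp add: power_mult)
qed

lemma sum_omega: "(\<Sum>j<3. f (omega ^ j)) = f 1 + f omega + f (cnj omega)"
  by (simp add: numeral_3_eq_3 omega_sq[unfolded power2_eq_square])

text \<open>A root of unity \<open>u \<noteq> 1\<close> of order three satisfies \<open>1 + u + cnj u = 0\<close>, so the vertices satisfy the
  inequalities, and with them their convex hull. Conversely the three affine functions are, up to the factor \<open>3\<close>, the
  barycentric coordinates of \<open>z\<close>.\<close>

lemma triangle_iff:
  "z \<in> convex hull {z :: complex. z ^ 3 = 1} \<longleftrightarrow> (\<forall>\<zeta>. \<zeta> ^ 3 = 1 \<longrightarrow> 0 \<le> 1 + 2 * Re (\<zeta> * z))"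
proof
  have root: "0 \<le> 1 + 2 * Re u" if "u ^ 3 = 1" for u :: complex
  proof -
    note u = cube_root_identities[OF that]
    have "(u - 1) * (1 + u + u * u) = u ^ 3 - 1" by (simp add: power3_eq_cube algebra_simps)
    then have "u = 1 \<or> 1 + u + cnj u = 0" using that u(2) by simp
    then show ?thesis by (auto simp: complex_eq_iff)
  qed
  let ?H = "\<lambda>\<zeta>. {z :: complex. inner (- cnj \<zeta>) z \<le> 1 / 2}"
  assume z: "z \<in> convex hull {z. z ^ 3 = 1}"
  show "\<forall>\<zeta>. \<zeta> ^ 3 = 1 \<longrightarrow> 0 \<le> 1 + 2 * Re (\<zeta> * z)"
  proof (intro allI impI)
    fix \<zeta> :: complex assume \<zeta>: "\<zeta> ^ 3 = 1"
    have "{z. z ^ 3 = 1} \<subseteq> ?H \<zeta>"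
    proof clarify
      fix u :: complex assume "u ^ 3 = 1"
      then have "(\<zeta> * u) ^ 3 = 1" using \<zeta> by (simp add: power_mult_distrib)
      from root[OF this] show "inner (- cnj \<zeta>) u \<le> 1 / 2" by (simp add: inner_complex_def)
    qed
    then have "z \<in> ?H \<zeta>" using hull_minimal[of _ "?H \<zeta>" convex] z convex_halfspace_le by blast
    then show "0 \<le> 1 + 2 * Re (\<zeta> * z)" by (simp add: inner_complex_def)
  qed
next
  assume *: "\<forall>\<zeta>. \<zeta> ^ 3 = 1 \<longrightarrow> 0 \<le> 1 + 2 * Re (\<zeta> * z)"
  let ?l = "\<lambda>\<zeta>. (1 + 2 * Re (\<zeta> * z)) / 3"
  have "(\<Sum>j<3. ?l (omega ^ j) *\<^sub>R cnj (omega ^ j)) \<in> convex hull {z :: complex. z ^ 3 = 1}"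
  proof (rule convex_sum)
    show "(\<Sum>j<3. ?l (omega ^ j)) = 1"
      unfolding sum_omega[of ?l] by (simp add: omega_def field_simps)
    show "0 \<le> ?l (omega ^ j)" for j
      using *[rule_format, OF omega_power_cube[of j]] by simp
    show "cnj (omega ^ j) \<in> convex hull {z. z ^ 3 = 1}" for j
      by (rule hull_inc) (simp add: omega_power_cube complex_cnj_power[symmetric] del: complex_cnj_power)
  qed (simp_all add: convex_convex_hull)
  moreover have "(\<Sum>j<3. ?l (omega ^ j) *\<^sub>R cnj (omega ^ j)) = z"
  proof -
    have "sqrt 3 * (sqrt 3 * y) = 3 * y" for y by (simp flip: mult.assoc)
    then show ?thesis
      unfolding sum_omega[of "\<lambda>\<zeta>. ?l \<zeta> *\<^sub>R cnj \<zeta>"]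
      by (simp add: omega_def complex_eq_iff field_simps)
  qed
  ultimately show "z \<in> convex hull {z. z ^ 3 = 1}" by (simp only:)
qed

lemma P3_iff:
  "(z, t) \<in> P3 \<longleftrightarrow> (\<forall>\<zeta>. \<zeta> ^ 3 = 1 \<longrightarrow> 0 \<le> 1 + 2 * Re (\<zeta> * z)) \<and> \<bar>t\<bar> \<le> 1"
  by (auto simp: P3_def triangle_iff)

section \<open>The maximal noncommutative convex set over the prism\<close>

lemma below_1: "below 1 = {0}"
  by (auto simp: below_def one_enat_def)

text \<open>The vector state of \<open>u\<close> is the compression along the isometry of \<open>\<ell>\<^sup>2(1)\<close> onto the line through \<open>u\<close>.\<close>

lemma vector_state_exists:
  assumes S: "operator_system (below n) S" and u: "restrict_ell2 (below n) u = u" "norm u = 1"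
  shows "\<exists>\<psi>\<in>ucp (below n) S 1. \<forall>r\<in>S. scalar_of (\<psi> r) = cinner (blinfun_apply r u) u"
proof -
  have bl: "bounded_linear (\<lambda>y::nat ell2. cscale (coord y 0) u)"
    by (rule bounded_linear_intro[of _ 1])
      (simp_all add: plus_ell2.rep_eq scaleR_ell2_def cscale.rep_eq cscale_simps norm_cscale u cmod_coord_le)
  define J where "J = Blinfun (\<lambda>y::nat ell2. cscale (coord y 0) u)"
  have Jx: "J y = cscale (coord y 0) u" for y by (simp add: J_def bounded_linear_Blinfun_apply[OF bl])
  have linJ: "clinear J" by (simp add: clinear_def Jx cscale.rep_eq cscale_simps)
  have J: "J \<in> bounded_ops (below 1) (below n)"
    by (rule bounded_opsI[OF linJ]) (simp_all add: Jx restrict_cscale u restrict_ell2.rep_eq below_1)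
  have r0: "restrict_ell2 {0} y = cscale (coord y 0) (ket 0)" for y :: "nat ell2"
    by (rule coord_eqI) (simp add: restrict_ell2.rep_eq cscale.rep_eq ket.rep_eq)
  have "adj J o\<^sub>L J = proj (below 1)"
  proof (rule blinfun_eqI, rule cinner_eqI)
    fix y z
    have "cinner (adj J (J y)) z = coord y 0 * cnj (coord z 0)"
      by (simp add: cinner_adj'[OF linJ] Jx cinner_simps cinner_eq_norm_sq u)
    also have "\<dots> = cinner (restrict_ell2 {0} y) z"
      by (simp add: r0 cinner_simps cinner_commute[of "ket 0" z] cinner_ket)
    finally show "cinner ((adj J o\<^sub>L J) y) z = cinner (proj (below 1) y) z" by (simp add: below_1)
  qed
  note ucp = compression_ucp[OF S J this]
  have "J basis0 = u" by (simp add: Jx basis0.rep_eq cscale_simps)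
  then have "\<forall>r\<in>S. scalar_of ((\<lambda>r\<in>S. adj J o\<^sub>L r o\<^sub>L J) r) = cinner (blinfun_apply r u) u"
    by (simp add: scalar_of_def cinner_adj'[OF linJ])
  with ucp show ?thesis by blast
qed

lemma BL_selfadj: "a \<in> BL n \<Longrightarrow> adj a = a \<Longrightarrow> selfadj a"
  by (intro selfadjI bounded_opsD(1))

text \<open>The inequalities that describe the prism, read as inequalities between selfadjoint operators on
  \<open>\<ell>\<^sup>2(n)\<close>, whose unit is the projection onto \<open>\<ell>\<^sup>2(n)\<close>.\<close>

definition prism_inequalities :: "enat \<Rightarrow> (nat, nat) op \<Rightarrow> (nat, nat) op \<Rightarrow> (nat, nat) op \<Rightarrow> bool" where
  "prism_inequalities n a b c \<longleftrightarrow> (\<forall>x.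
     (\<forall>\<zeta>. \<zeta> ^ 3 = 1 \<longrightarrow>
        0 \<le> inner (restrict_ell2 (below n) x) x + 2 * (Re \<zeta> * inner (a x) x - Im \<zeta> * inner (b x) x)) \<and>
     \<bar>inner (c x) x\<bar> \<le> inner (restrict_ell2 (below n) x) x)"

text \<open>If the joint numerical range lies in the prism, its points given by vector states yield the
  inequalities, by homogeneity for vectors of every norm. Conversely each inequality is the positivity of an element of
  the operator system of the triple, which states preserve.\<close>

lemma P3_max_iff:
  "(a, b, c) \<in> P3_max n \<longleftrightarrow> a \<in> BL n \<and> b \<in> BL n \<and> c \<in> BL n \<and> adj a = a \<and> adj b = b \<and> adj c = c \<and>
    prism_inequalities n a b c"
  (is "_ \<longleftrightarrow> ?R")
proof -
  let ?S = "opsys (below n) [a, b, c]"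
  have gens: "proj (below n) \<in> ?S" "a \<in> ?S" "b \<in> ?S" "c \<in> ?S"
    unfolding opsys_def by (rule cop.span_base, simp)+
  have add: "x \<in> ?S \<Longrightarrow> y \<in> ?S \<Longrightarrow> x + y \<in> ?S" and scale: "x \<in> ?S \<Longrightarrow> scale_op k x \<in> ?S" for x y k
    unfolding opsys_def by (rule cop.span_add cop.span_scale; assumption)+
  have "(\<forall>\<alpha> \<beta> \<gamma>. [\<alpha>, \<beta>, \<gamma>] \<in> W_nc (below n) [a, b, c] 1 \<longrightarrow>
        (Complex (Re (scalar_of \<alpha>)) (Re (scalar_of \<beta>)), Re (scalar_of \<gamma>)) \<in> P3) \<longleftrightarrow>
      prism_inequalities n a b c" (is "?W \<longleftrightarrow> _")
    if ab: "a \<in> BL n" "b \<in> BL n" "c \<in> BL n" and sa: "adj a = a" "adj b = b" "adj c = c"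
  proof -
    have S: "operator_system (below n) ?S" by (rule operator_system_opsys) (use ab in simp)
    note s = BL_selfadj[OF ab(1) sa(1)] BL_selfadj[OF ab(2) sa(2)] BL_selfadj[OF ab(3) sa(3)]
    have W: "?W \<longleftrightarrow> (\<forall>\<psi>\<in>ucp (below n) ?S 1.
        (Complex (Re (scalar_of (\<psi> a))) (Re (scalar_of (\<psi> b))), Re (scalar_of (\<psi> c))) \<in> P3)"
      by (auto simp: W_nc_def)
    show ?thesis
      unfolding W
    proof
      assume L: "\<forall>\<psi>\<in>ucp (below n) ?S 1.
        (Complex (Re (scalar_of (\<psi> a))) (Re (scalar_of (\<psi> b))), Re (scalar_of (\<psi> c))) \<in> P3"
      show "prism_inequalities n a b c"
        unfolding prism_inequalities_def
      proof
        fix x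
        define y where "y = restrict_ell2 (below n) x"
        have eq: "inner (T x) x = inner (T y) y" if "T \<in> BL n" for T
          using cinner_restrict[of "below n" "T y" x] by (simp add: y_def bounded_opsD[OF that] inner_ell2_def)
        have Py: "inner (restrict_ell2 (below n) x) x = (norm y)\<^sup>2"
          by (simp only: inner_restrict_self y_def)
        show "(\<forall>\<zeta>. \<zeta> ^ 3 = 1 \<longrightarrow> 0 \<le> inner (restrict_ell2 (below n) x) x +
              2 * (Re \<zeta> * inner (a x) x - Im \<zeta> * inner (b x) x)) \<and>
            \<bar>inner (c x) x\<bar> \<le> inner (restrict_ell2 (below n) x) x"
        proof (cases "y = 0")
          case True
          then show ?thesis by (simp add: eq ab Py)
        next
          case False
          then have ny: "norm y > 0" by simp
          define u where "u = (1 / norm y) *\<^sub>R y"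
          have u: "restrict_ell2 (below n) u = u" "norm u = 1"
            using ny by (simp_all add: u_def scaleR_ell2_def restrict_cscale y_def)
              (simp add: norm_cscale norm_divide)
          have un: "inner (T x) x = (norm y)\<^sup>2 * Re (cinner (T u) u)" if "T \<in> BL n" for T
            using ny by (simp add: eq[OF that] u_def blinfun.scaleR_right inner_ell2_def[symmetric] power2_eq_square)
          obtain \<psi> where \<psi>: "\<psi> \<in> ucp (below n) ?S 1" "\<And>r. r \<in> ?S \<Longrightarrow> scalar_of (\<psi> r) = cinner (r u) u"
            using vector_state_exists[OF S u] by blast
          have "(Complex (Re (cinner (a u) u)) (Re (cinner (b u) u)), Re (cinner (c u) u)) \<in> P3"
            using L \<psi> gens by auto
          then have 1: "\<And>\<zeta>. \<zeta> ^ 3 = 1 \<Longrightarrow> 0 \<le> 1 + 2 * (Re \<zeta> * Re (cinner (a u) u) - Im \<zeta> * Re (cinner (b u) u))"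
            and 2: "\<bar>Re (cinner (c u) u)\<bar> \<le> 1"
            unfolding P3_iff by simp_all
          show ?thesis
          proof (intro conjI allI impI)
            fix \<zeta> :: complex assume "\<zeta> ^ 3 = 1"
            then have "0 \<le> (norm y)\<^sup>2 * (1 + 2 * (Re \<zeta> * Re (cinner (a u) u) - Im \<zeta> * Re (cinner (b u) u)))"
              using 1 by simp
            then show "0 \<le> inner (restrict_ell2 (below n) x) x + 2 * (Re \<zeta> * inner (a x) x - Im \<zeta> * inner (b x) x)"
              by (simp add: un ab Py algebra_simps)
          next
            show "\<bar>inner (c x) x\<bar> \<le> inner (restrict_ell2 (below n) x) x"
              using mult_left_mono[OF 2, of "(norm y)\<^sup>2"]
              by (simp add: un ab Py abs_mult)
          qed
        qed
      qed
    next
      assume R: "prism_inequalities n a b c"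
      show "\<forall>\<psi>\<in>ucp (below n) ?S 1.
        (Complex (Re (scalar_of (\<psi> a))) (Re (scalar_of (\<psi> b))), Re (scalar_of (\<psi> c))) \<in> P3"
      proof
        fix \<psi> assume \<psi>: "\<psi> \<in> ucp (below n) ?S 1"
        have b1: "cinner (restrict_ell2 (below 1) basis0) basis0 = 1"
        proof -
          have b: "basis0 = ket 0" by (rule coord_eqI) (simp add: basis0.rep_eq ket.rep_eq)
          have r: "restrict_ell2 (below 1) basis0 = basis0"
            by (rule coord_eqI) (simp add: basis0.rep_eq restrict_ell2.rep_eq below_1)
          have "cinner basis0 (ket 0) = 1" by (simp add: cinner_ket basis0.rep_eq)
          then show ?thesis unfolding r using b by metis
        qed
        have pos: "0 \<le> 1 + (p * Re (scalar_of (\<psi> a)) + (q * Re (scalar_of (\<psi> b)) + t * Re (scalar_of (\<psi> c))))"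
          if le: "\<And>x. 0 \<le> inner (restrict_ell2 (below n) x) x + (p * inner (a x) x + (q * inner (b x) x + t * inner (c x) x))"
          for p q t :: real
        proof -
          let ?X = "proj (below n) + (scale_op (of_real p) a + (scale_op (of_real q) b + scale_op (of_real t) c))"
          have X: "?X \<in> ?S" by (intro add scale gens)
          have "cinner (?X x) x = of_real (inner (restrict_ell2 (below n) x) x +
              (p * inner (a x) x + (q * inner (b x) x + t * inner (c x) x)))" for x
            by (simp add: plus_blinfun.rep_eq cinner_simps cinner_restrict_self s[THEN selfadj_cinner_self])
          then have "cinner (?X x) x \<in> \<real>\<^sub>\<ge>\<^sub>0" for x using le[of x] by (simp only: nonneg_Reals_of_real_iff)
          from ucp_positive[OF \<psi> X this, of basis0]
          have "cinner (\<psi> ?X basis0) basis0 \<in> \<real>\<^sub>\<ge>\<^sub>0" .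
          moreover have "\<psi> ?X = proj (below 1) + (scale_op (of_real p) (\<psi> a) +
              (scale_op (of_real q) (\<psi> b) + scale_op (of_real t) (\<psi> c)))"
            by (simp add: ucpD(2,3,4)[OF \<psi>] add scale gens)
          ultimately show ?thesis
            by (simp add: plus_blinfun.rep_eq cinner_simps b1 scalar_of_def complex_nonneg_Reals_iff)
        qed
        have "0 \<le> 1 + 2 * (Re \<zeta> * Re (scalar_of (\<psi> a)) - Im \<zeta> * Re (scalar_of (\<psi> b)))" if "\<zeta> ^ 3 = 1" for \<zeta>
          using pos[of "2 * Re \<zeta>" "- 2 * Im \<zeta>" 0] R that by (simp add: prism_inequalities_def algebra_simps)
        moreover have "0 \<le> 1 + Re (scalar_of (\<psi> c))" "0 \<le> 1 - Re (scalar_of (\<psi> c))"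
        proof -
          have "\<bar>inner (c x) x\<bar> \<le> inner (restrict_ell2 (below n) x) x" for x
            using R by (simp add: prism_inequalities_def)
          then have c: "0 \<le> inner (restrict_ell2 (below n) x) x + inner (c x) x"
            "0 \<le> inner (restrict_ell2 (below n) x) x - inner (c x) x" for x
            by (smt (verit))+
          show "0 \<le> 1 + Re (scalar_of (\<psi> c))" using pos[of 0 0 1] c(1) by simp
          show "0 \<le> 1 - Re (scalar_of (\<psi> c))" using pos[of 0 0 "-1"] c(2) by simp
        qed
        ultimately show "(Complex (Re (scalar_of (\<psi> a))) (Re (scalar_of (\<psi> b))), Re (scalar_of (\<psi> c))) \<in> P3"
          by (simp add: P3_iff abs_le_iff)
      qed
    qed
  qed
  then show ?thesis unfolding P3_max_def by blast
qed

lemmas op_coord_simps = plus_blinfun.rep_eq minus_blinfun.rep_eq scaleR_blinfun.rep_eq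
  scaleR_ell2_def plus_ell2.rep_eq minus_ell2.rep_eq cscale.rep_eq

lemma selfadj_scaleR: "selfadj T \<Longrightarrow> selfadj (r *\<^sub>R T)"
  for T :: "('i, 'i) op"
  unfolding scaleR_eq_scale_op by (rule selfadj_scale_real)

lemma adj_re_op: "clinear x \<Longrightarrow> adj (re_op x) = re_op x"
  by (simp add: re_op_def adj_scale_op adj_add add.commute)

lemma adj_im_op:
  assumes "clinear x" shows "adj (im_op x) = im_op x"
proof -
  have "adj (im_op x) = scale_op (cnj (1 / (2 * \<i>))) (adj x - x)"
    unfolding im_op_def
    by (subst adj_scale_op) (simp_all only: clinear_simps clinear_adj assms adj_diff adj_adj)
  then show ?thesis
    by (simp only: im_op_def) (intro blinfun_eqI coord_eqI, simp add: op_coord_simps field_simps)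
qed

lemma cartesian_decomposition:
  "x = re_op x + scale_op \<i> (im_op x)" "adj x = re_op x + scale_op (- \<i>) (im_op x)"
  by (intro blinfun_eqI coord_eqI, simp add: re_op_def im_op_def op_coord_simps field_simps)+

lemma
  assumes "selfadj a" "selfadj b"
  shows re_op_cartesian: "re_op (a + scale_op \<i> b) = a"
    and im_op_cartesian: "im_op (a + scale_op \<i> b) = b"
proof -
  have "adj (a + scale_op \<i> b) = a + scale_op (- \<i>) b"
    using assms by (simp add: adj_add adj_scale_op selfadj_clinear selfadj_adj)
  then show "re_op (a + scale_op \<i> b) = a" "im_op (a + scale_op \<i> b) = b"
    unfolding re_op_def im_op_def
    by (simp_all only:) (intro blinfun_eqI coord_eqI, simp add: op_coord_simps field_simps)+
qed

lemma re_im_in_bounded_ops: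
  assumes "x \<in> bounded_ops I I" shows "re_op x \<in> bounded_ops I I" "im_op x \<in> bounded_ops I I"
  unfolding re_op_def im_op_def
  by (intro cop.subspace_scale cop.subspace_add cop.subspace_diff subspace_bounded_ops assms
      adj_in_bounded_ops)+

lemma
  assumes "clinear x"
  shows inner_re_op: "inner (re_op x y) y = Re (cinner (x y) y)"
    and inner_im_op: "inner (im_op x y) y = Im (cinner (x y) y)"
proof -
  have "cinner (adj x y) y = cnj (cinner (x y) y)"
    unfolding cinner_adj'[OF assms] by (rule cinner_commute)
  moreover have "re_op x y = cscale (1 / 2) (x y + adj x y)"
    "im_op x y = cscale (1 / (2 * \<i>)) (x y - adj x y)"
    by (simp_all only: re_op_def im_op_def scale_op_apply plus_blinfun.rep_eq minus_blinfun.rep_eq)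
  ultimately show "inner (re_op x y) y = Re (cinner (x y) y)" "inner (im_op x y) y = Im (cinner (x y) y)"
    by (simp_all add: inner_ell2_def cinner_simps complex_diff_cnj)
qed

lemma combination_in_NCP3: "combination (proj prism_index) gen_w (adj gen_w) gen_v k \<in> NCP3"
  by (cases k) (simp add: combination_def NCP3_gens NCP3_add NCP3_scale)

lemma as_triples_prism:
  "as_triples (W_nc prism_index [gen_w, gen_v]) n =
    (\<lambda>\<phi>. (re_op (\<phi> gen_w), im_op (\<phi> gen_w), \<phi> gen_v)) ` ucp prism_index NCP3 n"
  by (auto simp: as_triples_def W_nc_def NCP3_eq_opsys)

lemma ucp_image_prism_inequalities:
  assumes \<phi>: "\<phi> \<in> ucp prism_index NCP3 n"
  shows "prism_inequalities n (re_op (\<phi> gen_w)) (im_op (\<phi> gen_w)) (\<phi> gen_v)"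
  unfolding prism_inequalities_def
proof (intro allI conjI impI)
  let ?x = "\<phi> gen_w" and ?P = "restrict_ell2 (below n)"
  have lin: "clinear ?x" by (rule bounded_opsD(1)[OF ucpD(1)[OF \<phi> NCP3_gens(2)]])
  fix y
  have comb: "combination p q r s (c0, c1, c2, c3) y = cscale c0 (p y) + (cscale c1 (q y) + (cscale c2 (r y) + cscale c3 (s y)))"
    for p q r s :: "(nat, nat) op" and c0 c1 c2 c3
    by (simp add: combination_def plus_blinfun.rep_eq)
  note pos = ucp_positive[OF \<phi> combination_in_NCP3, unfolded ucp_combination[OF \<phi>]]
  have adj: "cinner (adj ?x y) y = cnj (cinner (?x y) y)"
    unfolding cinner_adj'[OF lin] by (rule cinner_commute)
  show "0 \<le> inner (?P y) y + 2 * (Re \<zeta> * inner (re_op ?x y) y - Im \<zeta> * inner (im_op ?x y) y)"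
    if "\<zeta> ^ 3 = 1" for \<zeta>
    using pos[OF gen_w_spectral_positive[OF that], of y]
    by (simp add: comb cscale_simps cscale_zero cinner_simps adj inner_re_op[OF lin] inner_im_op[OF lin]
        complex_nonneg_Reals_iff cinner_restrict_self algebra_simps)
  have "0 \<le> inner (?P y) y + s * inner (\<phi> gen_v y) y" if "s = 1 \<or> s = - 1" for s
    using pos[OF gen_v_spectral_positive[OF that], of y]
    by (simp add: comb cscale_simps cscale_zero cinner_simps complex_nonneg_Reals_iff cinner_restrict_self
        inner_ell2_def[of "\<phi> gen_v y"])
  from this[of 1] this[of "- 1"] show "\<bar>inner (\<phi> gen_v y) y\<bar> \<le> inner (?P y) y" by simp
qed

lemma W_nc_subset_P3_max: "as_triples (W_nc prism_index [gen_w, gen_v]) n \<subseteq> P3_max n"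
  unfolding as_triples_prism
proof clarify
  fix \<phi> assume \<phi>: "\<phi> \<in> ucp prism_index NCP3 n"
  have x: "\<phi> gen_w \<in> BL n" and c: "\<phi> gen_v \<in> BL n" by (rule ucpD(1)[OF \<phi>] NCP3_gens)+
  have "adj (\<phi> gen_v) = \<phi> gen_v"
    using ucp_adj[OF operator_system_NCP3 \<phi> NCP3_gens(4)] by (simp add: adj_gen_v)
  then show "(re_op (\<phi> gen_w), im_op (\<phi> gen_w), \<phi> gen_v) \<in> P3_max n"
    unfolding P3_max_iff
    using x c ucp_image_prism_inequalities[OF \<phi>]
    by (simp add: re_im_in_bounded_ops adj_re_op adj_im_op bounded_opsD(1)[OF x])
qed

text \<open>The positive operators are \<open>Q j = (1 + 2 Re \<zeta> a - 2 Im \<zeta> b) / 3\<close> for the three cube roots \<open>\<zeta>\<close> of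
  unity, where \<open>1\<close> is the identity of all of \<open>\<ell>\<^sup>2\<close>: it dominates the projection onto \<open>\<ell>\<^sup>2(n)\<close> that the
  inequalities provide. They add up to \<open>1\<close>, and by the formula for the barycentric coordinates
  \<open>a + i b\<close> is the sum of the \<open>cnj \<zeta> Q j\<close>.\<close>

lemma prism_unitary_order_3:
  assumes a: "a \<in> BL n" "adj a = a" and b: "b \<in> BL n" "adj b = b" and ineq: "prism_inequalities n a b c"
  obtains W where "W \<in> carrier unitary_group" "W [^]\<^bsub>unitary_group\<^esub> (3::nat) = id_blinfun"
    "adj (cuntz 0) o\<^sub>L W o\<^sub>L cuntz 0 = a + scale_op \<i> b"
proof -
  define q where "q \<zeta> = (1 / 3) *\<^sub>R (id_blinfun + (2 * Re \<zeta>) *\<^sub>R a - (2 * Im \<zeta>) *\<^sub>R b)" for \<zeta> :: complex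
  have s3: "sqrt 3 * (sqrt 3 * y) = 3 * y" for y by (simp flip: mult.assoc)
  show ?thesis
  proof (rule resolution_unitary_dilation[of 3 "\<lambda>j. q (omega ^ j)" "\<lambda>j. cnj (omega ^ j)" 3])
    show "selfadj (q (omega ^ j))" for j
      unfolding q_def by (intro selfadj_scaleR selfadj_diff selfadj_add selfadj_id BL_selfadj[OF a] BL_selfadj[OF b])
    show "0 \<le> inner (q (omega ^ j) x) x" for j x
    proof -
      have "0 \<le> inner (restrict_ell2 (below n) x) x +
          2 * (Re (omega ^ j) * inner (a x) x - Im (omega ^ j) * inner (b x) x)"
        using ineq omega_power_cube[of j] unfolding prism_inequalities_def by blast
      also have "\<dots> \<le> (norm x)\<^sup>2 + 2 * (Re (omega ^ j) * inner (a x) x - Im (omega ^ j) * inner (b x) x)"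
        using inner_restrict_le[of "below n" x] by simp
      also have "\<dots> = 3 * inner (q (omega ^ j) x) x"
        by (simp add: q_def scaleR_blinfun.rep_eq plus_blinfun.rep_eq minus_blinfun.rep_eq
            inner_add_left inner_diff_left power2_norm_eq_inner algebra_simps)
      finally show ?thesis by simp
    qed
    show "(\<Sum>j<3. q (omega ^ j)) = id_blinfun"
      unfolding sum_omega[of q]
      by (intro blinfun_eqI coord_eqI)
        (simp add: q_def omega_def op_coord_simps complex_eq_iff field_simps)
    show "cnj (omega ^ j) ^ 3 = 1" for j
      using arg_cong[OF omega_power_cube[of j], of cnj] by simp
    fix W assume "adj (cuntz 0) o\<^sub>L W o\<^sub>L cuntz 0 = (\<Sum>j<3. scale_op (cnj (omega ^ j)) (q (omega ^ j)))"
    also have "\<dots> = a + scale_op \<i> b"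
      unfolding sum_omega[of "\<lambda>\<zeta>. scale_op (cnj \<zeta>) (q \<zeta>)"]
      by (intro blinfun_eqI coord_eqI)
        (simp add: q_def omega_def op_coord_simps complex_eq_iff field_simps s3)
    finally show "W \<in> carrier unitary_group \<Longrightarrow> W [^]\<^bsub>unitary_group\<^esub> (3::nat) = id_blinfun \<Longrightarrow> thesis"
      by (rule that[rotated 2])
  qed simp
qed

text \<open>The positive operators are \<open>(1 + c) / 2\<close> and \<open>(1 - c) / 2\<close>, for the eigenvalues \<open>1\<close> and \<open>- 1\<close> of the dilation.\<close>

lemma prism_unitary_order_2:
  assumes c: "c \<in> BL n" "adj c = c" and ineq: "prism_inequalities n a b c"
  obtains V where "V \<in> carrier unitary_group" "V [^]\<^bsub>unitary_group\<^esub> (2::nat) = id_blinfun"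
    "adj (cuntz 0) o\<^sub>L V o\<^sub>L cuntz 0 = c"
proof -
  define q where "q j = (1 / 2) *\<^sub>R (id_blinfun + ((- 1) ^ j) *\<^sub>R c)" for j :: nat
  show ?thesis
  proof (rule resolution_unitary_dilation[of 2 q "\<lambda>j. (- 1) ^ j" 2])
    show "selfadj (q j)" for j
      unfolding q_def by (intro selfadj_scaleR selfadj_add selfadj_id BL_selfadj[OF c])
    show "0 \<le> inner (q j x) x" for j x
    proof -
      have "\<bar>inner (c x) x\<bar> \<le> (norm x)\<^sup>2"
        using ineq inner_restrict_le[of "below n" x] unfolding prism_inequalities_def by (blast intro: order_trans)
      then have "0 \<le> (norm x)\<^sup>2 + (- 1) ^ j * inner (c x) x"
        by (cases "even j") (simp_all add: abs_le_iff)
      also have "\<dots> = 2 * inner (q j x) x"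
        by (simp add: q_def scaleR_blinfun.rep_eq plus_blinfun.rep_eq inner_add_left power2_norm_eq_inner)
      finally show ?thesis by simp
    qed
    show "(\<Sum>j<2. q j) = id_blinfun"
      by (intro blinfun_eqI coord_eqI) (simp add: q_def numeral_2_eq_2 op_coord_simps field_simps)
    show "((- 1) ^ j) ^ 2 = (1 :: complex)" for j by (simp add: power_mult[symmetric])
    fix V assume "adj (cuntz 0) o\<^sub>L V o\<^sub>L cuntz 0 = (\<Sum>j<2. scale_op ((- 1) ^ j) (q j))"
    also have "\<dots> = c"
      by (intro blinfun_eqI coord_eqI) (simp add: q_def numeral_2_eq_2 op_coord_simps field_simps)
    finally show "V \<in> carrier unitary_group \<Longrightarrow> V [^]\<^bsub>unitary_group\<^esub> (2::nat) = id_blinfun \<Longrightarrow> thesis"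
      by (rule that[rotated 2])
  qed simp
qed

text \<open>Every representation on \<open>\<ell>\<^sup>2\<close> is a direct summand of the universal one, namely the fibre over itself.\<close>

lemma univ_rep_compress:
  assumes "\<pi> \<in> unitary_reps G" "g \<in> carrier G"
  shows "adj (push (Pair \<pi>)) (univ_rep G g (push (Pair \<pi>) y)) = \<pi> g y"
proof -
  have inj: "inj (Pair \<pi>)" by (simp add: inj_on_def)
  have "fibre \<pi> (push (Pair \<pi>) y) = y"
    using adj_push_push[OF inj, of y] by (intro coord_eqI) (metis coord_adj_push[OF inj] fibre.rep_eq)
  then show ?thesis
    by (intro coord_eqI) (simp add: coord_adj_push[OF inj] coord_univ_rep assms)
qed

text \<open>The map is the compression along \<open>\<ell>\<^sup>2(n) \<subseteq> \<ell>\<^sup>2\<close>, embedded by \<open>cuntz 0\<close> into the fibre of the universal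
  representation over \<open>\<pi>\<close>.\<close>

lemma representation_compression_ucp:
  assumes \<pi>: "\<pi> \<in> unitary_reps G" and S: "operator_system (univ_index G) S"
  shows "\<exists>\<phi>\<in>ucp (univ_index G) S n. \<forall>g\<in>carrier G. univ_rep G g \<in> S \<longrightarrow>
      \<phi> (univ_rep G g) = proj (below n) o\<^sub>L (adj (cuntz 0) o\<^sub>L \<pi> g o\<^sub>L cuntz 0) o\<^sub>L proj (below n)"
proof -
  have inj: "inj (Pair \<pi>)" by (simp add: inj_on_def)
  define J where "J = push (Pair \<pi>) o\<^sub>L cuntz 0 o\<^sub>L proj (below n)"
  have aJ: "adj J = proj (below n) o\<^sub>L (adj (cuntz 0) o\<^sub>L adj (push (Pair \<pi>)))"
    by (simp add: J_def adj_compose)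
  have J: "J \<in> bounded_ops (below n) (univ_index G)"
  proof (rule bounded_opsI)
    show "restrict_ell2 (univ_index G) (J x) = J x" for x
      using \<pi> by (intro coord_eqI) (auto simp: J_def restrict_ell2.rep_eq coord_push univ_index_def)
  qed (simp_all add: J_def)
  have "adj J o\<^sub>L J = proj (below n)"
    by (rule blinfun_eqI) (simp add: aJ, simp add: J_def adj_push_push[OF inj] cuntz_orthogonal)
  note ucp = compression_ucp[OF S J this]
  have "(\<lambda>r\<in>S. adj J o\<^sub>L r o\<^sub>L J) (univ_rep G g) =
      proj (below n) o\<^sub>L (adj (cuntz 0) o\<^sub>L \<pi> g o\<^sub>L cuntz 0) o\<^sub>L proj (below n)"
    if "g \<in> carrier G" "univ_rep G g \<in> S" for g
    using that by (intro blinfun_eqI) (simp add: aJ, simp add: J_def univ_rep_compress[OF \<pi>])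
  with ucp show ?thesis by blast
qed

lemma P3_max_subset_W_nc: "P3_max n \<subseteq> as_triples (W_nc prism_index [gen_w, gen_v]) n"
proof
  fix t assume t: "t \<in> P3_max n"
  obtain a b c where abc: "t = (a, b, c)" by (cases t)
  have bl: "a \<in> BL n" "b \<in> BL n" "c \<in> BL n" and sa: "adj a = a" "adj b = b" "adj c = c"
    and ineq: "prism_inequalities n a b c"
    using t unfolding abc P3_max_iff by auto
  obtain W where W: "W \<in> carrier unitary_group" "W [^]\<^bsub>unitary_group\<^esub> (3::nat) = id_blinfun"
    and cW: "adj (cuntz 0) o\<^sub>L W o\<^sub>L cuntz 0 = a + scale_op \<i> b"
    by (rule prism_unitary_order_3[OF bl(1) sa(1) bl(2) sa(2) ineq])
  obtain V where V: "V \<in> carrier unitary_group" "V [^]\<^bsub>unitary_group\<^esub> (2::nat) = id_blinfun"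
    and cV: "adj (cuntz 0) o\<^sub>L V o\<^sub>L cuntz 0 = c"
    by (rule prism_unitary_order_2[OF bl(3) sa(3) ineq])
  let ?l = "fp_inl (integer_mod_group 3) (integer_mod_group 2) 1"
  let ?r = "fp_inr (integer_mod_group 3) (integer_mod_group 2) 1"
  obtain \<pi> where \<pi>: "\<pi> \<in> unitary_reps Z3_Z2" "\<pi> ?l = W" "\<pi> ?r = V"
    by (rule Z3_Z2_representation[OF W V])
  have car: "?l \<in> carrier Z3_Z2" "?r \<in> carrier Z3_Z2"
    using hom_in_carrier[OF fp_inl_hom[OF group_integer_mod_group group_integer_mod_group], of 1 3 2]
      hom_in_carrier[OF fp_inr_hom[OF group_integer_mod_group group_integer_mod_group], of 1 2 3]
    by (simp_all add: Z3_Z2_def)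
  obtain \<phi> where \<phi>: "\<phi> \<in> ucp prism_index NCP3 n"
    and \<phi>g: "\<And>g. g \<in> carrier Z3_Z2 \<Longrightarrow> univ_rep Z3_Z2 g \<in> NCP3 \<Longrightarrow>
      \<phi> (univ_rep Z3_Z2 g) = proj (below n) o\<^sub>L (adj (cuntz 0) o\<^sub>L \<pi> g o\<^sub>L cuntz 0) o\<^sub>L proj (below n)"
    using representation_compression_ucp[OF \<pi>(1) operator_system_NCP3] by blast
  have x: "a + scale_op \<i> b \<in> BL n"
    by (intro cop.subspace_add cop.subspace_scale subspace_bounded_ops bl)
  have "\<phi> gen_w = a + scale_op \<i> b" "\<phi> gen_v = c"
    using \<phi>g[OF car(1)] \<phi>g[OF car(2)] NCP3_gens x bl(3)
    by (simp_all add: gen_w_def[symmetric] gen_v_def[symmetric] \<pi> cW cV bounded_ops_def)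
  then have "t = (re_op (\<phi> gen_w), im_op (\<phi> gen_w), \<phi> gen_v)"
    using BL_selfadj[OF bl(1) sa(1)] BL_selfadj[OF bl(2) sa(2)]
    by (simp add: abc re_op_cartesian im_op_cartesian)
  then show "t \<in> as_triples (W_nc prism_index [gen_w, gen_v]) n"
    unfolding as_triples_prism using \<phi> by blast
qed

lemma P3_max_eq_W_nc: "P3_max = as_triples (W_nc prism_index [gen_w, gen_v])"
  using P3_max_subset_W_nc W_nc_subset_P3_max by (intro ext equalityI) blast+

section \<open>Continuity in the ultraweak topology\<close>

lemma summable_ultraweak_functional:
  fixes T :: "('i, 'j) op"
  assumes "summable (\<lambda>k. (norm (\<xi> k))\<^sup>2)" "summable (\<lambda>k. (norm (\<eta> k))\<^sup>2)"
  shows "summable (\<lambda>k. cinner (T (\<xi> k)) (\<eta> k))"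
proof (rule summable_comparison_test'[where N = 0])
  show "summable (\<lambda>k. norm T * ((norm (\<xi> k))\<^sup>2 + (norm (\<eta> k))\<^sup>2))"
    by (intro summable_mult summable_add assms)
  fix k
  have "cmod (cinner (T (\<xi> k)) (\<eta> k)) \<le> 2 * (norm (T (\<xi> k)) * norm (\<eta> k))" by (rule cmod_cinner_le)
  also have "\<dots> \<le> 2 * ((norm T * norm (\<xi> k)) * norm (\<eta> k))"
    by (intro mult_left_mono mult_right_mono norm_blinfun) auto
  also have "\<dots> = norm T * (2 * norm (\<xi> k) * norm (\<eta> k))" by simp
  also have "\<dots> \<le> norm T * ((norm (\<xi> k))\<^sup>2 + (norm (\<eta> k))\<^sup>2)"
    by (intro mult_left_mono sum_squares_bound) auto
  finally show "cmod (cinner (T (\<xi> k)) (\<eta> k)) \<le> norm T * ((norm (\<xi> k))\<^sup>2 + (norm (\<eta> k))\<^sup>2)" .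
qed

text \<open>The ultraweak topology is the initial topology of the functionals \<open>T \<mapsto> \<Sum>k. cinner (T (\<xi> k)) (\<eta> k)\<close>.\<close>

lemma continuous_map_ultraweak_iff:
  fixes f :: "'a \<Rightarrow> ('i, 'j) op"
  shows "continuous_map X ultraweak f \<longleftrightarrow> (\<forall>\<xi> \<eta>. summable (\<lambda>k. (norm (\<xi> k))\<^sup>2) \<longrightarrow> summable (\<lambda>k. (norm (\<eta> k))\<^sup>2) \<longrightarrow>
    continuous_map X euclidean (\<lambda>x. \<Sum>k::nat. cinner (blinfun_apply (f x) (\<xi> k)) (\<eta> k)))"
proof -
  let ?F = "\<lambda>\<xi> \<eta> (T :: ('i, 'j) op). \<Sum>k::nat. cinner (blinfun_apply T (\<xi> k)) (\<eta> k)"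
  define S where "S = {{T. ?F \<xi> \<eta> T \<in> U} | \<xi> \<eta> U.
    summable (\<lambda>k. (norm (\<xi> k))\<^sup>2) \<and> summable (\<lambda>k. (norm (\<eta> k))\<^sup>2) \<and> open U}"
  have uw: "ultraweak = topology_generated_by S" by (simp only: ultraweak_def S_def)
  have "UNIV \<in> S"
    unfolding S_def by (rule CollectI, intro exI[of _ "\<lambda>_. 0"] exI[of _ UNIV]) simp
  then have "f ` topspace X \<subseteq> \<Union> S" by blast
  then have *: "continuous_map X ultraweak f \<longleftrightarrow> (\<forall>V. V \<in> S \<longrightarrow> openin X (f -` V \<inter> topspace X))"
    unfolding uw continuous_on_generated_topo_iff by (simp only: simp_thms)
  have vim: "f -` {T. ?F \<xi> \<eta> T \<in> U} \<inter> topspace X = {x \<in> topspace X. ?F \<xi> \<eta> (f x) \<in> U}"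
    for \<xi> :: "nat \<Rightarrow> 'i ell2" and \<eta> :: "nat \<Rightarrow> 'j ell2" and U by blast
  show ?thesis
    unfolding *
  proof (intro iffI allI impI)
    fix \<xi> :: "nat \<Rightarrow> 'i ell2" and \<eta> :: "nat \<Rightarrow> 'j ell2"
    assume H: "\<forall>V. V \<in> S \<longrightarrow> openin X (f -` V \<inter> topspace X)"
      and s: "summable (\<lambda>k. (norm (\<xi> k))\<^sup>2)" "summable (\<lambda>k. (norm (\<eta> k))\<^sup>2)"
    have "openin X {x \<in> topspace X. ?F \<xi> \<eta> (f x) \<in> U}" if "open U" for U
    proof -
      have "{T. ?F \<xi> \<eta> T \<in> U} \<in> S" unfolding S_def using s that by blast
      from H[rule_format, OF this] show ?thesis unfolding vim .
    qed
    then show "continuous_map X euclidean (\<lambda>x. ?F \<xi> \<eta> (f x))" by (simp add: continuous_map_def)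
  next
    fix V assume H: "\<forall>\<xi> \<eta>. summable (\<lambda>k. (norm (\<xi> k))\<^sup>2) \<longrightarrow> summable (\<lambda>k. (norm (\<eta> k))\<^sup>2) \<longrightarrow>
        continuous_map X euclidean (\<lambda>x. ?F \<xi> \<eta> (f x))" and "V \<in> S"
    then obtain \<xi> \<eta> U where V: "V = {T. ?F \<xi> \<eta> T \<in> U}" and U: "open U"
      and s: "summable (\<lambda>k. (norm (\<xi> k))\<^sup>2)" "summable (\<lambda>k. (norm (\<eta> k))\<^sup>2)"
      unfolding S_def by blast
    have "continuous_map X euclidean (\<lambda>x. ?F \<xi> \<eta> (f x))" using H s by blast
    then show "openin X (f -` V \<inter> topspace X)" unfolding V vim using U by (simp add: continuous_map_def)
  qed
qed

lemma continuous_map_ultraweak_const: "continuous_map X ultraweak (\<lambda>x. T)"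
  unfolding continuous_map_ultraweak_iff by simp

lemma continuous_map_ultraweak_add:
  fixes f g :: "'a \<Rightarrow> ('i, 'j) op"
  assumes "continuous_map X ultraweak f" "continuous_map X ultraweak g"
  shows "continuous_map X ultraweak (\<lambda>x. f x + g x)"
  unfolding continuous_map_ultraweak_iff
proof (intro allI impI)
  fix \<xi> :: "nat \<Rightarrow> 'i ell2" and \<eta> :: "nat \<Rightarrow> 'j ell2"
  assume s: "summable (\<lambda>k. (norm (\<xi> k))\<^sup>2)" "summable (\<lambda>k. (norm (\<eta> k))\<^sup>2)"
  have "(\<Sum>k. cinner ((f x + g x) (\<xi> k)) (\<eta> k)) =
      (\<Sum>k. cinner (f x (\<xi> k)) (\<eta> k)) + (\<Sum>k. cinner (g x (\<xi> k)) (\<eta> k))" for x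
    by (simp add: plus_blinfun.rep_eq cinner_add_left suminf_add summable_ultraweak_functional[OF s])
  then show "continuous_map X euclidean (\<lambda>x. \<Sum>k. cinner ((f x + g x) (\<xi> k)) (\<eta> k))"
    using assms s unfolding continuous_map_ultraweak_iff by (simp add: continuous_map_add)
qed

lemma continuous_map_ultraweak_scale:
  fixes f :: "'a \<Rightarrow> ('i, 'j) op"
  assumes "continuous_map X ultraweak f"
  shows "continuous_map X ultraweak (\<lambda>x. scale_op c (f x))"
  unfolding continuous_map_ultraweak_iff
proof (intro allI impI)
  fix \<xi> :: "nat \<Rightarrow> 'i ell2" and \<eta> :: "nat \<Rightarrow> 'j ell2"
  assume s: "summable (\<lambda>k. (norm (\<xi> k))\<^sup>2)" "summable (\<lambda>k. (norm (\<eta> k))\<^sup>2)"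
  have "(\<Sum>k. cinner (scale_op c (f x) (\<xi> k)) (\<eta> k)) = c * (\<Sum>k. cinner (f x (\<xi> k)) (\<eta> k))" for x
    by (simp add: cinner_cscale_left suminf_mult summable_ultraweak_functional[OF s])
  moreover have "continuous_map X euclidean (\<lambda>x. \<Sum>k. cinner (f x (\<xi> k)) (\<eta> k))"
    using assms s unfolding continuous_map_ultraweak_iff by blast
  from continuous_map_compose[OF this, of euclidean "\<lambda>z. c * z"]
  have "continuous_map X euclidean (\<lambda>x. c * (\<Sum>k. cinner (f x (\<xi> k)) (\<eta> k)))"
    by (simp add: o_def continuous_intros)
  ultimately show "continuous_map X euclidean (\<lambda>x. \<Sum>k. cinner (scale_op c (f x) (\<xi> k)) (\<eta> k))"
    by simp
qed

section \<open>The isomorphism with the state space\<close>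

definition gen_triple :: "((Z3Z2 univ, Z3Z2 univ) op \<Rightarrow> (nat, nat) op) \<Rightarrow> op_triple" where
  "gen_triple \<phi> = (re_op (\<phi> gen_w), im_op (\<phi> gen_w), \<phi> gen_v)"

definition triple_combination ::
  "enat \<Rightarrow> op_triple \<Rightarrow> complex \<times> complex \<times> complex \<times> complex \<Rightarrow> (nat, nat) op" where
  "triple_combination n t = combination (proj (below n)) (fst t + scale_op \<i> (fst (snd t)))
     (fst t + scale_op (- \<i>) (fst (snd t))) (snd (snd t))"

text \<open>A choice of coefficients of \<open>r\<close> in terms of \<open>1, w, w*, v\<close>; a linear map on \<open>NCP3\<close> gives
  the same value for every choice.\<close>

definition gen_coeffs :: "(Z3Z2 univ, Z3Z2 univ) op \<Rightarrow> complex \<times> complex \<times> complex \<times> complex" where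
  "gen_coeffs r = (SOME k. r = combination (proj prism_index) gen_w (adj gen_w) gen_v k)"

lemma ucp_eq_triple_combination:
  assumes \<phi>: "\<phi> \<in> ucp prism_index NCP3 n" and r: "r \<in> NCP3"
  shows "\<phi> r = triple_combination n (gen_triple \<phi>) (gen_coeffs r)"
proof -
  have "r = combination (proj prism_index) gen_w (adj gen_w) gen_v (gen_coeffs r)"
    unfolding gen_coeffs_def by (rule someI_ex[OF NCP3_combination[OF r]])
  then have "\<phi> r = combination (proj (below n)) (\<phi> gen_w) (adj (\<phi> gen_w)) (\<phi> gen_v) (gen_coeffs r)"
    using ucp_combination[OF \<phi>, of "gen_coeffs r"] by simp
  then show ?thesis
    unfolding triple_combination_def gen_triple_def fst_conv snd_conv
      cartesian_decomposition[symmetric, of "\<phi> gen_w"] .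
qed

lemma gen_triple_inj: "inj_on gen_triple (ucp prism_index NCP3 n)"
proof (rule inj_onI)
  fix \<phi> \<psi> assume \<phi>: "\<phi> \<in> ucp prism_index NCP3 n" and \<psi>: "\<psi> \<in> ucp prism_index NCP3 n"
    and eq: "gen_triple \<phi> = gen_triple \<psi>"
  show "\<phi> = \<psi>"
  proof (rule extensionalityI[OF ucpD(5)[OF \<phi>] ucpD(5)[OF \<psi>]])
    show "\<phi> r = \<psi> r" if "r \<in> NCP3" for r
      by (simp only: ucp_eq_triple_combination[OF \<phi> that] ucp_eq_triple_combination[OF \<psi> that] eq)
  qed
qed

abbreviation prism_W :: "enat \<Rightarrow> op_triple set" where
  "prism_W \<equiv> as_triples (W_nc prism_index [gen_w, gen_v])"

lemma prism_W_eq: "prism_W n = gen_triple ` ucp prism_index NCP3 n"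
  unfolding as_triples_prism gen_triple_def[abs_def] ..

definition state_of_triple :: "enat \<Rightarrow> op_triple \<Rightarrow> (Z3Z2 univ, Z3Z2 univ) op \<Rightarrow> (nat, nat) op" where
  "state_of_triple n = inv_into (ucp prism_index NCP3 n) gen_triple"

lemma state_of_triple:
  assumes "t \<in> prism_W n"
  shows "state_of_triple n t \<in> ucp prism_index NCP3 n" "gen_triple (state_of_triple n t) = t"
  using assms unfolding prism_W_eq state_of_triple_def
  by (simp_all add: inv_into_into f_inv_into_f)

lemma state_of_gen_triple:
  "\<phi> \<in> ucp prism_index NCP3 n \<Longrightarrow> state_of_triple n (gen_triple \<phi>) = \<phi>"
  unfolding state_of_triple_def by (rule inv_into_f_f[OF gen_triple_inj])

lemma state_of_triple_apply:
  assumes "t \<in> prism_W n" "r \<in> NCP3"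
  shows "state_of_triple n t r = triple_combination n t (gen_coeffs r)"
  using ucp_eq_triple_combination[OF state_of_triple(1)[OF assms(1)] assms(2)]
  by (simp add: state_of_triple(2)[OF assms(1)])

text \<open>Written in this form, the real and imaginary parts of \<open>\<phi> gen_w\<close> are linear combinations of values of \<open>\<phi>\<close>.
  This reduces continuity, compression and direct sums of triples to those of ucp maps.\<close>

lemma re_im_gen:
  assumes \<phi>: "\<phi> \<in> ucp prism_index NCP3 n"
  shows "re_op (\<phi> gen_w) = scale_op (1 / 2) (\<phi> gen_w + \<phi> (adj gen_w))"
    "im_op (\<phi> gen_w) = scale_op (1 / (2 * \<i>)) (\<phi> gen_w + scale_op (- 1) (\<phi> (adj gen_w)))"
proof -
  have adj: "\<phi> (adj gen_w) = adj (\<phi> gen_w)" by (rule ucp_adj[OF operator_system_NCP3 \<phi> NCP3_gens(2)])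
  show "re_op (\<phi> gen_w) = scale_op (1 / 2) (\<phi> gen_w + \<phi> (adj gen_w))" by (simp add: re_op_def adj)
  have "\<phi> gen_w - adj (\<phi> gen_w) = \<phi> gen_w + scale_op (- 1) (adj (\<phi> gen_w))"
    by (intro blinfun_eqI) (simp add: plus_blinfun.rep_eq minus_blinfun.rep_eq cscale_minus_one)
  then show "im_op (\<phi> gen_w) = scale_op (1 / (2 * \<i>)) (\<phi> gen_w + scale_op (- 1) (\<phi> (adj gen_w)))"
    by (simp only: im_op_def adj)
qed

text \<open>In both directions every component of the map is a fixed linear combination of ultraweakly
  continuous maps.\<close>

lemma homeomorphic_map_state_of_triple:
  "homeomorphic_map (level_top (triple_nc_set prism_W) n) (level_top (S_nc prism_index NCP3) n)
     (state_of_triple n)"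
proof (rule homeomorphic_maps_imp_map)
  let ?U = "ucp prism_index NCP3 n"
  let ?P = "prod_topology ultraweak (prod_topology ultraweak ultraweak) :: op_triple topology"
  let ?X = "subtopology ?P (prism_W n)"
  let ?Y = "subtopology (product_topology (\<lambda>_. ultraweak) NCP3) ?U"
  have X: "topspace ?X \<subseteq> prism_W n" and Y: "topspace ?Y \<subseteq> ?U" by auto
  note intros = continuous_map_ultraweak_add continuous_map_ultraweak_scale continuous_map_ultraweak_const
  have ev: "continuous_map ?Y ultraweak (\<lambda>\<phi>. \<phi> r)" if "r \<in> NCP3" for r
    by (intro continuous_map_from_subtopology continuous_map_product_projection that)
  have "continuous_map ?Y ?P (\<lambda>\<phi>. (scale_op (1 / 2) (\<phi> gen_w + \<phi> (adj gen_w)),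
      scale_op (1 / (2 * \<i>)) (\<phi> gen_w + scale_op (- 1) (\<phi> (adj gen_w))), \<phi> gen_v))"
    by (intro continuous_map_pairedI intros ev NCP3_gens)
  then have "continuous_map ?Y ?P gen_triple"
  proof (rule continuous_map_eq)
    fix \<phi> assume "\<phi> \<in> topspace ?Y"
    then have "\<phi> \<in> ?U" using Y by blast
    then show "(scale_op (1 / 2) (\<phi> gen_w + \<phi> (adj gen_w)),
      scale_op (1 / (2 * \<i>)) (\<phi> gen_w + scale_op (- 1) (\<phi> (adj gen_w))), \<phi> gen_v) = gen_triple \<phi>"
      by (simp only: gen_triple_def re_im_gen)
  qed
  then have 1: "continuous_map ?Y ?X gen_triple"
    by (rule continuous_map_into_subtopology) (use Y in \<open>auto simp: prism_W_eq\<close>)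
  have fst: "continuous_map ?X ultraweak fst" "continuous_map ?X ultraweak (\<lambda>t. fst (snd t))"
    "continuous_map ?X ultraweak (\<lambda>t. snd (snd t))"
    using continuous_map_fst_of[OF continuous_map_snd] continuous_map_snd_of[OF continuous_map_snd]
    by (auto intro!: continuous_map_from_subtopology continuous_map_fst simp: o_def)
  have "continuous_map ?X ultraweak (\<lambda>t. state_of_triple n t r)" if r: "r \<in> NCP3" for r
  proof (rule continuous_map_eq)
    show "continuous_map ?X ultraweak (\<lambda>t. triple_combination n t (gen_coeffs r))"
    proof -
      obtain c0 c1 c2 c3 where k: "gen_coeffs r = (c0, c1, c2, c3)" by (cases "gen_coeffs r")
      show ?thesis
        unfolding triple_combination_def combination_def k case_prod_conv by (intro intros fst)
    qed
    show "triple_combination n t (gen_coeffs r) = state_of_triple n t r" if "t \<in> topspace ?X" for t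
      using state_of_triple_apply[OF _ r, of t n] that X by auto
  qed
  moreover have "state_of_triple n ` topspace ?X \<subseteq> extensional NCP3"
    using X ucpD(5)[OF state_of_triple(1)] by blast
  ultimately have "continuous_map ?X (product_topology (\<lambda>_. ultraweak) NCP3) (state_of_triple n)"
    by (auto simp: continuous_map_componentwise)
  then have 2: "continuous_map ?X ?Y (state_of_triple n)"
    by (rule continuous_map_into_subtopology) (use X state_of_triple(1) in blast)
  show "homeomorphic_maps (level_top (triple_nc_set prism_W) n) (level_top (S_nc prism_index NCP3) n)
     (state_of_triple n) gen_triple"
    unfolding homeomorphic_maps_def triple_nc_set_def S_nc_def nc_set.simps
    using 1 2 X Y state_of_triple(2) state_of_gen_triple by blast
qed

lemma bij_betw_state_of_triple:
  "bij_betw (state_of_triple n) (prism_W n) (ucp prism_index NCP3 n)"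
  unfolding prism_W_eq state_of_triple_def
  by (intro bij_betw_inv_into inj_on_imp_bij_betw gen_triple_inj)

lemma gen_triple_compress:
  assumes \<phi>: "\<phi> \<in> ucp prism_index NCP3 n" and \<beta>: "\<beta> \<in> isometries m n"
  shows "gen_triple (\<lambda>r\<in>NCP3. op_compress \<beta> (\<phi> r)) = compress (triple_nc_set K) \<beta> (gen_triple \<phi>)"
proof -
  have lb: "clinear \<beta>" by (rule bounded_opsD(1)[OF isometriesD(1)[OF \<beta>]])
  note \<psi> = ucp_compress[OF operator_system_NCP3 \<phi> \<beta>]
  have lin: "op_compress \<beta> (scale_op c x) = scale_op c (op_compress \<beta> x)"
    "op_compress \<beta> (x + y) = op_compress \<beta> x + op_compress \<beta> y" for c x y
    by (intro blinfun_eqI, simp add: op_compress_def plus_blinfun.rep_eq blinfun.add_right clinearD lb)+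
  show ?thesis
    unfolding gen_triple_def re_im_gen[OF \<phi>] re_im_gen[OF \<psi>] triple_nc_set_def
    by (simp only: nc_set.simps case_prod_conv lin restrict_apply' NCP3_gens)
qed

lemma gen_triple_dsum:
  assumes dec: "decomposition N m n \<alpha>" and \<phi>: "\<And>i. i \<in> N \<Longrightarrow> \<phi> i \<in> ucp prism_index NCP3 (m i)"
    and \<psi>: "\<psi> \<in> ucp prism_index NCP3 n" and sum: "\<And>r. r \<in> NCP3 \<Longrightarrow> op_dsum N \<alpha> (\<lambda>i. \<phi> i r) (\<psi> r)"
  shows "dsum (triple_nc_set K) N \<alpha> (\<lambda>i. gen_triple (\<phi> i)) (gen_triple \<psi>)"
proof -
  have "op_dsum N \<alpha> (\<lambda>i. re_op (\<phi> i gen_w)) (re_op (\<psi> gen_w))"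
    unfolding re_im_gen[OF \<psi>]
    by (subst op_dsum_cong[OF dec re_im_gen(1)[OF \<phi>]])
      (simp, intro op_dsum_scale[OF dec] op_dsum_add[OF dec] sum NCP3_gens)
  moreover have "op_dsum N \<alpha> (\<lambda>i. im_op (\<phi> i gen_w)) (im_op (\<psi> gen_w))"
    unfolding re_im_gen[OF \<psi>]
    by (subst op_dsum_cong[OF dec re_im_gen(2)[OF \<phi>]])
      (assumption, intro op_dsum_scale[OF dec] op_dsum_add[OF dec] sum NCP3_gens)
  ultimately show ?thesis
    using sum[OF NCP3_gens(4)] by (simp add: triple_nc_set_def gen_triple_def)
qed

lemma triple_dsum_cong:
  assumes dec: "decomposition N m n \<alpha>" and eq: "\<And>i. i \<in> N \<Longrightarrow> x i = x' i"
  shows "dsum (triple_nc_set K) N \<alpha> x y \<longleftrightarrow> dsum (triple_nc_set K) N \<alpha> x' y"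
proof -
  obtain a b c where y: "y = (a, b, c)" by (cases y)
  have "op_dsum N \<alpha> (\<lambda>i. f (x i)) z \<longleftrightarrow> op_dsum N \<alpha> (\<lambda>i. f (x' i)) z" for f :: "op_triple \<Rightarrow> _" and z
    by (rule op_dsum_cong[OF dec]) (simp add: eq)
  from this[of fst] this[of "\<lambda>t. fst (snd t)"] this[of "\<lambda>t. snd (snd t)"]
  show ?thesis by (simp only: triple_nc_set_def nc_set.simps y case_prod_conv)
qed

lemma triple_combination_dsum:
  assumes dec: "decomposition N m n \<alpha>" and sum: "dsum (triple_nc_set K) N \<alpha> x y"
  shows "op_dsum N \<alpha> (\<lambda>i. triple_combination (m i) (x i) k) (triple_combination n y k)"
proof -
  obtain a b c where y: "y = (a, b, c)" by (cases y)
  have "op_dsum N \<alpha> (\<lambda>i. fst (x i)) a" "op_dsum N \<alpha> (\<lambda>i. fst (snd (x i))) b"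
    "op_dsum N \<alpha> (\<lambda>i. snd (snd (x i))) c"
    using sum by (simp_all add: triple_nc_set_def y)
  then show ?thesis
    by (cases k) (simp add: y triple_combination_def combination_def op_dsum_add[OF dec]
        op_dsum_scale[OF dec] op_dsum_proj[OF dec] del: cop.scale_minus_left)
qed

text \<open>Both operations are transported from the ucp maps, where compressions and direct sums are
  available.\<close>

lemma nc_convex_prism_W: "nc_convex (triple_nc_set prism_W)"
  unfolding nc_convex_def
proof (intro conjI allI ballI impI)
  fix m n \<beta> t assume \<beta>: "\<beta> \<in> isometries m n" and "t \<in> level (triple_nc_set prism_W) n"
  then obtain \<phi> where \<phi>: "\<phi> \<in> ucp prism_index NCP3 n" "t = gen_triple \<phi>"
    by (auto simp: triple_nc_set_def prism_W_eq)
  then have "compress (triple_nc_set prism_W) \<beta> t \<in> gen_triple ` ucp prism_index NCP3 m"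
    using gen_triple_compress[OF \<phi>(1) \<beta>, of prism_W] ucp_compress[OF operator_system_NCP3 \<phi>(1) \<beta>]
    by (metis imageI)
  then show "compress (triple_nc_set prism_W) \<beta> t \<in> level (triple_nc_set prism_W) m"
    by (simp add: triple_nc_set_def prism_W_eq)
next
  fix N m n \<alpha> x
  assume dec: "decomposition N m n \<alpha>" and x: "\<forall>i\<in>N. x i \<in> level (triple_nc_set prism_W) (m i)"
  let ?\<phi> = "\<lambda>i. state_of_triple (m i) (x i)"
  have xi: "x i \<in> prism_W (m i)" if "i \<in> N" for i using x that by (simp add: triple_nc_set_def)
  note \<phi> = state_of_triple(1)[OF xi]
  obtain \<psi> where \<psi>: "\<psi> \<in> ucp prism_index NCP3 n" and sum: "\<And>r. r \<in> NCP3 \<Longrightarrow> op_dsum N \<alpha> (\<lambda>i. ?\<phi> i r) (\<psi> r)"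
    using ucp_direct_sum_exists[OF dec operator_system_NCP3, of ?\<phi>] \<phi> by blast
  have "dsum (triple_nc_set prism_W) N \<alpha> (\<lambda>i. gen_triple (?\<phi> i)) (gen_triple \<psi>)"
    by (rule gen_triple_dsum[OF dec \<phi> \<psi> sum])
  moreover have "dsum (triple_nc_set prism_W) N \<alpha> (\<lambda>i. gen_triple (?\<phi> i)) (gen_triple \<psi>) \<longleftrightarrow>
      dsum (triple_nc_set prism_W) N \<alpha> x (gen_triple \<psi>)"
    by (rule triple_dsum_cong[OF dec]) (simp add: state_of_triple(2)[OF xi])
  moreover have "gen_triple \<psi> \<in> level (triple_nc_set prism_W) n"
    using \<psi> by (simp add: triple_nc_set_def prism_W_eq)
  ultimately show "\<exists>y\<in>level (triple_nc_set prism_W) n. dsum (triple_nc_set prism_W) N \<alpha> x y" by blast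
qed

lemma nc_iso_state_of_triple:
  "nc_iso (triple_nc_set prism_W) (S_nc prism_index NCP3) state_of_triple"
  unfolding nc_iso_def
proof (intro conjI allI ballI impI)
  fix n
  show "bij_betw (state_of_triple n) (level (triple_nc_set prism_W) n) (level (S_nc prism_index NCP3) n)"
    using bij_betw_state_of_triple by (simp add: triple_nc_set_def S_nc_def)
  show "homeomorphic_map (level_top (triple_nc_set prism_W) n) (level_top (S_nc prism_index NCP3) n)
     (state_of_triple n)" by (rule homeomorphic_map_state_of_triple)
next
  fix m n \<beta> t assume \<beta>: "\<beta> \<in> isometries m n" and "t \<in> level (triple_nc_set prism_W) n"
  then have t: "t \<in> prism_W n" by (simp add: triple_nc_set_def)
  note \<phi> = state_of_triple[OF t]
  have "state_of_triple m (compress (triple_nc_set prism_W) \<beta> t) =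
      (\<lambda>r\<in>NCP3. op_compress \<beta> (state_of_triple n t r))"
    using gen_triple_compress[OF \<phi>(1) \<beta>, of prism_W]
      state_of_gen_triple[OF ucp_compress[OF operator_system_NCP3 \<phi>(1) \<beta>]]
    by (simp add: \<phi>(2))
  then show "state_of_triple m (compress (triple_nc_set prism_W) \<beta> t) =
      compress (S_nc prism_index NCP3) \<beta> (state_of_triple n t)"
    by (simp add: S_nc_def)
next
  fix N m n \<alpha> x y
  assume "y \<in> level (triple_nc_set prism_W) n" and dec: "decomposition N m n \<alpha>"
    and "\<forall>i\<in>N. x i \<in> level (triple_nc_set prism_W) (m i)"
    and sum: "dsum (triple_nc_set prism_W) N \<alpha> x y"
  then have y: "y \<in> prism_W n" and x: "\<And>i. i \<in> N \<Longrightarrow> x i \<in> prism_W (m i)"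
    by (simp_all add: triple_nc_set_def)
  have "op_dsum N \<alpha> (\<lambda>i. state_of_triple (m i) (x i) r) (state_of_triple n y r)" if r: "r \<in> NCP3" for r
    using triple_combination_dsum[OF dec sum, of "gen_coeffs r"]
    by (simp add: op_dsum_cong[OF dec state_of_triple_apply[OF x r]] state_of_triple_apply[OF y r])
  then show "dsum (S_nc prism_index NCP3) N \<alpha> (\<lambda>i. state_of_triple (m i) (x i)) (state_of_triple n y)"
    by (simp add: S_nc_def)
qed

theorem theorem2p4:
  shows "P3_max = as_triples (W_nc (univ_index Z3_Z2) [gen_w, gen_v]) \<and>
    nc_isomorphic
      (triple_nc_set (as_triples (W_nc (univ_index Z3_Z2) [gen_w, gen_v])))
      (S_nc (univ_index Z3_Z2) NCP3)"
  unfolding nc_isomorphic_def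
  using P3_max_eq_W_nc nc_convex_prism_W nc_convex_S_nc[OF operator_system_NCP3] nc_iso_state_of_triple
  by blast

end
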